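(* Let $(W,S)$ be an arbitrary Coxeter system, $I\subseteq S$ arbitrary, and use the notation of the context. The groupoid $Y$ is naturally isomorphic to the fundamental groupoid $\pi_1(\mathcal Y;*,* )$ of the complex $\mathcal Y$ (via the map sending the class of a path in $\mathcal Y$ to the element of $C$ it represents). Hence for each $x\in\mathcal V(C)$ the vertex group $Y_{x,x}$ is isomorphic to the fundamental group $\pi_1(\mathcal Y;x)$.
   Context: **Coxeter groups.** $(W,S)$ is a Coxeter system, $S$ possibly infinite; $m_{s,t}$ is the order of $st$; $\Gamma$ is the Coxeter graph ($s\ne t$ adjacent iff $m_{s,t}\ge 3$, including $\infty$). $V$ is the real space with basis $\{\alpha_s\mid s\in S\}$ and form $\langle\alpha_s,\alpha_t\rangle=-\cos(\pi/m_{s,t})$ ($=-1$ if $m_{s,t}=\infty$); $W$ acts by $s\cdot v=v-2\langle\alpha_s,v\rangle\alpha_s$. $\Phi=\{w\cdot\alpha_s\}$ is the root system, $\Phi^+$ the positive roots. For $J\subseteq S$, $W_J=\langle J\rangle$; $J$ is of finite type if $W_J$ is finite, and then $w_0(J)$ is the longest element of $W_J$. For $J,K\subseteq S$, $J_{\sim K}$ is the union of those connected components of the full subgraph of $\Gamma$ on $J\cup K$ which meet $K$; $J_{\sim s}=J_{\sim\{s\}}$. $\Phi^{\perp J}=\{\gamma\in\Phi\mid\langle\gamma,\alpha_s\rangle=0\ \forall s\in J\}$ and $(\Phi^{\perp J})^+=\Phi^{\perp J}\cap\Phi^+$. **Groupoids.** Fix a set $\Lambda$ with $|\Lambda|=|I|$.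 $S^{(\Lambda)}$ is the set of injections $x:\Lambda\to S$, $x_\lambda=x(\lambda)$, $[x]=x(\Lambda)$. Fix $x_I\in S^{(\Lambda)}$ with $[x_I]=I$. For $x,y\in S^{(\Lambda)}$ put $C_{x,y}=\{w\in W\mid\alpha_{x_\lambda}=w\cdot\alpha_{y_\lambda}\ \forall\lambda\}$, $\mathcal V(C)=\{x\mid C_{x,x_I}\ne\emptyset\}$. $C=\{C_{x,y}\}_{x,y\in\mathcal V(C)}$ is a groupoid under multiplication in $W$ (elements of $C_{x,y}$ have source $y$, target $x$; write $x=w\cdot y$). $Y$ is the subgroupoid with the same vertices and $Y_{x,y}=\{w\in C_{x,y}\mid w\cdot(\Phi^{\perp[y]})^+\subseteq\Phi^+\}$. **Graph $\mathcal C$.** For $x\in\mathcal V(C)$ and $s\in S\smallsetminus[x]$ with $[x]_{\sim s}$ of finite type, let $w_x^s=w_0([x]_{\sim s})w_0([x]_{\sim s}\smallsetminus\{s\})$; it lies in $C_{y,x}$ for a unique $y\in\mathcal V(C)$. $\mathcal C$ is the graph with vertex set $\mathcal V(C)$ and edges $w_x^s$ from $x$ to $w_x^s\cdot x$, where $w_x^s$ and its inverse $w_y^t$ ($y=w_x^s\cdot x$, $\{t\}=([x]\cup\{s\})\smallsetminus[y]$) are identified as the two orientations of one edge. Paths are written from right to left; a path from $x$ to $y$ represents the product of its edges, an element of $C_{y,x}$. **Complex $\mathcal Y$.** The $1$-skeleton $\mathcal Y^1$ is $\mathcal C$ with all loops deleted. For $x\in\mathcal V(C)$ and $s\ne t$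 in $S\smallsetminus[x]$ with $[x]_{\sim\{s,t\}}$ of finite type, put $J=[x]\cup\{s,t\}$, let $\mathcal C(J)$ be the subgraph of $\mathcal C$ consisting of the vertices $y$ with $[y]\subseteq J$ and edges $w_y^{s'}$ with $[y]\cup\{s'\}\subseteq J$, and let $\mathcal G$ be the connected component of $\mathcal C(J)$ containing $x$. $\mathcal G$ is a finite graph in which each vertex is incident to exactly two edges (a loop counting as one edge), so it is either a cycle without loops, or a simple path with a loop at each end. $\mathcal Y$ has one $2$-cell with boundary $\mathcal G$ for each $\mathcal G$ arising in this way which is a cycle without loops. The fundamental groupoid $\pi_1(\mathcal Y;*,* )$, with vertex set $\mathcal V(C)$, is the free groupoid of paths in $\mathcal Y^1$ (opposite orientations of an edge being inverse) modulo the relations that boundaries of $2$-cells are trivial. *)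

theory Defs
  imports
    Complex_Main
    "HOL-Library.FuncSet"
    "HOL-Library.Poly_Mapping"
    "HOL-Algebra.Generated_Groups"
    "HOL-Algebra.Multiplicative_Group"
    "Graph_Theory.Digraph_Component"
    "Graph_Theory.Arc_Walk"
begin

section \<open>Groupoids\<close>

text \<open>\<open>Hom G x y\<close> is the set of morphisms with target \<open>x\<close> and source \<open>y\<close>, so that \<open>Comp G\<close>
  maps \<open>Hom G x y \<times> Hom G y z\<close> to \<open>Hom G x z\<close>. The sets \<open>Hom G x y\<close> need not be disjoint
  for different pairs of objects.\<close>

record ('o, 'm) groupoid_data =
  Obj :: "'o set"
  Hom :: "'o \<Rightarrow> 'o \<Rightarrow> 'm set"
  Comp :: "'m \<Rightarrow> 'm \<Rightarrow> 'm"
  Ident :: "'o \<Rightarrow> 'm"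

locale groupoid =
  fixes G :: "('o, 'm) groupoid_data"
  assumes Ident_closed: "x \<in> Obj G \<Longrightarrow> Ident G x \<in> Hom G x x"
    and Comp_closed: "\<lbrakk>x \<in> Obj G; y \<in> Obj G; z \<in> Obj G; f \<in> Hom G x y; g \<in> Hom G y z\<rbrakk>
      \<Longrightarrow> Comp G f g \<in> Hom G x z"
    and Comp_assoc: "\<lbrakk>x \<in> Obj G; y \<in> Obj G; z \<in> Obj G; u \<in> Obj G;
      f \<in> Hom G x y; g \<in> Hom G y z; h \<in> Hom G z u\<rbrakk>
      \<Longrightarrow> Comp G (Comp G f g) h = Comp G f (Comp G g h)"
    and Comp_Ident_left: "\<lbrakk>x \<in> Obj G; y \<in> Obj G; f \<in> Hom G x y\<rbrakk> \<Longrightarrow> Comp G (Ident G x) f = f"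
    and Comp_Ident_right: "\<lbrakk>x \<in> Obj G; y \<in> Obj G; f \<in> Hom G x y\<rbrakk> \<Longrightarrow> Comp G f (Ident G y) = f"
    and inverse_ex: "\<lbrakk>x \<in> Obj G; y \<in> Obj G; f \<in> Hom G x y\<rbrakk>
      \<Longrightarrow> \<exists>g\<in>Hom G y x. Comp G f g = Ident G x \<and> Comp G g f = Ident G y"

definition groupoid_iso ::
  "('o, 'm) groupoid_data \<Rightarrow> ('p, 'n) groupoid_data \<Rightarrow> ('o \<Rightarrow> 'p) \<Rightarrow> ('m \<Rightarrow> 'n) \<Rightarrow> bool" where
  "groupoid_iso G H F \<phi> \<longleftrightarrow>
     bij_betw F (Obj G) (Obj H) \<and>
     (\<forall>x\<in>Obj G. \<forall>y\<in>Obj G. bij_betw \<phi> (Hom G x y) (Hom H (F x) (F y))) \<and>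
     (\<forall>x\<in>Obj G. \<forall>y\<in>Obj G. \<forall>z\<in>Obj G. \<forall>f\<in>Hom G x y. \<forall>g\<in>Hom G y z.
        \<phi> (Comp G f g) = Comp H (\<phi> f) (\<phi> g)) \<and>
     (\<forall>x\<in>Obj G. \<phi> (Ident G x) = Ident H (F x))"

definition vertex_group :: "('o, 'm) groupoid_data \<Rightarrow> 'o \<Rightarrow> 'm monoid" where
  "vertex_group G x = \<lparr>carrier = Hom G x x, monoid.mult = Comp G, one = Ident G x\<rparr>"


section \<open>Combinatorial 2-complexes and their fundamental groupoids\<close>

text \<open>The 1-skeleton is a multigraph given by its oriented edges: each edge contributes an arc
  \<open>e\<close> and the opposite arc \<open>opp e\<close>. Every 2-cell is attached along an embedded cycle without
  loops, and is given by the set of all arcs (in both orientations) of that cycle.\<close>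

record ('v, 'e) two_complex =
  skel :: "('v, 'e) pre_digraph"
  opp :: "'e \<Rightarrow> 'e"
  cells :: "'e set set"

text \<open>The closed walk \<open>p\<close> goes once around a cycle whose set of arcs is \<open>D\<close>. The library notion
  \<^const>\<open>pre_digraph.cycle\<close> admits going back and forth along a single edge, which the
  second condition excludes; two distinct parallel edges do form a cycle.\<close>

definition traverses ::
  "('v, 'e) pre_digraph \<Rightarrow> ('e \<Rightarrow> 'e) \<Rightarrow> 'e list \<Rightarrow> 'e set \<Rightarrow> bool" where
  "traverses G op p D \<longleftrightarrow>
     pre_digraph.cycle G p \<and> set p \<inter> op ` set p = {} \<and> D = set p \<union> op ` set p"

text \<open>A triple \<open>(u, p, v)\<close> stands for the walk \<open>p\<close> from \<open>u\<close> to \<open>v\<close>, whose first arc is the head of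
  the list \<open>p\<close>; carrying the end points keeps the empty walks at different vertices apart.\<close>

type_synonym ('v, 'e) walk = "'v \<times> 'e list \<times> 'v"

definition homotopy_step ::
  "('v, 'e) two_complex \<Rightarrow> (('v, 'e) walk \<times> ('v, 'e) walk) set" where
  "homotopy_step X = {((u, a @ b @ c, v), (u, a @ c, v)) | u v a b c.
     pre_digraph.awalk (skel X) u (a @ b @ c) v \<and> pre_digraph.awalk (skel X) u (a @ c) v \<and>
     ((\<exists>e. b = [e, opp X e]) \<or> (\<exists>D\<in>cells X. traverses (skel X) (opp X) b D))}"

definition homotopic ::
  "('v, 'e) two_complex \<Rightarrow> (('v, 'e) walk \<times> ('v, 'e) walk) set" where
  "homotopic X = (homotopy_step X \<union> (homotopy_step X)\<inverse>)\<^sup>*"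

definition homotopy_class ::
  "('v, 'e) two_complex \<Rightarrow> ('v, 'e) walk \<Rightarrow> ('v, 'e) walk set" where
  "homotopy_class X w = homotopic X `` {w}"

definition fundamental_groupoid ::
  "('v, 'e) two_complex \<Rightarrow> ('v, ('v, 'e) walk set) groupoid_data" where
  "fundamental_groupoid X =
     \<lparr>Obj = verts (skel X),
      Hom = (\<lambda>x y. {(y, p, x) | p. pre_digraph.awalk (skel X) y p x} // homotopic X),
      Comp = (\<lambda>A B. homotopic X `` {(u, q @ p, w) | u v w p q. (v, p, w) \<in> A \<and> (u, q, v) \<in> B}),
      Ident = (\<lambda>x. homotopy_class X (x, [], x))\<rparr>"

definition fundamental_group ::
  "('v, 'e) two_complex \<Rightarrow> 'v \<Rightarrow> ('v, 'e) walk set monoid" where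
  "fundamental_group X x = vertex_group (fundamental_groupoid X) x"

definition delete_loops :: "('v, 'e) pre_digraph \<Rightarrow> ('v, 'e) pre_digraph" where
  "delete_loops G = G\<lparr>arcs := {e \<in> arcs G. tail G e \<noteq> head G e}\<rparr>"

definition component_of :: "('v, 'e) pre_digraph \<Rightarrow> 'v \<Rightarrow> ('v, 'e) pre_digraph" where
  "component_of G x = G \<restriction> {y. reachable (with_proj (mk_symmetric G)) x y}"

definition cycle_without_loops :: "('v, 'e) pre_digraph \<Rightarrow> ('e \<Rightarrow> 'e) \<Rightarrow> bool" where
  "cycle_without_loops G op \<longleftrightarrow>
     (\<forall>e\<in>arcs G. tail G e \<noteq> head G e) \<and> (\<exists>p. traverses G op p (arcs G))"


section \<open>Coxeter systems\<close>

definition word_prod :: "('a, 'b) monoid_scheme \<Rightarrow> 'a list \<Rightarrow> 'a" where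
  "word_prod W ws = foldr (monoid.mult W) ws \<one>\<^bsub>W\<^esub>"

text \<open>Insertion of a defining relator \<open>(s t)\<^sup>m\<close>, where \<open>m\<close> is the order of \<open>s t\<close>. As
  \<^const>\<open>group.ord\<close> is \<open>0\<close> for elements of infinite order, the relator is then the empty word. For
  \<open>s = t\<close> the relator is \<open>s s\<close>, so words in \<open>S\<close> without formal inverses suffice to
  describe the group presented by these relators.\<close>

definition coxeter_step :: "('a, 'b) monoid_scheme \<Rightarrow> 'a set \<Rightarrow> ('a list \<times> 'a list) set" where
  "coxeter_step W S = {(u @ v, u @ concat (replicate (group.ord W (s \<otimes>\<^bsub>W\<^esub> t)) [s, t]) @ v) | u v s t.
     set u \<subseteq> S \<and> set v \<subseteq> S \<and> s \<in> S \<and> t \<in> S}"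

locale coxeter_system = group W for W :: "('a, 'b) monoid_scheme" (structure) +
  fixes S :: "'a set"
  assumes S_subset: "S \<subseteq> carrier W"
    and S_generates: "generate W S = carrier W"
    and S_involution: "s \<in> S \<Longrightarrow> ord s = 2"
    and S_presentation: "\<lbrakk>set u \<subseteq> S; set v \<subseteq> S; word_prod W u = word_prod W v\<rbrakk>
      \<Longrightarrow> (u, v) \<in> (coxeter_step W S \<union> (coxeter_step W S)\<inverse>)\<^sup>*"
begin

text \<open>The value \<open>0\<close> encodes \<open>m\<^sub>s\<^sub>,\<^sub>t = \<infinity>\<close>.\<close>

definition m :: "'a \<Rightarrow> 'a \<Rightarrow> nat" where
  "m s t = ord (s \<otimes> t)"

definition len :: "'a \<Rightarrow> nat" where
  "len w = (LEAST n. \<exists>ws. set ws \<subseteq> S \<and> word_prod W ws = w \<and> length ws = n)"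

definition parabolic :: "'a set \<Rightarrow> 'a set" where
  "parabolic J = generate W J"

definition finite_type :: "'a set \<Rightarrow> bool" where
  "finite_type J \<longleftrightarrow> finite (parabolic J)"

definition w0 :: "'a set \<Rightarrow> 'a" where
  "w0 J = (THE w. is_arg_max len (\<lambda>u. u \<in> parabolic J) w)"

definition coxeter_graph :: "('a \<times> 'a) set" where
  "coxeter_graph = {(s, t). s \<in> S \<and> t \<in> S \<and> s \<noteq> t \<and> (m s t \<ge> 3 \<or> m s t = 0)}"

text \<open>\<open>J\<^sub>\<sim>\<^sub>K\<close>: the vertices joined to some element of \<open>K\<close> by a path inside \<open>J \<union> K\<close>.\<close>

definition sim :: "'a set \<Rightarrow> 'a set \<Rightarrow> 'a set" where
  "sim J K = (coxeter_graph \<inter> (J \<union> K) \<times> (J \<union> K))\<^sup>* `` K"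


subsection \<open>The geometric representation and the root system\<close>

text \<open>Vectors are finitely supported functions; \<open>V\<close> consists of those supported in \<open>S\<close>.\<close>

definition simple_root :: "'a \<Rightarrow> 'a \<Rightarrow>\<^sub>0 real" where
  "simple_root s = Poly_Mapping.single s 1"

definition form :: "('a \<Rightarrow>\<^sub>0 real) \<Rightarrow> ('a \<Rightarrow>\<^sub>0 real) \<Rightarrow> real" where
  "form u v = (\<Sum>s\<in>Poly_Mapping.keys u. \<Sum>t\<in>Poly_Mapping.keys v. Poly_Mapping.lookup u s * Poly_Mapping.lookup v t *
     (if m s t = 0 then - 1 else - cos (pi / real (m s t))))"

definition reflect :: "'a \<Rightarrow> ('a \<Rightarrow>\<^sub>0 real) \<Rightarrow> ('a \<Rightarrow>\<^sub>0 real)" where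
  "reflect s v = v - Poly_Mapping.single s (2 * form (simple_root s) v)"

text \<open>The reflections satisfy the defining relations of \<open>W\<close>, so the value does not depend on the
  word representing \<open>w\<close>.\<close>

definition act :: "'a \<Rightarrow> ('a \<Rightarrow>\<^sub>0 real) \<Rightarrow> ('a \<Rightarrow>\<^sub>0 real)" where
  "act w v = (THE u. \<exists>ws. set ws \<subseteq> S \<and> word_prod W ws = w \<and> u = foldr reflect ws v)"

definition roots :: "('a \<Rightarrow>\<^sub>0 real) set" where
  "roots = {act w (simple_root s) | w s. w \<in> carrier W \<and> s \<in> S}"

definition pos_roots :: "('a \<Rightarrow>\<^sub>0 real) set" where
  "pos_roots = {\<gamma> \<in> roots. \<forall>s. Poly_Mapping.lookup \<gamma> s \<ge> 0}"

definition perp_roots :: "'a set \<Rightarrow> ('a \<Rightarrow>\<^sub>0 real) set" where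
  "perp_roots J = {\<gamma> \<in> roots. \<forall>s\<in>J. form \<gamma> (simple_root s) = 0}"


subsection \<open>The groupoids \<open>C\<close> and \<open>Y\<close>\<close>

definition injections :: "'l set \<Rightarrow> ('l \<Rightarrow> 'a) set" where
  "injections \<Lambda> = {x \<in> \<Lambda> \<rightarrow>\<^sub>E S. inj_on x \<Lambda>}"

definition C_hom :: "'l set \<Rightarrow> ('l \<Rightarrow> 'a) \<Rightarrow> ('l \<Rightarrow> 'a) \<Rightarrow> 'a set" where
  "C_hom \<Lambda> x y = {w \<in> carrier W. \<forall>l\<in>\<Lambda>. simple_root (x l) = act w (simple_root (y l))}"

definition C_vertices :: "'l set \<Rightarrow> ('l \<Rightarrow> 'a) \<Rightarrow> ('l \<Rightarrow> 'a) set" where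
  "C_vertices \<Lambda> xI = {x \<in> injections \<Lambda>. C_hom \<Lambda> x xI \<noteq> {}}"

definition Y_hom :: "'l set \<Rightarrow> ('l \<Rightarrow> 'a) \<Rightarrow> ('l \<Rightarrow> 'a) \<Rightarrow> 'a set" where
  "Y_hom \<Lambda> x y = {w \<in> C_hom \<Lambda> x y. act w ` (perp_roots (y ` \<Lambda>) \<inter> pos_roots) \<subseteq> pos_roots}"

definition Y_groupoid :: "'l set \<Rightarrow> ('l \<Rightarrow> 'a) \<Rightarrow> ('l \<Rightarrow> 'a, 'a) groupoid_data" where
  "Y_groupoid \<Lambda> xI =
     \<lparr>Obj = C_vertices \<Lambda> xI, Hom = Y_hom \<Lambda>, Comp = (\<otimes>), Ident = (\<lambda>x. \<one>)\<rparr>"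


subsection \<open>The graph \<open>\<C>\<close>\<close>

text \<open>The arc \<open>(x, s)\<close> is the oriented edge \<open>w\<^sub>x\<^sup>s\<close>, with source \<open>x\<close> and target \<open>w\<^sub>x\<^sup>s \<cdot> x\<close>.\<close>

definition arc_elt :: "'l set \<Rightarrow> ('l \<Rightarrow> 'a) \<times> 'a \<Rightarrow> 'a" where
  "arc_elt \<Lambda> = (\<lambda>(x, s). w0 (sim (x ` \<Lambda>) {s}) \<otimes> w0 (sim (x ` \<Lambda>) {s} - {s}))"

definition arc_target :: "'l set \<Rightarrow> ('l \<Rightarrow> 'a) \<Rightarrow> ('l \<Rightarrow> 'a) \<times> 'a \<Rightarrow> ('l \<Rightarrow> 'a)" where
  "arc_target \<Lambda> xI e = (THE y. y \<in> C_vertices \<Lambda> xI \<and> arc_elt \<Lambda> e \<in> C_hom \<Lambda> y (fst e))"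

definition arc_opp :: "'l set \<Rightarrow> ('l \<Rightarrow> 'a) \<Rightarrow> ('l \<Rightarrow> 'a) \<times> 'a \<Rightarrow> ('l \<Rightarrow> 'a) \<times> 'a" where
  "arc_opp \<Lambda> xI = (\<lambda>(x, s). let y = arc_target \<Lambda> xI (x, s)
     in (y, the_elem ((x ` \<Lambda> \<union> {s}) - y ` \<Lambda>)))"

definition C_graph :: "'l set \<Rightarrow> ('l \<Rightarrow> 'a) \<Rightarrow> ('l \<Rightarrow> 'a, ('l \<Rightarrow> 'a) \<times> 'a) pre_digraph" where
  "C_graph \<Lambda> xI =
     \<lparr>verts = C_vertices \<Lambda> xI,
      arcs = {(x, s). x \<in> C_vertices \<Lambda> xI \<and> s \<in> S - x ` \<Lambda> \<and> finite_type (sim (x ` \<Lambda>) {s})},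
      tail = fst,
      head = arc_target \<Lambda> xI\<rparr>"

definition C_graph_on ::
  "'l set \<Rightarrow> ('l \<Rightarrow> 'a) \<Rightarrow> 'a set \<Rightarrow> ('l \<Rightarrow> 'a, ('l \<Rightarrow> 'a) \<times> 'a) pre_digraph" where
  "C_graph_on \<Lambda> xI J = (C_graph \<Lambda> xI)
     \<lparr>verts := {y \<in> verts (C_graph \<Lambda> xI). y ` \<Lambda> \<subseteq> J},
      arcs := {(y, s) \<in> arcs (C_graph \<Lambda> xI). y ` \<Lambda> \<union> {s} \<subseteq> J}\<rparr>"

text \<open>As walks are listed in the order of traversal but represent products written from right to
  left, the first arc of the list becomes the rightmost factor.\<close>

definition walk_elt :: "'l set \<Rightarrow> (('l \<Rightarrow> 'a) \<times> 'a) list \<Rightarrow> 'a" where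
  "walk_elt \<Lambda> p = fold (\<lambda>e w. arc_elt \<Lambda> e \<otimes> w) p \<one>"


subsection \<open>The complex \<open>\<Y>\<close>\<close>

definition Y_complex :: "'l set \<Rightarrow> ('l \<Rightarrow> 'a) \<Rightarrow> ('l \<Rightarrow> 'a, ('l \<Rightarrow> 'a) \<times> 'a) two_complex" where
  "Y_complex \<Lambda> xI =
     \<lparr>skel = delete_loops (C_graph \<Lambda> xI),
      opp = arc_opp \<Lambda> xI,
      cells = {arcs G | G. cycle_without_loops G (arc_opp \<Lambda> xI) \<and>
        (\<exists>x\<in>C_vertices \<Lambda> xI. \<exists>s\<in>S - x ` \<Lambda>. \<exists>t\<in>S - x ` \<Lambda>.
           s \<noteq> t \<and> finite_type (sim (x ` \<Lambda>) {s, t}) \<and>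
           G = component_of (C_graph_on \<Lambda> xI (x ` \<Lambda> \<union> {s, t})) x)}\<rparr>"

end

end

theory Submission
  imports Defs
begin

text \<open>
  Let \<open>w \<in> C\<^sub>y\<^sub>,\<^sub>x\<close> send the simple roots of a set \<open>T\<close> to negative roots. Then every positive root
  of \<open>[x] \<union> T\<close> which involves \<open>T\<close> is inverted by \<open>w\<close>; so there are finitely many of them, which forces
  \<open>K = [x]\<^sub>\<sim>\<^sub>T\<close> to be of finite type, and \<open>w\<close> factors through \<open>w\<^sub>0(K) w\<^sub>0(K \<setminus> T)\<close> with lengths adding up.
  For \<open>T\<close> a single generator this shows that the arcs of \<open>\<C>\<close> generate \<open>C\<close>. An arc is a loop exactly if it
  inverts a root orthogonal to \<open>[x]\<close>, so the arcs that are not loops lie in \<open>Y\<close>, and a length reduced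
  factorization of an element of \<open>Y\<close> uses no other arcs. For \<open>T\<close> with two elements, the two reduced walks
  representing \<open>w\<^sub>0(K) w\<^sub>0(K \<setminus> T)\<close> bound a 2-cell as soon as this element is in \<open>Y\<close>; by induction on the length
  all reduced walks with the same product are homotopic, and every walk is homotopic to a reduced one.
  Conversely the boundary of a 2-cell represents an element of \<open>W\<^sub>K\<close> fixing the simple roots of \<open>[u]\<close>,
  and such an element is trivial
    if no root of \<open>K\<close> is orthogonal to \<open>[u]\<close>, which is what the absence of loops
  means.\<close>

section \<open>Finitely supported vectors\<close>

text \<open>The inversion set takes their place: it is finite for every w, its cardinality is the
  length, it determines w, and an inclusion of inversion sets yields a right divisor with lengths
  adding up. Arcs, their inverses, loops and longest elements are all identified by computing
  inversion sets, and finite types come out as conclusions because the roots in question lie in the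
  inversion set of a given element. Walks are measured by the Coxeter lengths of their arcs. Passing
  through an arc changes the length of an element of C by exactly plus or minus the length of the
  arc, so arcs behave like the generators of a Coxeter group, and the elements of rank two play the
  part of the braid relations. The loops at x separate C from Y: each of them is the reflection in a
  root orthogonal to [x].\<close>

definition scl :: "real \<Rightarrow> ('a \<Rightarrow>\<^sub>0 real) \<Rightarrow> ('a \<Rightarrow>\<^sub>0 real)" where
  "scl c v = Poly_Mapping.map ((*) c) v"

lemma lookup_scl [simp]: "Poly_Mapping.lookup (scl c v) k = c * Poly_Mapping.lookup v k"
  by (simp add: scl_def Poly_Mapping.map.rep_eq when_def)

lemma keys_scl_subset: "Poly_Mapping.keys (scl c v) \<subseteq> Poly_Mapping.keys v"
  by (auto simp: in_keys_iff)

lemma scl_add: "scl c (u + v) = scl c u + scl c v"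
  by (rule poly_mapping_eqI) (simp add: lookup_add algebra_simps)

lemma scl_scl [simp]: "scl c (scl d u) = scl (c * d) u"
  by (rule poly_mapping_eqI) simp

lemma scl_0 [simp]: "scl 0 u = 0"
  by (rule poly_mapping_eqI) simp

lemma scl_1 [simp]: "scl 1 u = u"
  by (rule poly_mapping_eqI) simp

lemma scl_minus1: "scl (- 1) u = - u"
  by (rule poly_mapping_eqI) simp

lemma scl_uminus_left: "scl (- c) u = - scl c u"
  by (rule poly_mapping_eqI) simp

lemma single_eq_scl: "Poly_Mapping.single s c = scl c (Poly_Mapping.single s 1)"
  by (rule poly_mapping_eqI) (simp add: lookup_single when_def)

lemma vector_expansion:
  assumes "finite A" "Poly_Mapping.keys v \<subseteq> A"
  shows "v = (\<Sum>s\<in>A. scl (Poly_Mapping.lookup v s) (Poly_Mapping.single s 1))"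
proof (rule poly_mapping_eqI)
  fix k
  have "(\<Sum>s\<in>A. Poly_Mapping.lookup (scl (Poly_Mapping.lookup v s) (Poly_Mapping.single s 1)) k)
      = (\<Sum>s\<in>A. if s = k then Poly_Mapping.lookup v s else 0)"
    by (rule sum.cong) (auto simp: lookup_single when_def)
  also have "\<dots> = Poly_Mapping.lookup v k"
    using assms by (auto simp: in_keys_iff)
  finally show "Poly_Mapping.lookup v k
    = Poly_Mapping.lookup (\<Sum>s\<in>A. scl (Poly_Mapping.lookup v s) (Poly_Mapping.single s 1)) k"
    by (simp add: lookup_sum)
qed

section \<open>The geometric representation\<close>

text \<open>Values of the Chebyshev polynomials of the second kind, shifted by one: they are the
  coefficients of the roots in a dihedral root system.\<close>

fun cheb :: "real \<Rightarrow> nat \<Rightarrow> real" where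
  "cheb c 0 = 0"
| "cheb c (Suc 0) = 1"
| "cheb c (Suc (Suc k)) = 2 * c * cheb c (Suc k) - cheb c k"

text \<open>Written without division, so it holds for every \<theta>. The recurrence is the addition
  formula for sin((k + 2)\<theta>) + sin(k\<theta>).\<close>

lemma cheb_cos: "cheb (cos \<theta>) k * sin \<theta> = sin (real k * \<theta>)"
proof (induction "cos \<theta>" k rule: cheb.induct)
  case (3 k)
  have "sin (real (Suc (Suc k)) * \<theta>) + sin (real k * \<theta>) = 2 * cos \<theta> * sin (real (Suc k) * \<theta>)"
  proof -
    have "sin (real (Suc k) * \<theta> + \<theta>) + sin (real (Suc k) * \<theta> - \<theta>) = 2 * cos \<theta> * sin (real (Suc k) * \<theta>)"
      by (simp only: sin_add sin_diff) (simp add: algebra_simps)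
    moreover have "real (Suc k) * \<theta> + \<theta> = real (Suc (Suc k)) * \<theta>"
      "real (Suc k) * \<theta> - \<theta> = real k * \<theta>"
      by (simp_all add: algebra_simps)
    ultimately show ?thesis by simp
  qed
  with 3 show ?case by (simp add: algebra_simps)
qed auto

text \<open>The value c = 1 belongs to pairs of generators whose product has infinite order.\<close>

lemma cheb_one: "cheb 1 k = real k"
  by (induction "1::real" k rule: cheb.induct) auto

text \<open>A nonempty word ends in t. It grows at the right end because in a product the rightmost
  letter acts first; exchanging s and t in the recursion keeps the letters alternating.\<close>

fun alt_word :: "nat \<Rightarrow> 'a \<Rightarrow> 'a \<Rightarrow> 'a list" where
  "alt_word 0 s t = []"
| "alt_word (Suc k) s t = alt_word k t s @ [t]"

lemma length_alt_word [simp]: "length (alt_word k s t) = k"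
  by (induction k arbitrary: s t) auto

lemma set_alt_word: "set (alt_word k s t) \<subseteq> {s, t}"
  by (induction k arbitrary: s t) auto

lemma alt_word_replicate: "alt_word (2 * k) s t = concat (replicate k [s, t])"
proof (induction k)
  case (Suc k)
  have "concat (replicate (Suc k) [s, t]) = concat (replicate k [s, t]) @ [s, t]"
    by (induction k) auto
  with Suc show ?case by simp
qed auto

lemma alt_word_Cons: "alt_word (Suc k) s t = (if even k then t else s) # alt_word k s t"
  by (induction k arbitrary: s t) auto

lemma alt_word_append: "alt_word (j + k) s t = (if even k then alt_word j s t else alt_word j t s) @ alt_word k s t"
  by (induction k arbitrary: s t) auto

context coxeter_system
begin

abbreviation lk :: "('a \<Rightarrow>\<^sub>0 real) \<Rightarrow> 'a \<Rightarrow> real" where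
  "lk \<equiv> Poly_Mapping.lookup"
abbreviation ky :: "('a \<Rightarrow>\<^sub>0 real) \<Rightarrow> 'a set" where
  "ky \<equiv> Poly_Mapping.keys"

section \<open>The bilinear form\<close>

definition gram :: "'a \<Rightarrow> 'a \<Rightarrow> real" where
  "gram s t = (if m s t = 0 then - 1 else - cos (pi / real (m s t)))"

text \<open>\<open>form\<close> sums over supports, which differ between the vectors of a linear
  relation. Over a common finite index set bilinearity becomes distributivity.\<close>

lemma form_eq_sum:
  assumes "finite A" "ky u \<subseteq> A" "finite B" "ky v \<subseteq> B"
  shows "form u v = (\<Sum>s\<in>A. \<Sum>t\<in>B. lk u s * lk v t * gram s t)"
proof -
  have "(\<Sum>s\<in>A. \<Sum>t\<in>B. lk u s * lk v t * gram s t) = (\<Sum>s\<in>ky u. \<Sum>t\<in>B. lk u s * lk v t * gram s t)"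
    using assms by (intro sum.mono_neutral_right) (auto simp: in_keys_iff)
  also have "\<dots> = (\<Sum>s\<in>ky u. \<Sum>t\<in>ky v. lk u s * lk v t * gram s t)"
    using assms by (intro sum.cong sum.mono_neutral_right) (auto simp: in_keys_iff)
  finally show ?thesis by (simp add: form_def gram_def)
qed

lemma form_add_left: "form (u + u') v = form u v + form u' v"
proof -
  let ?A = "ky u \<union> ky u'"
  have "ky (u + u') \<subseteq> ?A" by (rule keys_add)
  then show ?thesis
    by (subst (1 2 3) form_eq_sum[of ?A _ "ky v"])
      (auto simp: lookup_add algebra_simps sum.distrib)
qed

lemma form_add_right: "form v (u + u') = form v u + form v u'"
proof -
  let ?A = "ky u \<union> ky u'"
  have "ky (u + u') \<subseteq> ?A" by (rule keys_add)
  then show ?thesis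
    by (subst (1 2 3) form_eq_sum[of "ky v" _ ?A])
      (auto simp: lookup_add algebra_simps sum.distrib)
qed

lemma form_scl_left: "form (scl c u) v = c * form u v"
  by (subst (1 2) form_eq_sum[of "ky u" _ "ky v"])
    (auto simp: keys_scl_subset sum_distrib_left mult.assoc dest: subsetD[OF keys_scl_subset])

lemma form_scl_right: "form v (scl c u) = c * form v u"
  by (subst (1 2) form_eq_sum[of "ky v" _ "ky u"])
    (auto simp: sum_distrib_left algebra_simps dest: subsetD[OF keys_scl_subset])

lemma form_uminus_left: "form (- u) v = - form u v"
  using form_scl_left[of "- 1" u v] by (simp add: scl_minus1)

lemma form_uminus_right: "form v (- u) = - form v u"
  using form_scl_right[of v "- 1" u] by (simp add: scl_minus1)

lemma form_diff_left: "form (u - u') v = form u v - form u' v"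
  using form_add_left[of u "- u'" v] by (simp add: form_uminus_left)

lemma form_diff_right: "form v (u - u') = form v u - form v u'"
  using form_add_right[of v u "- u'"] by (simp add: form_uminus_right)

lemma form_zero_left [simp]: "form 0 v = 0" by (simp add: form_def)
lemma form_zero_right [simp]: "form v 0 = 0" by (simp add: form_def)

lemma form_sum_right: "form v (sum f A) = (\<Sum>i\<in>A. form v (f i))"
  by (induction A rule: infinite_finite_induct) (auto simp: form_add_right)

lemmas form_linear = form_add_left form_add_right form_scl_left form_scl_right
  form_uminus_left form_uminus_right form_diff_left form_diff_right

lemma form_simple_roots: "form (simple_root s) (simple_root t) = gram s t"
  by (simp add: form_def gram_def simple_root_def)

lemma lookup_simple_root: "lk (simple_root s) k = (if k = s then 1 else 0)"
  by (simp add: simple_root_def lookup_single when_def)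

lemma S_carrier: "s \<in> S \<Longrightarrow> s \<in> carrier W" using S_subset by auto

lemma ord_one_eq: "ord \<one> = 1"
  using ord_eq_1[of \<one>] by simp

lemma S_square: "s \<in> S \<Longrightarrow> s \<otimes> s = \<one>"
  using pow_ord_eq_1[of s] S_involution[of s] S_carrier[of s] by (simp add: numeral_2_eq_2)

lemma S_inv: "s \<in> S \<Longrightarrow> inv s = s"
  using S_square inv_equality S_carrier by blast

lemma m_self: "s \<in> S \<Longrightarrow> m s s = 1"
  by (simp add: m_def S_square ord_one_eq)

lemma m_commute: "s \<in> S \<Longrightarrow> t \<in> S \<Longrightarrow> m s t = m t s"
  unfolding m_def using ord_inv[of "s \<otimes> t"] by (simp add: inv_mult_group S_inv S_carrier)

lemma m_neq_1:
  assumes "s \<in> S" "t \<in> S" "s \<noteq> t" shows "m s t \<noteq> 1"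
proof
  assume "m s t = 1"
  then have "s \<otimes> t = \<one>" using assms ord_eq_1[of "s \<otimes> t"] by (simp add: m_def S_carrier)
  then show False
    using assms S_inv[of t] inv_equality[of s t] S_carrier by auto
qed

lemma gram_self [simp]: "s \<in> S \<Longrightarrow> gram s s = 1"
  by (simp add: gram_def m_self)

lemma gram_commute: "s \<in> S \<Longrightarrow> t \<in> S \<Longrightarrow> gram s t = gram t s"
  by (simp add: gram_def m_commute)

lemma cos_pi_over_pos: "n \<ge> 3 \<Longrightarrow> cos (pi / real n) > 0"
proof -
  assume n: "n \<ge> 3"
  have "pi / real n < pi / 2" by (rule divide_strict_left_mono) (use n in auto)
  then show ?thesis using n by (intro cos_gt_zero_pi) (auto intro: less_trans[of _ 0])
qed

text \<open>For distinct generators the form is 0 if m = 2, negative if m is at least 3, and - 1 for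
  the value 0 that encodes infinity. Connectedness can therefore be handled through the
  form.\<close>

lemma coxeter_graph_gram:
  assumes "s \<in> S" "t \<in> S" "s \<noteq> t"
  shows "(s, t) \<in> coxeter_graph \<longleftrightarrow> gram s t \<noteq> 0"
proof -
  consider "m s t = 0" | "m s t = 2" | "m s t \<ge> 3" using m_neq_1[OF assms] by linarith
  then show ?thesis
    by cases (use assms cos_pi_over_pos[of "m s t"] in \<open>auto simp: coxeter_graph_def gram_def\<close>)
qed

section \<open>Reflections and the dihedral relations\<close>

lemma reflect_eq: "reflect s v = v - scl (2 * form (simple_root s) v) (simple_root s)"
  unfolding reflect_def simple_root_def by (subst single_eq_scl) simp

lemma lookup_reflect:
  "lk (reflect s v) k = lk v k - (if k = s then 2 * form (simple_root s) v else 0)"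
  by (auto simp: reflect_eq lookup_minus simple_root_def lookup_single when_def)

lemma reflect_add: "reflect s (u + v) = reflect s u + reflect s v"
  by (rule poly_mapping_eqI) (simp add: lookup_reflect lookup_add form_linear)

lemma reflect_scl: "reflect s (scl c v) = scl c (reflect s v)"
  by (rule poly_mapping_eqI) (simp add: lookup_reflect form_linear algebra_simps)

lemma reflect_twice: "s \<in> S \<Longrightarrow> reflect s (reflect s v) = v"
  by (rule poly_mapping_eqI)
    (simp add: lookup_reflect, simp add: reflect_eq form_linear form_simple_roots)

abbreviation refl_word :: "'a list \<Rightarrow> ('a \<Rightarrow>\<^sub>0 real) \<Rightarrow> ('a \<Rightarrow>\<^sub>0 real)" where
  "refl_word \<equiv> foldr reflect"

lemma refl_word_add: "refl_word ws (u + v) = refl_word ws u + refl_word ws v"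
  by (induction ws) (auto simp: reflect_add)

lemma refl_word_scl: "refl_word ws (scl c v) = scl c (refl_word ws v)"
  by (induction ws) (auto simp: reflect_scl)

text \<open>Each reflection exchanges the roles of s and t and moves the pair of coefficients one
  step along the recurrence of \<open>cheb\<close>. The offset j is the induction parameter; j = 0
  describes the image of \<open>simple_root s\<close>.\<close>

lemma refl_word_alt:
  assumes "s \<in> S" "t \<in> S" "c = - gram s t"
  shows "refl_word (alt_word k s t)
      (scl (cheb c (Suc j)) (simple_root s) + scl (cheb c j) (simple_root t)) =
    (if even k then scl (cheb c (Suc (j + k))) (simple_root s) + scl (cheb c (j + k)) (simple_root t)
     else scl (cheb c (Suc (j + k))) (simple_root t) + scl (cheb c (j + k)) (simple_root s))"
  using assms
proof (induction k arbitrary: s t j)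
  case (Suc k)
  have "reflect t (scl (cheb c (Suc j)) (simple_root s) + scl (cheb c j) (simple_root t))
    = scl (cheb c (Suc (Suc j))) (simple_root t) + scl (cheb c (Suc j)) (simple_root s)"
    by (rule poly_mapping_eqI)
      (use Suc.prems gram_commute[of s t] in
        \<open>auto simp: lookup_reflect lookup_add form_linear form_simple_roots algebra_simps
          lookup_simple_root\<close>)
  moreover have "c = - gram t s" using Suc.prems gram_commute by auto
  ultimately show ?case using Suc.IH[of t s "Suc j"] Suc.prems by simp
qed auto

lemma sin_pi_over_pos: "n \<ge> 2 \<Longrightarrow> sin (pi / real n) > 0"
  by (intro sin_gt_zero) (auto simp: field_simps)

text \<open>For s and t distinct with finite m and \<theta> = \<pi>/m, the coefficients reached
  after 2m letters are sin(2m\<theta>)/sin \<theta> = 0 and its neighbours, so both roots are fixed.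
  The plane they span splits off orthogonally because its Gram determinant is the square of sin
  \<theta>, and both reflections fix the complement pointwise.\<close>

lemma refl_word_relator:
  assumes "s \<in> S" "t \<in> S"
  shows "refl_word (concat (replicate (m s t) [s, t])) v = v"
proof (cases "s = t")
  case True
  then show ?thesis using assms by (simp add: m_self reflect_twice)
next
  case False
  let ?m = "m s t" and ?\<theta> = "pi / real (m s t)"
  show ?thesis
  proof (cases "?m = 0")
    case False
    with m_neq_1[OF assms \<open>s \<noteq> t\<close>] have m2: "?m \<ge> 2" by linarith
    define c where "c = - gram s t"
    have c: "c = cos ?\<theta>" using m2 by (simp add: c_def gram_def)
    have sp: "sin ?\<theta> > 0" using sin_pi_over_pos[OF m2] .
    have U: "cheb c k = sin (real k * ?\<theta>) / sin ?\<theta>" for k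
      using cheb_cos[of ?\<theta> k] sp c by (simp add: field_simps)
    have 2: "real (2 * ?m) * ?\<theta> = 2 * pi" using m2 by simp
    have U0: "cheb c (2 * ?m) = 0" using 2 U[of "2 * ?m"] by simp
    have "real (Suc (2 * ?m)) * ?\<theta> = 2 * pi + ?\<theta>" using 2 by (simp add: algebra_simps)
    then have U1: "cheb c (Suc (2 * ?m)) = 1"
      using U[of "Suc (2 * ?m)"] sp by (simp only:) (simp add: sin_add)
    obtain n where n: "2 * ?m = Suc n" using m2 by (cases "2 * ?m") auto
    have "real n * ?\<theta> = 2 * pi - ?\<theta>"
    proof -
      have "real n = real (2 * ?m) - 1" using n by simp
      then show ?thesis using 2 by (simp only: left_diff_distrib mult_1)
    qed
    then have Um: "cheb c n = - 1" using U[of n] sp by (simp only:) (simp add: sin_diff)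
    have odd: "odd n" using n by presburger
    have w: "concat (replicate ?m [s, t]) = alt_word (2 * ?m) s t"
      by (simp add: alt_word_replicate)
    have fs: "refl_word (alt_word (2 * ?m) s t) (simple_root s) = simple_root s"
      using refl_word_alt[OF assms c_def, of "2 * ?m" 0] U0 U1 by simp
    have c': "c = - gram t s" using assms gram_commute by (simp add: c_def)
    have rt: "reflect t (simple_root t) = scl (- 1) (simple_root t)"
      by (rule poly_mapping_eqI)
        (use assms in \<open>auto simp: lookup_reflect form_simple_roots lookup_simple_root\<close>)
    \<comment> \<open>The letter t acts first and only negates its root. The remaining n = 2m - 1
      letters form an alternating word that ends in s, to which the same formula applies with s and
      t exchanged.\<close>
    have "refl_word (alt_word n t s) (simple_root t) = scl (cheb c (Suc n)) (simple_root s) + scl (cheb c n) (simple_root t)"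
      using refl_word_alt[OF assms(2,1) c', of n 0] odd by simp
    then have ft: "refl_word (alt_word (2 * ?m) s t) (simple_root t) = simple_root t"
      using n Um U0 by (simp add: rt refl_word_scl scl_add)
    have cc: "1 - c\<^sup>2 \<noteq> 0"
      using sp sin_squared_eq[of ?\<theta>] c by auto
    \<comment> \<open>The coefficients p and q solve the 2 by 2 Gram system that makes v0 orthogonal
      to both roots.\<close>
    define p where "p = (form (simple_root s) v + c * form (simple_root t) v) / (1 - c\<^sup>2)"
    define q where "q = (c * form (simple_root s) v + form (simple_root t) v) / (1 - c\<^sup>2)"
    define v0 where "v0 = v - scl p (simple_root s) - scl q (simple_root t)"
    have gs: "gram s t = - c" "gram t s = - c" using c_def c' by auto
    have p1: "p - c * q = form (simple_root s) v" "q - c * p = form (simple_root t) v"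
      unfolding p_def q_def
        using cc by (simp_all add: divide_simps power2_eq_square) (simp_all add: algebra_simps)
    then have "form (simple_root s) v0 = 0" "form (simple_root t) v0 = 0"
      using assms by (auto simp: v0_def form_linear form_simple_roots gs algebra_simps)
    then have "refl_word ws v0 = v0" if "set ws \<subseteq> {s, t}" for ws
      using that by (induction ws) (auto simp: reflect_eq)
    then have f0: "refl_word (alt_word (2 * ?m) s t) v0 = v0" using set_alt_word by metis
    have v: "v = v0 + scl p (simple_root s) + scl q (simple_root t)"
      by (simp add: v0_def algebra_simps)
    show ?thesis unfolding w
      by (subst (1 2) v) (simp add: refl_word_add refl_word_scl fs ft f0)
  qed simp
qed

section \<open>Words and the action of W\<close>

lemma word_prod_Nil [simp]: "word_prod W [] = \<one>"
  by (simp add: word_prod_def)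

lemma word_prod_Cons [simp]: "word_prod W (a # ws) = a \<otimes> word_prod W ws"
  by (simp add: word_prod_def)

lemma word_prod_closed [simp]: "set ws \<subseteq> S \<Longrightarrow> word_prod W ws \<in> carrier W"
  using S_carrier by (induction ws) auto

lemma word_prod_append:
  "set u \<subseteq> S \<Longrightarrow> set v \<subseteq> S \<Longrightarrow> word_prod W (u @ v) = word_prod W u \<otimes> word_prod W v"
  using S_carrier by (induction u) (auto simp: m_assoc)

lemma word_prod_rev: "set u \<subseteq> S \<Longrightarrow> word_prod W (rev u) = inv (word_prod W u)"
  by (induction u) (auto simp: word_prod_append S_carrier inv_mult_group S_inv)

lemma generate_word:
  assumes "J \<subseteq> S" "w \<in> generate W J"
  obtains ws where "set ws \<subseteq> J" "word_prod W ws = w"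
proof -
  have "\<exists>ws. set ws \<subseteq> J \<and> word_prod W ws = w" using assms(2)
  proof (induction rule: generate.induct)
    case one
    show ?case by (rule exI[of _ "[]"]) simp
  next
    case (incl h)
    then show ?case using assms S_carrier by (intro exI[of _ "[h]"]) auto
  next
    case (inv h)
    then show ?case using assms S_carrier by (intro exI[of _ "[h]"]) (auto simp: S_inv)
  next
    case (eng h1 h2)
    then obtain u v where "set u \<subseteq> J" "word_prod W u = h1" "set v \<subseteq> J"
      "word_prod W v = h2" by blast
    then show ?case using assms by (intro exI[of _ "u @ v"]) (auto simp: word_prod_append)
  qed
  then show ?thesis using that by blast
qed

lemma carrier_word:
  assumes "w \<in> carrier W"
  obtains ws where "set ws \<subseteq> S" "word_prod W ws = w"
  using generate_word[of S w] assms S_generates by auto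

lemma parabolic_word:
  assumes "J \<subseteq> S" "w \<in> parabolic J"
  obtains ws where "set ws \<subseteq> J" "word_prod W ws = w"
  using generate_word assms unfolding parabolic_def by blast

text \<open>Relators act as the identity, so by the presentation two words with the same product act
  alike. This is the uniqueness behind the description in \<open>act\<close>.\<close>

lemma refl_word_well_defined:
  assumes "set u \<subseteq> S" "set v \<subseteq> S" "word_prod W u = word_prod W v"
  shows "refl_word u x = refl_word v x"
proof -
  have step: "refl_word a x = refl_word b x" if "(a, b) \<in> coxeter_step W S" for a b
    using that refl_word_relator by (auto simp: coxeter_step_def m_def)
  have "(u, v) \<in> (coxeter_step W S \<union> (coxeter_step W S)\<inverse>)\<^sup>*"
    by (rule S_presentation[OF assms])
  then show ?thesis
    by (induction rule: rtrancl_induct) (use step in fastforce)+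
qed

text \<open>Every relator has even length, so the parity of a word depends on its product only: this
  is the sign character. It excludes \<open>len (w \<otimes> s) = len w\<close>.\<close>

lemma length_parity:
  assumes "set u \<subseteq> S" "set v \<subseteq> S" "word_prod W u = word_prod W v"
  shows "even (length u) = even (length v)"
proof -
  have cl: "length (concat (replicate n [s, t])) = 2 * n" for n and s t :: 'a
    by (induction n) auto
  have step: "even (length a) = even (length b)" if "(a, b) \<in> coxeter_step W S" for a b
    using that cl by (auto simp: coxeter_step_def)
  have "(u, v) \<in> (coxeter_step W S \<union> (coxeter_step W S)\<inverse>)\<^sup>*"
    by (rule S_presentation[OF assms])
  then show ?thesis
    by (induction rule: rtrancl_induct) (use step in fastforce)+
qed

lemma act_word:
  assumes "set ws \<subseteq> S" shows "act (word_prod W ws) v = refl_word ws v"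
  unfolding act_def using assms by (intro the_equality) (auto intro: refl_word_well_defined)

lemma act_one [simp]: "act \<one> v = v"
  using act_word[of "[]"] by simp

lemma act_S: "s \<in> S \<Longrightarrow> act s v = reflect s v"
  using act_word[of "[s]" v] by (simp add: S_carrier)

lemma act_mult:
  assumes "w \<in> carrier W" "u \<in> carrier W" shows "act (w \<otimes> u) v = act w (act u v)"
proof -
  obtain a b where "set a \<subseteq> S" "word_prod W a = w" "set b \<subseteq> S" "word_prod W b = u"
    using assms carrier_word by metis
  then show ?thesis using act_word[of "a @ b" v] by (auto simp: word_prod_append act_word)
qed

lemma act_inv_act [simp]: "w \<in> carrier W \<Longrightarrow> act (inv w) (act w v) = v"
  using act_mult[of "inv w" w v] by simp

lemma act_act_inv [simp]: "w \<in> carrier W \<Longrightarrow> act w (act (inv w) v) = v"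
  using act_mult[of w "inv w" v] by simp

lemma act_add: "w \<in> carrier W \<Longrightarrow> act w (u + v) = act w u + act w v"
  by (erule carrier_word) (auto simp: act_word refl_word_add)

lemma act_scl: "w \<in> carrier W \<Longrightarrow> act w (scl c v) = scl c (act w v)"
  by (erule carrier_word) (auto simp: act_word refl_word_scl)

lemma act_uminus: "w \<in> carrier W \<Longrightarrow> act w (- v) = - act w v"
  using act_scl[of w "- 1" v] by (simp add: scl_minus1)

lemma act_diff: "w \<in> carrier W \<Longrightarrow> act w (u - v) = act w u - act w v"
  using act_add[of w u "- v"] by (simp add: act_uminus)

lemma act_zero: "w \<in> carrier W \<Longrightarrow> act w 0 = 0"
  using act_scl[of w 0 0] by simp

lemma act_sum: "w \<in> carrier W \<Longrightarrow> act w (sum f A) = (\<Sum>i\<in>A. act w (f i))"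
  by (induction A rule: infinite_finite_induct) (auto simp: act_add act_zero)

lemma form_commute:
  assumes "ky u \<subseteq> S" "ky v \<subseteq> S" shows "form u v = form v u"
proof -
  have "form u v = (\<Sum>s\<in>ky u. \<Sum>t\<in>ky v. lk u s * lk v t * gram s t)"
    by (intro form_eq_sum) auto
  also have "\<dots> = (\<Sum>s\<in>ky u. \<Sum>t\<in>ky v. lk v t * lk u s * gram t s)"
    using assms by (intro sum.cong) (auto simp: gram_commute subset_iff)
  also have "\<dots> = (\<Sum>t\<in>ky v. \<Sum>s\<in>ky u. lk v t * lk u s * gram t s)"
    by (rule sum.swap)
  also have "\<dots> = form v u" by (intro form_eq_sum[symmetric]) auto
  finally show ?thesis .
qed

lemma ky_simple_root [simp]: "ky (simple_root s) = {s}"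
  by (simp add: simple_root_def)

lemma ky_reflect: "ky (reflect s v) \<subseteq> insert s (ky v)"
  by (auto simp: in_keys_iff lookup_reflect split: if_splits)

lemma ky_refl_word: "ky (refl_word ws v) \<subseteq> set ws \<union> ky v"
  using ky_reflect by (induction ws) fastforce+

lemma ky_act: "w \<in> carrier W \<Longrightarrow> ky v \<subseteq> S \<Longrightarrow> ky (act w v) \<subseteq> S"
  using ky_refl_word by (elim carrier_word) (fastforce simp: act_word)

lemma form_reflect:
  assumes "s \<in> S" "ky u \<subseteq> S" "ky v \<subseteq> S"
  shows "form (reflect s u) (reflect s v) = form u v"
  using assms form_commute[of u "simple_root s"]
  by (simp add: reflect_eq form_linear form_simple_roots algebra_simps)

lemma form_act:
  assumes "w \<in> carrier W" "ky u \<subseteq> S" "ky v \<subseteq> S"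
  shows "form (act w u) (act w v) = form u v"
proof -
  obtain ws where ws: "set ws \<subseteq> S" "word_prod W ws = w" using assms carrier_word by metis
  have "form (refl_word ws u) (refl_word ws v) = form u v" using ws(1)
  proof (induction ws)
    case (Cons a ws)
    then show ?case using ky_refl_word[of ws u] ky_refl_word[of ws v] assms
      by (simp, subst form_reflect) auto
  qed simp
  then show ?thesis using ws by (auto simp: act_word)
qed

lemma simple_root_inj: "simple_root s = simple_root t \<longleftrightarrow> s = t"
  using ky_simple_root by (metis singleton_inject)

section \<open>Length and the root system\<close>

lemma reduced_word:
  assumes "w \<in> carrier W"
  obtains ws where "set ws \<subseteq> S" "word_prod W ws = w" "length ws = len w"
proof -
  obtain ws where "set ws \<subseteq> S" "word_prod W ws = w" using assms carrier_word by metis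
  then have "\<exists>n ws. set ws \<subseteq> S \<and> word_prod W ws = w \<and> length ws = n" by blast
  then have "\<exists>ws. set ws \<subseteq> S \<and> word_prod W ws = w \<and> length ws = len w"
    unfolding len_def by (rule LeastI_ex)
  then show ?thesis using that by blast
qed

lemma len_le: "set ws \<subseteq> S \<Longrightarrow> len (word_prod W ws) \<le> length ws"
  unfolding len_def by (rule Least_le) blast

lemma len_one [simp]: "len \<one> = 0"
  using len_le[of "[]"] by simp

lemma len_eq_0: "w \<in> carrier W \<Longrightarrow> len w = 0 \<longleftrightarrow> w = \<one>"
  by (auto elim: reduced_word)

lemma len_mult_le:
  assumes "w \<in> carrier W" "u \<in> carrier W" shows "len (w \<otimes> u) \<le> len w + len u"
proof -
  obtain a b where "set a \<subseteq> S" "word_prod W a = w" "length a = len w"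
    "set b \<subseteq> S" "word_prod W b = u" "length b = len u"
    using assms reduced_word by metis
  then show ?thesis using len_le[of "a @ b"] by (auto simp: word_prod_append)
qed

lemma len_inv: "w \<in> carrier W \<Longrightarrow> len (inv w) = len w"
proof -
  have *: "len (inv w) \<le> len w" if "w \<in> carrier W" for w
  proof -
    obtain a where "set a \<subseteq> S" "word_prod W a = w" "length a = len w"
      using \<open>w \<in> carrier W\<close> reduced_word by metis
    then show ?thesis using len_le[of "rev a"] by (auto simp: word_prod_rev)
  qed
  assume "w \<in> carrier W"
  then show ?thesis using *[of w] *[of "inv w"] by simp
qed

lemma len_S_le: "s \<in> S \<Longrightarrow> len s \<le> 1"
  using len_le[of "[s]"] S_carrier by simp

lemma len_mult_S:
  assumes "w \<in> carrier W" "s \<in> S"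
  shows "len (w \<otimes> s) = len w + 1 \<or> len w = len (w \<otimes> s) + 1"
proof -
  obtain a where a: "set a \<subseteq> S" "word_prod W a = w" "length a = len w"
    using assms reduced_word by metis
  obtain b where b: "set b \<subseteq> S" "word_prod W b = w \<otimes> s" "length b = len (w \<otimes> s)"
    using assms reduced_word[of "w \<otimes> s"] S_carrier by blast
  have "even (length (a @ [s])) = even (length b)"
    by (rule length_parity) (use a b assms S_carrier in \<open>auto simp: word_prod_append\<close>)
  then have "len (w \<otimes> s) \<noteq> len w" using a b by auto
  moreover have "len (w \<otimes> s) \<le> len w + 1"
    using len_mult_le[of w s] len_S_le[of s] assms S_carrier[of s] by simp
  moreover have "w \<otimes> s \<otimes> s = w" using assms S_carrier[of s] by (simp add: m_assoc S_square)
  then have "len w \<le> len (w \<otimes> s) + 1"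
    using len_mult_le[of "w \<otimes> s" s] len_S_le[of s] assms S_carrier[of s] by simp
  ultimately show ?thesis by linarith
qed

lemma len_descent_ex:
  assumes "w \<in> carrier W" "w \<noteq> \<one>"
  obtains t where "t \<in> S" "len w = len (w \<otimes> t) + 1"
proof -
  obtain a where a: "set a \<subseteq> S" "word_prod W a = w" "length a = len w"
    using assms reduced_word by metis
  then have "a \<noteq> []" using assms by auto
  then obtain b t where bt: "a = b @ [t]" by (metis append_butlast_last_id)
  then have "w = word_prod W b \<otimes> t" using a S_carrier by (auto simp: word_prod_append)
  moreover have "t \<in> S" "set b \<subseteq> S" using a bt by auto
  ultimately have "w \<otimes> t = word_prod W b" using S_carrier[of t] by (simp add: m_assoc S_square)
  then have "len (w \<otimes> t) < len w" using len_le[of b] \<open>set b \<subseteq> S\<close> a bt by auto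
  then show ?thesis using that[of t] \<open>t \<in> S\<close> len_mult_S[OF assms(1), of t] by linarith
qed

section \<open>Roots are positive or negative\<close>

definition nonneg :: "('a \<Rightarrow>\<^sub>0 real) \<Rightarrow> bool" where
  "nonneg v \<longleftrightarrow> (\<forall>k. lk v k \<ge> 0)"

lemma nonneg_add: "nonneg u \<Longrightarrow> nonneg v \<Longrightarrow> nonneg (u + v)"
  by (simp add: nonneg_def lookup_add)

lemma nonneg_scl: "c \<ge> 0 \<Longrightarrow> nonneg v \<Longrightarrow> nonneg (scl c v)"
  by (simp add: nonneg_def)

lemma nonneg_sum: "(\<And>i. i \<in> A \<Longrightarrow> nonneg (f i)) \<Longrightarrow> nonneg (sum f A)"
  by (simp add: nonneg_def lookup_sum sum_nonneg)

lemma nonneg_simple_root: "nonneg (simple_root s)"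
  by (simp add: nonneg_def lookup_simple_root)

lemma word_prod_relator:
  assumes "s \<in> S" "t \<in> S"
  shows "word_prod W (concat (replicate (m s t) [s, t])) = \<one>"
proof -
  have "word_prod W (concat (replicate n [s, t])) = (s \<otimes> t) [^] n" for n
  proof (induction n)
    case (Suc n)
    have "word_prod W (concat (replicate (Suc n) [s, t])) = (s \<otimes> t) \<otimes> (s \<otimes> t) [^] n"
      using assms S_carrier Suc by (simp add: m_assoc)
    then show ?case using assms S_carrier by (simp only: nat_pow_Suc2 m_closed)
  qed simp
  then show ?thesis using assms S_carrier unfolding m_def by (simp add: pow_ord_eq_1)
qed

text \<open>For k at most m the angle k\<pi>/m stays in [0, \<pi>], where sin is nonnegative. For
  infinite order \<open>cheb\<close> takes the value k.\<close>

lemma cheb_gram_nonneg: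
  assumes "s \<in> S" "t \<in> S" "s \<noteq> t" "m s t = 0 \<or> k \<le> m s t"
  shows "cheb (- gram s t) k \<ge> 0"
proof (cases "m s t = 0")
  case True
  then show ?thesis by (simp add: gram_def cheb_one)
next
  case False
  with m_neq_1 assms have m2: "m s t \<ge> 2" by (metis One_nat_def less_2_cases not_le)
  let ?\<theta> = "pi / real (m s t)"
  have "real k * ?\<theta> \<le> pi" using assms False by (simp add: field_simps)
  then have "sin (real k * ?\<theta>) \<ge> 0" by (intro sin_ge_zero) auto
  then have "cheb (cos ?\<theta>) k * sin ?\<theta> \<ge> 0" by (simp only: cheb_cos)
  then have "cheb (cos ?\<theta>) k \<ge> 0"
    using sin_pi_over_pos[OF m2] mult_neg_pos linorder_not_le by blast
  then show ?thesis using False by (simp add: gram_def)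
qed

text \<open>An alternating word of m + 1 letters is inverse to the other m - 1 letters of the
  relator of length 2m. Replacing it saves two of the k + 1 letters.\<close>

lemma len_alt_word_overlong:
  assumes "s \<in> S" "t \<in> S" "s \<noteq> t" "m s t \<noteq> 0" "k \<ge> m s t"
  shows "len (word_prod W (alt_word k s t @ [s])) < k"
proof -
  let ?m = "m s t"
  have mts: "m t s = ?m" using m_commute assms by auto
  obtain X where X: "alt_word ((?m - 1) + Suc ?m) t s = X @ alt_word (Suc ?m) t s" "length X = ?m - 1"
    "set X \<subseteq> {s, t}"
  proof
    let ?X = "if even (Suc ?m) then alt_word (?m - 1) t s else alt_word (?m - 1) s t"
    show "alt_word ((?m - 1) + Suc ?m) t s = ?X @ alt_word (Suc ?m) t s" by (rule alt_word_append)
    show "length ?X = ?m - 1" by simp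
    show "set ?X \<subseteq> {s, t}" using set_alt_word[of "?m - 1" t s] set_alt_word[of "?m - 1" s t] by auto
  qed
  have "(?m - 1) + Suc ?m = 2 * ?m" using assms by simp
  then have "X @ alt_word (Suc ?m) t s = concat (replicate (m t s) [t, s])"
    using X(1) alt_word_replicate[of ?m t s] mts by metis
  then have "word_prod W (X @ alt_word (Suc ?m) t s) = \<one>"
    using word_prod_relator[of t s] assms by metis
  moreover have XS: "set X \<subseteq> S" "set (alt_word (Suc ?m) t s) \<subseteq> S"
    using X assms set_alt_word[of "Suc ?m" t s] by (auto simp del: alt_word.simps)
  ultimately have "word_prod W X \<otimes> word_prod W (alt_word (Suc ?m) t s) = \<one>"
    by (simp add: word_prod_append del: alt_word.simps)
  then have "word_prod W (alt_word (Suc ?m) t s) = inv (word_prod W X)"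
    using XS by (metis inv_equality inv_inv word_prod_closed)
  then have l1: "len (word_prod W (alt_word (Suc ?m) t s)) \<le> ?m - 1"
    using len_inv[of "word_prod W X"] len_le[of X] XS X by simp
  obtain Y where Y: "alt_word ((k - ?m) + Suc ?m) t s = Y @ alt_word (Suc ?m) t s" "length Y = k - ?m"
    "set Y \<subseteq> {s, t}"
  proof
    let ?X = "if even (Suc ?m) then alt_word (k - ?m) t s else alt_word (k - ?m) s t"
    show "alt_word ((k - ?m) + Suc ?m) t s = ?X @ alt_word (Suc ?m) t s" by (rule alt_word_append)
    show "length ?X = k - ?m" by simp
    show "set ?X \<subseteq> {s, t}" using set_alt_word[of "k - ?m" t s] set_alt_word[of "k - ?m" s t] by auto
  qed
  have YS: "set Y \<subseteq> S" using Y assms by auto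
  have "alt_word k s t @ [s] = Y @ alt_word (Suc ?m) t s"
    using Y(1) assms by (simp flip: alt_word.simps(2))
  then have "len (word_prod W (alt_word k s t @ [s])) \<le> len (word_prod W Y) + len (word_prod W (alt_word (Suc ?m) t s))"
    using YS XS len_mult_le by (simp add: word_prod_append del: alt_word.simps)
  also have "\<dots> \<le> (k - ?m) + (?m - 1)" using l1 len_le[OF YS] Y by simp
  also have "\<dots> < k" using assms by auto
  finally show ?thesis .
qed

text \<open>The reduction to rank two: write \<open>w = v a\<close> with \<open>a\<close> an alternating word in \<open>s\<close> and some
  descent \<open>t\<close> of \<open>w\<close>, lengths adding up, and \<open>a\<close> as long as possible.\<close>

lemma act_simple_root_nonneg:
  assumes "w \<in> carrier W" "s \<in> S" "len (w \<otimes> s) > len w"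
  shows "nonneg (act w (simple_root s))"
  using assms
proof (induction "len w" arbitrary: w s rule: less_induct)
  case less
  note w = less.prems(1) and s = less.prems(2)
  show ?case
  proof (cases "w = \<one>")
    case True
    then show ?thesis by (simp add: nonneg_simple_root)
  next
    case False
    then obtain t where t: "t \<in> S" "len w = len (w \<otimes> t) + 1" using len_descent_ex w by metis
    have st: "s \<noteq> t" using less.prems t by auto
    define P where "P k \<longleftrightarrow> (\<exists>v\<in>carrier W. w = v \<otimes> word_prod W (alt_word k s t) \<and> len w = len v + k)" for k
    have "w = w \<otimes> t \<otimes> t" using w t S_carrier by (simp add: m_assoc S_square)
    then have "P 1" unfolding P_def using w t S_carrier by (intro bexI[of _ "w \<otimes> t"]) auto
    moreover have bound: "\<forall>k. P k \<longrightarrow> k \<le> len w" by (auto simp: P_def)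
    ultimately have "P (Greatest P)" using GreatestI_nat[of P 1 "len w"] by blast
    then obtain k where k: "P k" "\<And>j. P j \<Longrightarrow> j \<le> k"
      using Greatest_le_nat[of P _ "len w"] bound by blast
    have "k \<ge> 1" using k(2)[OF \<open>P 1\<close>] .
    then obtain k' where k': "k = Suc k'" by (cases k) auto
    obtain v where v: "v \<in> carrier W" "w = v \<otimes> word_prod W (alt_word k s t)" "len w = len v + k"
      using k(1) by (auto simp: P_def)
    have altS: "set (alt_word j s t) \<subseteq> S" for j using set_alt_word[of j s t] s t by auto
    \<comment> \<open>The letter r is the first one of the chosen alternating word and r' the one
      that would prolong it to the left; together they are s and t. If r shortened v, then w would
      be too short, and if r' did, then k would not be maximal.\<close>
    define r where "r = (if even k' then t else s)"
    define r' where "r' = (if even k then t else s)"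
    have rS: "r \<in> S" "r' \<in> S" using s t by (auto simp: r_def r'_def)
    have A1: "alt_word k s t = r # alt_word k' s t" unfolding k' r_def by (rule alt_word_Cons)
    have A2: "alt_word (Suc k) s t = r' # alt_word k s t" unfolding r'_def by (rule alt_word_Cons)
    have lr: "len (v \<otimes> r) > len v"
    proof (rule ccontr)
      assume "\<not> ?thesis"
      then have "len v = len (v \<otimes> r) + 1" using len_mult_S[OF v(1) rS(1)] by linarith
      moreover have "w = (v \<otimes> r) \<otimes> word_prod W (alt_word k' s t)"
        using v A1 rS S_carrier altS by (simp add: m_assoc)
      then have "len w \<le> len (v \<otimes> r) + len (word_prod W (alt_word k' s t))"
        by (metis len_mult_le m_closed v(1) S_carrier[OF rS(1)] word_prod_closed[OF altS])
      ultimately show False using len_le[OF altS[of k']] v(3) k' by simp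
    qed
    have lr': "len (v \<otimes> r') > len v"
    proof (rule ccontr)
      assume "\<not> ?thesis"
      then have "len v = len (v \<otimes> r') + 1" using len_mult_S[OF v(1) rS(2)] by linarith
      moreover have "w = (v \<otimes> r') \<otimes> word_prod W (alt_word (Suc k) s t)"
      proof -
        have "(v \<otimes> r') \<otimes> word_prod W (alt_word (Suc k) s t) = v \<otimes> (r' \<otimes> r') \<otimes> word_prod W (alt_word k s t)"
          unfolding A2 using v rS S_carrier altS by (simp add: m_assoc)
        then show ?thesis using v rS by (simp add: S_square)
      qed
      ultimately have "P (Suc k)"
        unfolding P_def using v rS S_carrier by (intro bexI[of _ "v \<otimes> r'"]) auto
      then show False using k(2) by force
    qed
    have "len v < len w" using v k' by simp
    then have "nonneg (act v (simple_root r))" "nonneg (act v (simple_root r'))"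
      using less.hyps v rS lr lr' by auto
    moreover have "{r, r'} = {s, t}" by (auto simp: r_def r'_def k')
    ultimately have nn: "nonneg (act v (simple_root s))" "nonneg (act v (simple_root t))"
      by (auto simp: doubleton_eq_iff)
    \<comment> \<open>A longer alternating part could be shortened after appending s, so s would be
      a descent of w.\<close>
    have km: "m s t = 0 \<or> Suc k \<le> m s t"
    proof (rule ccontr)
      assume "\<not> ?thesis"
      then have "len (word_prod W (alt_word k s t @ [s])) < k"
        using len_alt_word_overlong[OF s t(1) st] by simp
      moreover have "w \<otimes> s = v \<otimes> word_prod W (alt_word k s t @ [s])"
        using v s altS S_carrier by (simp add: word_prod_append m_assoc)
      then have "len (w \<otimes> s) \<le> len v + len (word_prod W (alt_word k s t @ [s]))"
        using len_mult_le[of v "word_prod W (alt_word k s t @ [s])"] v altS s by simp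
      ultimately show False using less.prems v by simp
    qed
    define c where "c = - gram s t"
    have c: "cheb c k \<ge> 0" "cheb c (Suc k) \<ge> 0"
      unfolding c_def by (intro cheb_gram_nonneg s t st; use km in auto)+
    have "act w (simple_root s) = act v (refl_word (alt_word k s t) (simple_root s))"
      using v altS by (simp add: act_mult act_word)
    also have "\<dots> = (if even k then scl (cheb c (Suc k)) (act v (simple_root s)) + scl (cheb c k) (act v (simple_root t))
       else scl (cheb c (Suc k)) (act v (simple_root t)) + scl (cheb c k) (act v (simple_root s)))"
      using refl_word_alt[OF s t(1) c_def, of k 0] v(1) by (simp add: act_add act_scl)
    finally show ?thesis using nn c by (simp add: nonneg_add nonneg_scl)
  qed
qed

lemma rootE:
  assumes "\<gamma> \<in> roots"
  obtains w s where "w \<in> carrier W" "s \<in> S" "\<gamma> = act w (simple_root s)"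
  using assms by (auto simp: roots_def)

lemma act_root: "w \<in> carrier W \<Longrightarrow> \<gamma> \<in> roots \<Longrightarrow> act w \<gamma> \<in> roots"
  unfolding roots_def by (auto simp flip: act_mult) blast

lemma simple_root_in_roots: "s \<in> S \<Longrightarrow> simple_root s \<in> roots"
  unfolding roots_def using act_one by force

lemma root_ky: "\<gamma> \<in> roots \<Longrightarrow> ky \<gamma> \<subseteq> S"
  by (erule rootE) (auto dest!: ky_act[THEN subsetD, rotated 2])

lemma root_unit: "\<gamma> \<in> roots \<Longrightarrow> form \<gamma> \<gamma> = 1"
  by (erule rootE) (simp add: form_act form_simple_roots)

lemma root_nonzero: "\<gamma> \<in> roots \<Longrightarrow> \<gamma> \<noteq> 0"
  using root_unit by fastforce

lemma act_simple_root_self: "s \<in> S \<Longrightarrow> act s (simple_root s) = - simple_root s"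
  by (rule poly_mapping_eqI) (auto simp: act_S lookup_reflect form_simple_roots lookup_simple_root)

lemma uminus_root: "\<gamma> \<in> roots \<Longrightarrow> - \<gamma> \<in> roots"
proof (erule rootE)
  fix w s assume "w \<in> carrier W" "s \<in> S" "\<gamma> = act w (simple_root s)"
  then have "- \<gamma> = act (w \<otimes> s) (simple_root s)"
    by (simp add: act_mult S_carrier act_simple_root_self act_uminus)
  then show ?thesis unfolding roots_def
    using \<open>w \<in> carrier W\<close> \<open>s \<in> S\<close> S_carrier by blast
qed

lemma pos_root_iff: "\<gamma> \<in> pos_roots \<longleftrightarrow> \<gamma> \<in> roots \<and> nonneg \<gamma>"
  by (simp add: pos_roots_def nonneg_def)

text \<open>If s is a descent of w, the positivity lemma applies to \<open>w \<otimes> s\<close>,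
  which sends the simple root of s to - \<gamma>.\<close>

lemma root_pos_or_neg: "\<gamma> \<in> roots \<Longrightarrow> \<gamma> \<in> pos_roots \<or> - \<gamma> \<in> pos_roots"
proof (erule rootE)
  fix w s assume w: "w \<in> carrier W" "s \<in> S" "\<gamma> = act w (simple_root s)"
  have r: "\<gamma> \<in> roots" using w by (auto simp: roots_def)
  consider "len (w \<otimes> s) > len w" | "len w > len (w \<otimes> s)"
    using len_mult_S[OF w(1,2)] by linarith
  then show ?thesis
  proof cases
    case 1
    then show ?thesis using act_simple_root_nonneg[OF w(1,2)] w r by (simp add: pos_root_iff)
  next
    case 2
    have "w \<otimes> s \<otimes> s = w" using w S_carrier by (simp add: m_assoc S_square)
    then have "nonneg (act (w \<otimes> s) (simple_root s))"
      using act_simple_root_nonneg[of "w \<otimes> s" s] w S_carrier 2 by simp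
    then show ?thesis
      using w r uminus_root[OF r]
        by (simp add: pos_root_iff act_mult S_carrier act_simple_root_self act_uminus)
  qed
qed

lemma pos_not_neg: "\<gamma> \<in> pos_roots \<Longrightarrow> - \<gamma> \<notin> pos_roots"
proof
  assume "\<gamma> \<in> pos_roots" "- \<gamma> \<in> pos_roots"
  then have "lk \<gamma> k = 0" for k by (auto simp: pos_root_iff nonneg_def) (metis antisym)
  then have "\<gamma> = 0" by (intro poly_mapping_eqI) auto
  then show False using \<open>\<gamma> \<in> pos_roots\<close> root_nonzero by (auto simp: pos_root_iff)
qed

lemma root_neg_iff: "\<gamma> \<in> roots \<Longrightarrow> - \<gamma> \<in> pos_roots \<longleftrightarrow> \<gamma> \<notin> pos_roots"
  using pos_not_neg root_pos_or_neg by blast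

lemma pos_root_root: "\<gamma> \<in> pos_roots \<Longrightarrow> \<gamma> \<in> roots"
  by (simp add: pos_root_iff)

lemma simple_root_pos: "s \<in> S \<Longrightarrow> simple_root s \<in> pos_roots"
  by (simp add: pos_root_iff simple_root_in_roots nonneg_simple_root)

lemma root_pos_lookup: "\<gamma> \<in> roots \<Longrightarrow> lk \<gamma> k > 0 \<Longrightarrow> \<gamma> \<in> pos_roots"
  using root_pos_or_neg[of \<gamma>] by (auto simp: pos_roots_def) (meson linorder_not_le)

lemma root_neg_lookup: "\<gamma> \<in> roots \<Longrightarrow> lk \<gamma> k < 0 \<Longrightarrow> - \<gamma> \<in> pos_roots"
  using root_pos_lookup[of "- \<gamma>" k] uminus_root by auto

text \<open>The unit norm of roots determines the coefficient up to sign, and positivity makes it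
  1.\<close>

lemma pos_root_singleton:
  assumes "\<gamma> \<in> pos_roots" "ky \<gamma> \<subseteq> {s}" shows "\<gamma> = simple_root s"
proof -
  have g: "\<gamma> = scl (lk \<gamma> s) (simple_root s)"
    using vector_expansion[of "{s}" \<gamma>] assms by (simp add: simple_root_def)
  have "ky \<gamma> \<noteq> {}" using root_nonzero[of \<gamma>] assms by (auto simp: pos_root_iff)
  then have "ky \<gamma> = {s}" using assms by blast
  then have sS: "s \<in> S" using assms root_ky[of \<gamma>] by (auto simp: pos_root_iff)
  have "form \<gamma> \<gamma> = (lk \<gamma> s) * (lk \<gamma> s)"
    by (subst (1 2) g) (simp add: form_linear form_simple_roots sS)
  then have "(lk \<gamma> s)\<^sup>2 = 1"
    using root_unit[of \<gamma>] assms by (simp add: pos_root_iff power2_eq_square)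
  moreover have "lk \<gamma> s \<ge> 0" using assms by (auto simp: pos_roots_def)
  ultimately have "lk \<gamma> s = 1" by (simp add: power2_eq_1_iff)
  then show ?thesis using g by simp
qed

lemma pos_root_other_key:
  assumes "\<gamma> \<in> pos_roots" "\<gamma> \<noteq> simple_root s"
  obtains k where "k \<noteq> s" "lk \<gamma> k > 0"
proof -
  have "\<not> ky \<gamma> \<subseteq> {s}" using assms pos_root_singleton by blast
  then obtain k where "k \<noteq> s" "lk \<gamma> k \<noteq> 0" by (auto simp: in_keys_iff)
  moreover have "lk \<gamma> k \<ge> 0" using assms by (auto simp: pos_roots_def)
  ultimately show ?thesis using that[of k] by linarith
qed

text \<open>Only the coefficient at s changes, and a positive coefficient elsewhere decides the sign
  of the whole root.\<close>

lemma reflect_pos_root: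
  assumes "\<gamma> \<in> pos_roots" "\<gamma> \<noteq> simple_root s" "s \<in> S"
  shows "reflect s \<gamma> \<in> pos_roots"
proof -
  obtain k where "k \<noteq> s" "lk \<gamma> k > 0" using assms pos_root_other_key by metis
  then have "lk (reflect s \<gamma>) k > 0" by (simp add: lookup_reflect)
  moreover have "reflect s \<gamma> \<in> roots"
    using act_root[of s \<gamma>] assms S_carrier by (simp add: act_S pos_root_iff)
  ultimately show ?thesis using root_pos_lookup by blast
qed

lemma len_less_iff:
  assumes "w \<in> carrier W" "s \<in> S"
  shows "act w (simple_root s) \<in> pos_roots \<longleftrightarrow> len w < len (w \<otimes> s)"
proof
  assume "len w < len (w \<otimes> s)"
  then show "act w (simple_root s) \<in> pos_roots"
    using act_simple_root_nonneg assms by (simp add: pos_root_iff act_root simple_root_in_roots)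
next
  assume p: "act w (simple_root s) \<in> pos_roots"
  show "len w < len (w \<otimes> s)"
  proof (rule ccontr)
    assume "\<not> ?thesis"
    then have "len (w \<otimes> s) < len w" using len_mult_S[OF assms] by linarith
    moreover have "w \<otimes> s \<otimes> s = w" using assms S_carrier by (simp add: m_assoc S_square)
    ultimately have "nonneg (act (w \<otimes> s) (simple_root s))"
      using act_simple_root_nonneg[of "w \<otimes> s" s] assms S_carrier by simp
    then have "- act w (simple_root s) \<in> pos_roots"
      using assms p by (simp add: pos_root_iff uminus_root act_mult S_carrier act_simple_root_self act_uminus)
    then show False using pos_not_neg p by blast
  qed
qed

section \<open>Inversion sets and length\<close>

definition inv_set :: "'a \<Rightarrow> ('a \<Rightarrow>\<^sub>0 real) set" where
  "inv_set w = {\<gamma> \<in> pos_roots. - act w \<gamma> \<in> pos_roots}"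

lemma inv_set_iff: "w \<in> carrier W \<Longrightarrow> \<gamma> \<in> inv_set w \<longleftrightarrow> \<gamma> \<in> pos_roots \<and> act w \<gamma> \<notin> pos_roots"
  using root_neg_iff[of "act w \<gamma>"] act_root pos_root_root by (auto simp: inv_set_def)

text \<open>The reflection in s permutes the positive roots other than the simple root of s, so
  exactly one inversion is added to the transported ones.\<close>

lemma inv_set_mult_S:
  assumes "w \<in> carrier W" "s \<in> S" "act w (simple_root s) \<in> pos_roots"
  shows "inv_set (w \<otimes> s) = insert (simple_root s) (reflect s ` inv_set w)"
    and "simple_root s \<notin> reflect s ` inv_set w"
proof -
  have a: "act (w \<otimes> s) v = act w (reflect s v)" for v
    using assms S_carrier by (simp add: act_mult act_S)
  have rs: "reflect s (simple_root s) = - simple_root s" using act_simple_root_self act_S assms by metis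
  show "simple_root s \<notin> reflect s ` inv_set w"
  proof
    assume "simple_root s \<in> reflect s ` inv_set w"
    then obtain g where g: "g \<in> inv_set w" "simple_root s = reflect s g" by blast
    then have "- g = simple_root s" using reflect_twice[OF assms(2), of g] rs by (metis minus_minus)
    then show False using g pos_not_neg[of g] simple_root_pos[OF assms(2)] by (auto simp: inv_set_def)
  qed
  show "inv_set (w \<otimes> s) = insert (simple_root s) (reflect s ` inv_set w)" (is "?L = ?R")
  proof (rule subset_antisym)
    show "?L \<subseteq> ?R"
    proof
      fix g assume g: "g \<in> ?L"
      show "g \<in> ?R"
      proof (cases "g = simple_root s")
        case False
        then have "reflect s g \<in> inv_set w"
          using g assms reflect_pos_root by (auto simp: inv_set_def a)
        then show ?thesis using reflect_twice[OF assms(2), of g] by (metis image_eqI insertCI)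
      qed simp
    qed
    show "?R \<subseteq> ?L"
    proof
      fix g assume "g \<in> ?R"
      then consider "g = simple_root s" | h where "g = reflect s h" "h \<in> inv_set w" by blast
      then show "g \<in> ?L"
      proof cases
        case 1
        then show ?thesis using assms rs simple_root_pos by (simp add: inv_set_def a act_uminus)
      next
        case 2
        then have "h \<noteq> simple_root s" using assms pos_not_neg by (auto simp: inv_set_def)
        then show ?thesis using 2 assms reflect_pos_root by (auto simp: inv_set_def a reflect_twice)
      qed
    qed
  qed
qed

lemma inv_set_one [simp]: "inv_set \<one> = {}"
  using pos_not_neg by (auto simp: inv_set_def)

lemma finite_card_inv_set:
  assumes "w \<in> carrier W" shows "finite (inv_set w) \<and> card (inv_set w) = len w"
  using assms
proof (induction "len w" arbitrary: w)
  case 0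
  then show ?case using len_eq_0[of w] by simp
next
  case (Suc n)
  then have "w \<noteq> \<one>" by auto
  then obtain t where t: "t \<in> S" "len w = len (w \<otimes> t) + 1" using len_descent_ex Suc.prems by metis
  let ?v = "w \<otimes> t"
  have v: "?v \<in> carrier W" using Suc.prems t S_carrier by simp
  have w: "w = ?v \<otimes> t" using Suc.prems t S_carrier by (simp add: m_assoc S_square)
  have IH: "finite (inv_set ?v)" "card (inv_set ?v) = len ?v" using Suc.hyps(1)[of ?v] Suc.hyps(2) t v by auto
  have "act ?v (simple_root t) \<in> pos_roots" using len_less_iff[OF v t(1)] w t by simp
  note * = inv_set_mult_S[OF v t(1) this]
  have "inj (reflect t)" using reflect_twice[OF t(1)] by (metis injI)
  then have "card (reflect t ` inv_set ?v) = len ?v" using IH by (simp add: card_image inj_on_subset)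
  then have "finite (inv_set (?v \<otimes> t))" "card (inv_set (?v \<otimes> t)) = len ?v + 1"
    using * IH by simp_all
  then show ?case using w t by simp
qed

lemmas finite_inv_set = finite_card_inv_set[THEN conjunct1]
lemmas card_inv_set = finite_card_inv_set[THEN conjunct2]

lemma descent_ex:
  assumes "w \<in> carrier W" "w \<noteq> \<one>"
  obtains t where "t \<in> S" "- act w (simple_root t) \<in> pos_roots"
proof -
  obtain t where t: "t \<in> S" "len w = len (w \<otimes> t) + 1" using len_descent_ex assms by metis
  then have "act w (simple_root t) \<notin> pos_roots" using len_less_iff assms by simp
  then show ?thesis using that[of t] t assms root_neg_iff act_root simple_root_in_roots by blast
qed

text \<open>The roots inverted by w are those inverted by u together with the images under
  \<open>inv u\<close> of those inverted by \<open>w \<otimes> inv u\<close>: the inclusion prevents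
  the second factor from turning back a root inverted by u. Counting this disjoint union gives the
  lengths.\<close>

lemma len_mult_inv_of_inv_set_subset:
  assumes "w \<in> carrier W" "u \<in> carrier W" "inv_set u \<subseteq> inv_set w"
  shows "len w = len (w \<otimes> inv u) + len u"
proof -
  have a: "act (w \<otimes> inv u) v = act w (act (inv u) v)" for v using assms by (simp add: act_mult)
  have eq: "inv_set w = inv_set u \<union> act (inv u) ` inv_set (w \<otimes> inv u)"
  proof (intro subset_antisym subsetI)
    fix g assume g: "g \<in> inv_set w"
    show "g \<in> inv_set u \<union> act (inv u) ` inv_set (w \<otimes> inv u)"
    proof (cases "g \<in> inv_set u")
      case False
      then have "act u g \<in> pos_roots" using g assms by (auto simp: inv_set_iff)
      then have "act u g \<in> inv_set (w \<otimes> inv u)" using g assms by (simp add: inv_set_def a)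
      then show ?thesis using assms by (metis UnI2 act_inv_act image_eqI)
    qed simp
  next
    fix g assume "g \<in> inv_set u \<union> act (inv u) ` inv_set (w \<otimes> inv u)"
    then consider "g \<in> inv_set u" | h where "g = act (inv u) h" "h \<in> inv_set (w \<otimes> inv u)"
      by blast
    then show "g \<in> inv_set w"
    proof cases
      case 2
      have "g \<in> pos_roots"
      proof (rule ccontr)
        assume "g \<notin> pos_roots"
        then have "- g \<in> pos_roots" using 2 assms root_neg_iff act_root pos_root_root
          by (metis (no_types, lifting) inv_closed inv_set_def mem_Collect_eq)
        moreover have "act u (- g) = - h" using 2 assms by (simp add: act_uminus)
        ultimately have "- g \<in> inv_set u" using 2 by (simp add: inv_set_def)
        then have "- g \<in> inv_set w" using assms by blast
        then have "act w g \<in> pos_roots" using assms by (simp add: inv_set_def act_uminus)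
        then show False using 2 assms pos_not_neg by (auto simp: inv_set_def a)
      qed
      then show ?thesis using 2 by (simp add: inv_set_def a)
    qed (use assms in auto)
  qed
  have "inv_set u \<inter> act (inv u) ` inv_set (w \<otimes> inv u) = {}"
    using assms pos_not_neg by (auto simp: inv_set_def)
  moreover have "card (act (inv u) ` inv_set (w \<otimes> inv u)) = card (inv_set (w \<otimes> inv u))"
    by (intro card_image inj_on_inverseI[of _ "act u"]) (use assms in simp)
  ultimately have "card (inv_set w) = card (inv_set u) + card (inv_set (w \<otimes> inv u))"
    using eq assms finite_inv_set by (metis card_Un_disjoint finite_imageI inv_closed m_closed)
  then show ?thesis using assms by (simp add: card_inv_set)
qed

text \<open>By the preceding lemma the quotient has length 0. Longest elements, inverses of arcs and
  loops are recognized in this way.\<close>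

lemma inv_set_inj:
  assumes "w \<in> carrier W" "u \<in> carrier W" "inv_set w = inv_set u" shows "w = u"
proof -
  have "len (w \<otimes> inv u) = 0"
    using len_mult_inv_of_inv_set_subset[OF assms(1,2)] assms card_inv_set[of w] card_inv_set[of u] by simp
  then have "w \<otimes> inv u = \<one>" using len_eq_0 assms by simp
  then show ?thesis using assms by (metis inv_equality inv_inv inv_closed)
qed

text \<open>A conjugate of a generator. The condition on the support of v lets the invariance of
  \<open>form\<close> be applied.\<close>

lemma root_reflection_ex:
  assumes "\<gamma> \<in> roots"
  obtains r where "r \<in> carrier W" "\<And>v. ky v \<subseteq> S \<Longrightarrow> act r v = v - scl (2 * form \<gamma> v) \<gamma>"
proof -
  obtain g s where g: "g \<in> carrier W" "s \<in> S" "\<gamma> = act g (simple_root s)"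
    using assms rootE by metis
  show ?thesis
  proof
    show "g \<otimes> s \<otimes> inv g \<in> carrier W" using g S_carrier by simp
    fix v assume v: "ky v \<subseteq> S"
    have "form (simple_root s) (act (inv g) v) = form (act g (simple_root s)) (act g (act (inv g) v))"
      using g v ky_act by (subst form_act) auto
    then have *: "form (simple_root s) (act (inv g) v) = form \<gamma> v" using g by simp
    have "act (g \<otimes> s \<otimes> inv g) v = act g (reflect s (act (inv g) v))"
      using g S_carrier by (simp add: act_mult act_S)
    also have "\<dots> = v - scl (2 * form \<gamma> v) \<gamma>"
      unfolding reflect_eq * using g by (simp add: act_diff act_scl)
    finally show "act (g \<otimes> s \<otimes> inv g) v = v - scl (2 * form \<gamma> v) \<gamma>" .
  qed
qed

section \<open>Parabolic subgroups and longest elements\<close>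

text \<open>The roots belonging to a parabolic subgroup are described by their supports, not as an
  orbit, so that membership is read off from coefficients.\<close>

definition pos_on :: "'a set \<Rightarrow> ('a \<Rightarrow>\<^sub>0 real) set" where
  "pos_on K = {\<gamma> \<in> pos_roots. ky \<gamma> \<subseteq> K}"

lemma parabolic_subgroup: "J \<subseteq> S \<Longrightarrow> subgroup (parabolic J) W"
  unfolding parabolic_def using S_subset by (intro generate_is_subgroup) auto

lemma parabolic_carrier: "J \<subseteq> S \<Longrightarrow> w \<in> parabolic J \<Longrightarrow> w \<in> carrier W"
  using subgroup.mem_carrier parabolic_subgroup by metis

lemma parabolic_one: "\<one> \<in> parabolic J"
  unfolding parabolic_def by (rule generate.one)

lemma parabolic_S: "s \<in> J \<Longrightarrow> s \<in> parabolic J"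
  unfolding parabolic_def by (rule generate.incl)

lemma parabolic_mult: "w \<in> parabolic J \<Longrightarrow> u \<in> parabolic J \<Longrightarrow> w \<otimes> u \<in> parabolic J"
  unfolding parabolic_def by (rule generate.eng)

lemma parabolic_inv: "J \<subseteq> S \<Longrightarrow> w \<in> parabolic J \<Longrightarrow> inv w \<in> parabolic J"
  using subgroup.m_inv_closed parabolic_subgroup by metis

lemma parabolic_mono: "J \<subseteq> K \<Longrightarrow> parabolic J \<subseteq> parabolic K"
  unfolding parabolic_def by (rule mono_generate)

lemma lookup_act_parabolic:
  assumes "J \<subseteq> S" "w \<in> parabolic J" "k \<notin> J" shows "lk (act w v) k = lk v k"
proof -
  obtain ws where ws: "set ws \<subseteq> J" "word_prod W ws = w" using assms parabolic_word by metis
  have "lk (refl_word ws v) k = lk v k" using ws(1) assms(3)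
    by (induction ws) (auto simp: lookup_reflect)
  then show ?thesis using ws assms by (auto simp: act_word)
qed

lemma ky_act_parabolic:
  assumes "J \<subseteq> S" "w \<in> parabolic J" "J \<subseteq> K" "ky v \<subseteq> K" shows
    "ky (act w v) \<subseteq> K"
proof
  fix k assume "k \<in> ky (act w v)"
  then show "k \<in> K" using lookup_act_parabolic[OF assms(1,2), of k v] assms(3,4)
    by (cases "k \<in> J") (auto simp: in_keys_iff)
qed

lemma act_parabolic_orthogonal:
  assumes "J \<subseteq> S" "w \<in> parabolic J" "\<And>j. j \<in> J \<Longrightarrow> form (simple_root j) v = 0"
  shows "act w v = v"
proof -
  obtain ws where ws: "set ws \<subseteq> J" "word_prod W ws = w" using assms parabolic_word by metis
  have "refl_word ws v = v" using ws(1) assms(3)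
    by (induction ws) (auto simp: reflect_eq)
  then show ?thesis using ws assms by (auto simp: act_word)
qed

text \<open>The coefficients outside J do not change, and a single positive one decides the
  sign.\<close>

lemma parabolic_pos_root_outside:
  assumes "J \<subseteq> S" "w \<in> parabolic J" "\<gamma> \<in> pos_roots"
    "\<not> ky \<gamma> \<subseteq> J"
  shows "act w \<gamma> \<in> pos_roots"
proof -
  obtain k where k: "k \<notin> J" "lk \<gamma> k \<noteq> 0" using assms(4) by (auto simp: in_keys_iff)
  then have "lk (act w \<gamma>) k > 0" using lookup_act_parabolic[OF assms(1,2) k(1), of \<gamma>] assms(3)
    by (auto simp: pos_roots_def less_le)
  then show ?thesis using root_pos_lookup act_root parabolic_carrier assms pos_root_root by metis
qed

text \<open>Simple roots outside J stay positive under \<open>parabolic J\<close>, so w has no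
  descent at all.\<close>

lemma parabolic_trivial:
  assumes "J \<subseteq> S" "w \<in> parabolic J" "\<And>k. k \<in> J \<Longrightarrow> act w (simple_root k) \<in> pos_roots"
  shows "w = \<one>"
proof (rule ccontr)
  assume "w \<noteq> \<one>"
  then obtain t where t: "t \<in> S" "- act w (simple_root t) \<in> pos_roots"
    using descent_ex parabolic_carrier assms by metis
  have "act w (simple_root t) \<in> pos_roots"
    using assms parabolic_pos_root_outside[OF assms(1,2), of "simple_root t"] simple_root_pos[OF t(1)]
    by (cases "t \<in> J") auto
  then show False using t pos_not_neg by blast
qed

lemma inv_set_parabolic:
  assumes "J \<subseteq> S" "w \<in> parabolic J" shows "inv_set w \<subseteq> pos_on J"
proof
  fix g assume "g \<in> inv_set w"
  then show "g \<in> pos_on J"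
    using parabolic_pos_root_outside[OF assms, of g] pos_not_neg[of "act w g"]
    by (auto simp: inv_set_def pos_on_def)
qed

text \<open>Inversion sets embed the parabolic subgroup into the power set of
  \<open>pos_on J\<close>.\<close>

lemma finite_type_if_finite_pos_on:
  assumes "J \<subseteq> S" "finite (pos_on J)" shows "finite_type J"
proof -
  have "inj_on inv_set (parabolic J)"
    using inv_set_inj parabolic_carrier assms by (auto intro!: inj_onI)
  moreover have "inv_set ` parabolic J \<subseteq> Pow (pos_on J)" using inv_set_parabolic assms by auto
  ultimately show ?thesis unfolding finite_type_def
    using assms finite_imageD finite_subset[of "inv_set ` parabolic J" "Pow (pos_on J)"] by blast
qed

lemma act_expansion:
  assumes "w \<in> carrier W"
  shows "act w v = (\<Sum>k\<in>ky v. scl (lk v k) (act w (simple_root k)))"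
proof -
  have "act w v = act w (\<Sum>k\<in>ky v. scl (lk v k) (simple_root k))"
    using vector_expansion[of "ky v" v] by (simp add: simple_root_def)
  then show ?thesis using assms by (simp add: act_sum act_scl)
qed

lemma act_pos_combination:
  assumes "w \<in> carrier W" "\<gamma> \<in> pos_roots" "\<And>k. k \<in> ky \<gamma> \<Longrightarrow> act w (simple_root k) \<in> pos_roots"
  shows "act w \<gamma> \<in> pos_roots"
proof -
  have "nonneg (act w \<gamma>)" unfolding act_expansion[OF assms(1), of \<gamma>]
    using assms by (intro nonneg_sum nonneg_scl) (auto simp: pos_roots_def nonneg_def)
  then show ?thesis using assms by (simp add: pos_root_iff act_root)
qed

lemma act_neg_combination:
  assumes "w \<in> carrier W" "\<gamma> \<in> pos_roots" "\<And>k. k \<in> ky \<gamma> \<Longrightarrow> - act w (simple_root k) \<in> pos_roots"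
  shows "- act w \<gamma> \<in> pos_roots"
proof -
  have "- act w \<gamma> = (\<Sum>k\<in>ky \<gamma>. scl (lk \<gamma> k) (- act w (simple_root k)))"
    unfolding act_expansion[OF assms(1), of \<gamma>]
    by (rule poly_mapping_eqI) (simp add: lookup_sum sum_negf)
  also have "nonneg \<dots>"
    using assms by (intro nonneg_sum nonneg_scl) (auto simp: pos_roots_def nonneg_def)
  finally show ?thesis using assms by (simp add: pos_root_iff act_root uminus_root)
qed

text \<open>Simple roots are extremal in the cone spanned by the positive roots: at a coordinate
  other than k the sum of nonnegative terms is 0, so a summand with positive weight is supported in
  k alone.\<close>

lemma simple_root_indecomposable:
  assumes "finite A" "simple_root k = (\<Sum>j\<in>A. scl (c j) (\<delta> j))"
    "\<And>j. j \<in> A \<Longrightarrow> c j \<ge> 0" "\<And>j. j \<in> A \<Longrightarrow> \<delta> j \<in> pos_roots"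
  obtains j where "j \<in> A" "c j > 0" "\<delta> j = simple_root k"
proof -
  have "\<exists>j\<in>A. c j > 0"
  proof (rule ccontr)
    assume "\<not> ?thesis"
    then have "\<And>j. j \<in> A \<Longrightarrow> c j = 0" using assms(3) by force
    then have "simple_root k = 0" using assms(2) by simp
    then show False using ky_simple_root[of k] by simp
  qed
  then obtain j where j: "j \<in> A" "c j > 0" by blast
  have "ky (\<delta> j) \<subseteq> {k}"
  proof
    fix i assume i: "i \<in> ky (\<delta> j)"
    show "i \<in> {k}"
    proof (rule ccontr)
      assume "i \<notin> {k}"
      then have "(\<Sum>j\<in>A. c j * lk (\<delta> j) i) = 0"
        using arg_cong[OF assms(2), of "\<lambda>v. lk v i"] by (simp add: lookup_sum lookup_simple_root)
      moreover have "\<And>j. j \<in> A \<Longrightarrow> c j * lk (\<delta> j) i \<ge> 0"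
        using assms(3,4) by (auto simp: pos_roots_def)
      ultimately have "c j * lk (\<delta> j) i = 0"
        using sum_nonneg_eq_0_iff[OF assms(1), of "\<lambda>j. c j * lk (\<delta> j) i"] j(1) by blast
      then show False using i j by (simp add: in_keys_iff)
    qed
  qed
  then show ?thesis using that[of j] j pos_root_singleton assms(4) by blast
qed

text \<open>With J = [x]\<sim>T this is the arc at x if T is a singleton, and the common product of
  the two sides of a 2-cell if T has two members.\<close>

definition relative_w0 :: "'a set \<Rightarrow> 'a set \<Rightarrow> 'a" where
  "relative_w0 J T = w0 J \<otimes> w0 (J - T)"

context
  fixes J assumes J: "J \<subseteq> S" and fin: "finite_type J"
begin

lemma finite_parabolic: "finite (parabolic J)" using fin by (simp add: finite_type_def)

lemma finite_type_finite: "finite J"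
  using finite_parabolic parabolic_S by (meson finite_subset subsetI)

text \<open>At maximal length every member of J is a descent, so all positive combinations of these
  roots become negative. As the inversion set is thus prescribed, the element is unique and
  \<open>w0 J\<close> is well defined.\<close>

lemma arg_max_inv_set:
  assumes "is_arg_max len (\<lambda>u. u \<in> parabolic J) w" shows "inv_set w = pos_on J"
proof
  have wJ: "w \<in> parabolic J" using assms by (auto simp: is_arg_max_def)
  then have w: "w \<in> carrier W" using J parabolic_carrier by blast
  show "inv_set w \<subseteq> pos_on J" by (rule inv_set_parabolic[OF J wJ])
  have "- act w (simple_root k) \<in> pos_roots" if "k \<in> J" for k
  proof -
    have "w \<otimes> k \<in> parabolic J" using wJ that parabolic_S parabolic_mult by blast
    then have "\<not> len (w \<otimes> k) > len w" using assms by (auto simp: is_arg_max_def)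
    then have "act w (simple_root k) \<notin> pos_roots" using len_less_iff w that J by blast
    then show ?thesis using root_neg_iff act_root simple_root_in_roots w that J by blast
  qed
  then show "pos_on J \<subseteq> inv_set w"
    using act_neg_combination[OF w] by (auto simp: pos_on_def inv_set_def)
qed

lemma w0_arg_max: "is_arg_max len (\<lambda>u. u \<in> parabolic J) (w0 J)"
  unfolding w0_def
proof (rule theI')
  show "\<exists>!w. is_arg_max len (\<lambda>u. u \<in> parabolic J) w"
  proof (rule ex_ex1I)
    have "len ` parabolic J \<noteq> {}" using parabolic_one by auto
    then obtain w where "w \<in> parabolic J" "len w = Max (len ` parabolic J)"
      using Max_in[of "len ` parabolic J"] finite_parabolic by fastforce
    then have "is_arg_max len (\<lambda>u. u \<in> parabolic J) w"
      using finite_parabolic by (auto simp: is_arg_max_def not_less)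
    then show "\<exists>w. is_arg_max len (\<lambda>u. u \<in> parabolic J) w" ..
  next
    fix w u
    assume "is_arg_max len (\<lambda>u. u \<in> parabolic J) w"
      "is_arg_max len (\<lambda>u. u \<in> parabolic J) u"
    then show "w = u" using arg_max_inv_set inv_set_inj[of w u] parabolic_carrier[OF J]
      by (auto simp: is_arg_max_def)
  qed
qed

lemma w0_parabolic: "w0 J \<in> parabolic J"
  using w0_arg_max by (simp add: is_arg_max_def)

lemma w0_carrier: "w0 J \<in> carrier W"
  using w0_parabolic parabolic_carrier J by blast

lemma inv_set_w0: "inv_set (w0 J) = pos_on J"
  using arg_max_inv_set w0_arg_max by blast

lemma finite_pos_on: "finite (pos_on J)"
  using finite_inv_set[OF w0_carrier] inv_set_w0 by simp

text \<open>The inverse of the longest element makes the simple roots of J negative as well.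
  Expanding \<beta> and mapping it back writes the given simple root as a nonnegative combination of
  positive roots, and by indecomposability one of them is that simple root.\<close>

lemma w0_simple_root:
  assumes "k \<in> J" obtains j where "j \<in> J" "act (w0 J) (simple_root k) = - simple_root j"
proof -
  let ?w = "w0 J"
  have kS: "k \<in> S" using assms J by auto
  define \<beta> where "\<beta> = - act ?w (simple_root k)"
  have "simple_root k \<in> pos_on J" using assms simple_root_pos kS by (simp add: pos_on_def)
  then have \<beta>: "\<beta> \<in> pos_roots" using inv_set_w0 by (auto simp: \<beta>_def inv_set_def)
  have "ky \<beta> \<subseteq> J" unfolding \<beta>_def keys_minus
    using ky_act_parabolic[OF J w0_parabolic subset_refl] assms by simp
  have neg: "- act (inv ?w) (simple_root j) \<in> pos_roots" if "j \<in> J" for j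
  proof (rule ccontr)
    let ?d = "act (inv ?w) (simple_root j)"
    assume "- ?d \<notin> pos_roots"
    then have "?d \<in> pos_roots"
      using root_pos_or_neg[of ?d] act_root w0_carrier simple_root_in_roots that J by auto
    moreover have "ky ?d \<subseteq> J"
      using ky_act_parabolic[OF J parabolic_inv[OF J w0_parabolic] subset_refl] that by simp
    ultimately have "?d \<in> inv_set ?w" by (simp add: inv_set_w0 pos_on_def)
    then show False using w0_carrier pos_not_neg simple_root_pos that J by (auto simp: inv_set_def)
  qed
  have "simple_root k = - act (inv ?w) \<beta>" using w0_carrier by (simp add: \<beta>_def act_uminus)
  also have "\<dots> = (\<Sum>j\<in>ky \<beta>. scl (lk \<beta> j) (- act (inv ?w) (simple_root j)))"
    unfolding act_expansion[OF inv_closed[OF w0_carrier], of \<beta>]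
    by (rule poly_mapping_eqI) (simp add: lookup_sum sum_negf)
  finally obtain j where j: "j \<in> ky \<beta>" "- act (inv ?w) (simple_root j) = simple_root k"
    by (rule simple_root_indecomposable[rotated])
      (use neg \<open>ky \<beta> \<subseteq> J\<close> \<beta> in \<open>auto simp: pos_roots_def\<close>)
  then have "act ?w (simple_root k) = act ?w (- act (inv ?w) (simple_root j))" by simp
  also have "\<dots> = - simple_root j" using w0_carrier by (simp add: act_uminus)
  finally show ?thesis using that[of j] j \<open>ky \<beta> \<subseteq> J\<close> by blast
qed

lemma finite_type_subset: "L \<subseteq> J \<Longrightarrow> finite_type L"
  using finite_parabolic parabolic_mono finite_subset by (metis finite_type_def)

end

context
  fixes J T :: "'a set" assumes J: "J \<subseteq> S" and fin: "finite_type J"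
begin

lemma Diff_finite_type: "J - T \<subseteq> S" "finite_type (J - T)"
  using J finite_type_subset[OF J fin, of "J - T"] by auto

lemma relative_w0_parabolic: "relative_w0 J T \<in> parabolic J"
  unfolding relative_w0_def
  using w0_parabolic[OF J fin] w0_parabolic[OF Diff_finite_type] parabolic_mono[of "J - T" J] parabolic_mult
  by blast

lemma relative_w0_carrier: "relative_w0 J T \<in> carrier W"
  using relative_w0_parabolic parabolic_carrier J by blast

lemma act_relative_w0: "act (relative_w0 J T) v = act (w0 J) (act (w0 (J - T)) v)"
  unfolding relative_w0_def by (rule act_mult) (use w0_carrier J fin Diff_finite_type in auto)

text \<open>The first factor to act negates the roots supported in J - T within J and keeps the
  other positive roots of J positive; the longest element of J then reverses all signs.\<close>

lemma inv_set_relative_w0: "inv_set (relative_w0 J T) = pos_on J - pos_on (J - T)"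
proof (intro subset_antisym subsetI)
  fix g assume g: "g \<in> inv_set (relative_w0 J T)"
  then have gJ: "g \<in> pos_on J" using inv_set_parabolic[OF J relative_w0_parabolic] by blast
  moreover have "g \<notin> pos_on (J - T)"
  proof
    assume gL: "g \<in> pos_on (J - T)"
    let ?d = "- act (w0 (J - T)) g"
    have "?d \<in> pos_roots" using gL inv_set_w0[OF Diff_finite_type] by (auto simp: inv_set_def)
    moreover have "ky ?d \<subseteq> J" unfolding keys_minus
      using ky_act_parabolic[OF Diff_finite_type(1) w0_parabolic[OF Diff_finite_type], of J g] gJ
      by (auto simp: pos_on_def)
    ultimately have "?d \<in> inv_set (w0 J)" using inv_set_w0[OF J fin] by (simp add: pos_on_def)
    then have "act (relative_w0 J T) g \<in> pos_roots"
      using w0_carrier[OF J fin] by (simp add: inv_set_def act_relative_w0 act_uminus)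
    then show False using g pos_not_neg by (auto simp: inv_set_def)
  qed
  ultimately show "g \<in> pos_on J - pos_on (J - T)" by blast
next
  fix g assume g: "g \<in> pos_on J - pos_on (J - T)"
  let ?d = "act (w0 (J - T)) g"
  have "?d \<in> pos_roots"
    using parabolic_pos_root_outside[OF Diff_finite_type(1) w0_parabolic[OF Diff_finite_type], of g] g
    by (auto simp: pos_on_def)
  moreover have "ky ?d \<subseteq> J"
    using ky_act_parabolic[OF Diff_finite_type(1) w0_parabolic[OF Diff_finite_type], of J g] g
    by (auto simp: pos_on_def)
  ultimately have "?d \<in> inv_set (w0 J)" using inv_set_w0[OF J fin] by (simp add: pos_on_def)
  then show "g \<in> inv_set (relative_w0 J T)"
    using g by (simp add: inv_set_def act_relative_w0 pos_on_def)
qed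

lemma relative_w0_simple_root:
  assumes "l \<in> J - T"
  obtains j where "j \<in> J" "act (relative_w0 J T) (simple_root l) = simple_root j"
proof -
  obtain k where k: "k \<in> J - T" "act (w0 (J - T)) (simple_root l) = - simple_root k"
    using w0_simple_root[OF Diff_finite_type assms] by metis
  obtain j where j: "j \<in> J" "act (w0 J) (simple_root k) = - simple_root j"
    using w0_simple_root[OF J fin, of k] k by blast
  then have "act (relative_w0 J T) (simple_root l) = simple_root j"
    using k w0_carrier[OF J fin] by (simp add: act_relative_w0 act_uminus)
  then show ?thesis using that j by blast
qed

end

section \<open>Finiteness criterion for components\<close>

lemma sim_subset: "sim X T \<subseteq> X \<union> T"
proof
  fix k assume "k \<in> sim X T"
  then obtain t where "t \<in> T" "(t, k) \<in> (coxeter_graph \<inter> (X \<union> T) \<times> (X \<union> T))\<^sup>*"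
    by (auto simp: sim_def)
  then show "k \<in> X \<union> T" by (auto elim: rtranclE)
qed

lemma subset_sim: "T \<subseteq> sim X T"
  by (auto simp: sim_def)

lemma sim_induct [consumes 1, case_names base step]:
  assumes "k \<in> sim X T" "\<And>t. t \<in> T \<Longrightarrow> P t"
    "\<And>j k. j \<in> sim X T \<Longrightarrow> k \<in> sim X T \<Longrightarrow> (j, k) \<in> coxeter_graph \<Longrightarrow> P j \<Longrightarrow> P k"
  shows "P k"
proof -
  let ?R = "coxeter_graph \<inter> (X \<union> T) \<times> (X \<union> T)"
  obtain t where t: "t \<in> T" "(t, k) \<in> ?R\<^sup>*" using assms(1) by (auto simp: sim_def)
  from t(2) have "P k \<and> k \<in> sim X T"
  proof (induction rule: rtrancl_induct)
    case base
    then show ?case using t assms(2) subset_sim by blast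
  next
    case (step j k)
    then have "k \<in> sim X T" using t unfolding sim_def by (meson ImageI rtrancl.rtrancl_into_rtrancl)
    then show ?case using step assms(3) by blast
  qed
  then show ?thesis ..
qed

lemma sim_edge: "j \<in> sim X T \<Longrightarrow> (j, k) \<in> coxeter_graph \<Longrightarrow> k \<in> X \<union> T \<Longrightarrow> k \<in> sim X T"
proof -
  assume a: "j \<in> sim X T" "(j, k) \<in> coxeter_graph" "k \<in> X \<union> T"
  then obtain t where "t \<in> T" "(t, j) \<in> (coxeter_graph \<inter> (X \<union> T) \<times> (X \<union> T))\<^sup>*"
    by (auto simp: sim_def)
  moreover have "(j, k) \<in> coxeter_graph \<inter> (X \<union> T) \<times> (X \<union> T)"
    using a sim_subset by blast
  ultimately show ?thesis unfolding sim_def by (meson ImageI rtrancl.rtrancl_into_rtrancl)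
qed

lemma coxeter_graph_sym: "(j, k) \<in> coxeter_graph \<Longrightarrow> (k, j) \<in> coxeter_graph"
  using m_commute by (auto simp: coxeter_graph_def)

lemma gram_sim_outside:
  assumes "X \<union> T \<subseteq> S" "j \<in> sim X T" "k \<in> X \<union> T" "k \<notin> sim X T"
  shows "gram j k = 0"
  using assms sim_edge sim_subset coxeter_graph_gram[of j k] by blast

lemma form_eq_sum_right:
  "form v u = (\<Sum>k\<in>ky u. lk u k * form v (simple_root k))"
  by (subst vector_expansion[of "ky u" u]) (simp_all add: form_sum_right form_scl_right simple_root_def)

lemma root_not_orthogonal_to_support:
  assumes "\<gamma> \<in> roots" obtains k where "k \<in> ky \<gamma>"
    "form \<gamma> (simple_root k) \<noteq> 0"
proof -
  have "\<exists>k\<in>ky \<gamma>. form \<gamma> (simple_root k) \<noteq> 0"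
  proof (rule ccontr)
    assume "\<not> ?thesis"
    then have "form \<gamma> \<gamma> = 0" using form_eq_sum_right[of \<gamma> \<gamma>] by simp
    then show False using root_unit[OF assms] by simp
  qed
  then show ?thesis using that by blast
qed

lemma proportional_pos_roots:
  assumes "\<gamma> \<in> pos_roots" "\<gamma>' \<in> pos_roots" "\<gamma> = scl c d"
    "\<gamma>' = scl c' d" shows "\<gamma> = \<gamma>'"
proof -
  have "c * c * form d d = 1" "c' * c' * form d d = 1"
    using root_unit[of \<gamma>] root_unit[of \<gamma>'] assms pos_root_root
      by (auto simp: form_linear mult.assoc)
  then have "c\<^sup>2 = c'\<^sup>2"
    by (metis mult_cancel_right power2_eq_square zero_neq_one mult_zero_right)
  then have "c = c' \<or> c = - c'" by (simp add: power2_eq_iff)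
  then show ?thesis using assms pos_not_neg[of \<gamma>'] by (auto simp: scl_uminus_left)
qed

text \<open>If only finitely many positive roots of a union of components \<open>K\<close> involve \<open>T\<close>, then reflecting
  one of these in a root \<open>\<gamma>\<close> not involving \<open>T\<close> expresses \<open>\<gamma>\<close> through the difference of two of
  them; connectedness ensures that some such reflection is not trivial.\<close>

lemma finite_type_simI:
  assumes XT: "X \<subseteq> S" "T \<subseteq> S" and fin: "finite (pos_on (sim X T) - pos_on (sim X T - T))"
  shows "finite_type (sim X T)"
proof -
  define K where "K = sim X T"
  define F where "F = pos_on K - pos_on (K - T)"
  have K: "K \<subseteq> S" using XT sim_subset K_def by blast
  have F_iff: "\<theta> \<in> F \<longleftrightarrow> \<theta> \<in> pos_roots \<and> ky \<theta> \<subseteq> K \<and> (\<exists>t\<in>T. lk \<theta> t > 0)" for \<theta>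
    by (auto simp: F_def pos_on_def pos_roots_def in_keys_iff less_le)
  have F_reflect: "\<theta> - scl c \<gamma> \<in> F"
    if th: "\<theta> \<in> F" and g: "ky \<gamma> \<subseteq> K - T" and rt:
      "\<theta> - scl c \<gamma> \<in> roots" for \<theta> c \<gamma>
  proof -
    have "ky \<theta> \<subseteq> K" using th F_iff by blast
    then have k: "ky (\<theta> - scl c \<gamma>) \<subseteq> K"
      using g keys_diff[of \<theta> "scl c \<gamma>"] keys_scl_subset[of c \<gamma>] by blast
    obtain t where t: "t \<in> T" "lk \<theta> t > 0" using th F_iff by blast
    then have "lk \<gamma> t = 0" using g by (auto simp: in_keys_iff)
    then have "lk (\<theta> - scl c \<gamma>) t > 0" using t by (simp add: lookup_minus)
    then show ?thesis using k t rt root_pos_lookup F_iff by blast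
  qed
  have F_S: "ky \<theta> \<subseteq> S" if "\<theta> \<in> F" for \<theta> using that K F_iff by blast
  have F_root: "\<theta> \<in> roots" if "\<theta> \<in> F" for \<theta>
    using that F_iff pos_root_root by blast
  \<comment> \<open>Both \<theta> and its reflection in k lie in F. A vector orthogonal to both is
    orthogonal to their difference, a multiple of the simple root of k.\<close>
  have orth_step: "form (simple_root k) \<theta> = 0"
    if v: "\<And>\<theta>. \<theta> \<in> F \<Longrightarrow> form v \<theta> = 0" and k:
      "form v (simple_root k) \<noteq> 0" "k \<in> K - T" "\<theta> \<in> F" for v k \<theta>
  proof -
    have "k \<in> S" using k K by auto
    then have "reflect k \<theta> \<in> roots"
      using act_root[OF S_carrier F_root[OF k(3)], of k] by (simp add: act_S)
    then have "\<theta> - scl (2 * form (simple_root k) \<theta>) (simple_root k) \<in> F"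
      using F_reflect[OF k(3), of "simple_root k"] k(2) by (simp add: reflect_eq)
    then have "form v \<theta> - 2 * form (simple_root k) \<theta> * form v (simple_root k) = 0"
      using v[of "\<theta> - scl (2 * form (simple_root k) \<theta>) (simple_root k)"]
        by (simp add: form_linear)
    then show ?thesis using v[OF k(3)] k(1) by simp
  qed
  have simple_F: "simple_root t \<in> F" if "t \<in> T" for t
  proof -
    have "t \<in> S" "t \<in> K" using that XT subset_sim[of T X] K_def by auto
    moreover have "lk (simple_root t) t > 0" by (simp add: lookup_simple_root)
    ultimately show ?thesis unfolding F_iff using that simple_root_pos by auto
  qed
  \<comment> \<open>If F were orthogonal to the simple root of k, it would also be orthogonal to
    that of the neighbour j, and so on back to T, whose simple roots belong to F and are not
    orthogonal to their neighbours.\<close>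
  have no_orth: "k \<in> T \<or> (\<exists>\<theta>\<in>F. form (simple_root k) \<theta> \<noteq> 0)"
    if "k \<in> K" for k
    using that unfolding K_def
  proof (induction rule: sim_induct)
    case (step j k)
    then have "j \<in> S" "k \<in> S" "j \<noteq> k" by (auto simp: coxeter_graph_def)
    then have g: "form (simple_root k) (simple_root j) \<noteq> 0"
      using step.hyps(3) coxeter_graph_gram[of k j] coxeter_graph_sym form_simple_roots by metis
    show ?case
    proof (rule ccontr)
      assume n: "\<not> ?case"
      then have "j \<notin> T" using g simple_F by blast
      then have "\<And>\<theta>. \<theta> \<in> F \<Longrightarrow> form (simple_root j) \<theta> = 0"
        using orth_step[of "simple_root k" j] n g step.hyps(1) K_def by blast
      then show False using step.IH \<open>j \<notin> T\<close> by blast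
    qed
  qed simp
  have ex: "\<exists>\<theta>\<in>F. form \<gamma> \<theta> \<noteq> 0"
    if \<gamma>: "\<gamma> \<in> pos_on (K - T)" for \<gamma>
  proof (rule ccontr)
    assume n: "\<not> ?thesis"
    obtain k where "k \<in> ky \<gamma>" "form \<gamma> (simple_root k) \<noteq> 0"
      using root_not_orthogonal_to_support[of \<gamma>] \<gamma> by (auto simp: pos_on_def pos_root_iff)
    then show False using orth_step[of \<gamma> k] n no_orth[of k] \<gamma> by (auto simp: pos_on_def)
  qed
  have "pos_on (K - T) \<subseteq> (\<Union>\<theta>\<in>F. \<Union>\<theta>'\<in>F. {\<gamma> \<in> pos_roots. \<exists>c. \<gamma> = scl c (\<theta> - \<theta>')})"
  proof
    fix \<gamma> assume \<gamma>: "\<gamma> \<in> pos_on (K - T)"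
    then obtain \<theta> where \<theta>: "\<theta> \<in> F" "form \<gamma> \<theta> \<noteq> 0"
      using ex by blast
    obtain r where r: "r \<in> carrier W" "\<And>v. ky v \<subseteq> S \<Longrightarrow> act r v = v - scl (2 * form \<gamma> v) \<gamma>"
      using root_reflection_ex[of \<gamma>] \<gamma> by (auto simp: pos_on_def pos_root_iff)
    let ?t = "\<theta> - scl (2 * form \<gamma> \<theta>) \<gamma>"
    have "?t \<in> roots" using r(2)[OF F_S[OF \<theta>(1)]] act_root[OF r(1) F_root[OF \<theta>(1)]] by simp
    then have "?t \<in> F" using F_reflect[OF \<theta>(1)] \<gamma> by (auto simp: pos_on_def)
    moreover have "\<exists>c. \<gamma> = scl c (\<theta> - ?t)"
      by (rule exI[of _ "1 / (2 * form \<gamma> \<theta>)"]) (use \<theta>(2) in \<open>auto intro!: poly_mapping_eqI simp: lookup_minus\<close>)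
    ultimately show "\<gamma> \<in> (\<Union>\<theta>\<in>F. \<Union>\<theta>'\<in>F. {\<gamma> \<in> pos_roots. \<exists>c. \<gamma> = scl c (\<theta> - \<theta>')})"
      using \<theta>(1) \<gamma> by (simp only: pos_on_def) blast
  qed
  \<comment> \<open>A line contains at most one positive root, so the pairs from F bound the number
    of roots \<gamma>.\<close>
  moreover have "finite {\<gamma> \<in> pos_roots. \<exists>c. \<gamma> = scl c d}" (is "finite ?X") for d
  proof (cases "?X = {}")
    case False
    then obtain g where "g \<in> ?X" by blast
    then have "?X \<subseteq> {g}" using proportional_pos_roots by blast
    then show ?thesis by (rule finite_subset) simp
  next
    case True
    then show ?thesis by (simp only: finite.emptyI)
  qed
  ultimately have "finite (pos_on (K - T))"
    by (elim finite_subset) (use fin in \<open>simp add: F_def K_def\<close>)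
  then have "finite (pos_on K)" using fin by (simp add: K_def)
  then show ?thesis using finite_type_if_finite_pos_on[OF K] K_def by simp
qed

section \<open>Pointwise stabilizers\<close>

text \<open>Finitely many hyperplanes do not cover the span of L. A vector on the newest hyperplane
  is moved in a direction transversal to it, by a nonzero amount avoiding the finitely many values
  at which it would meet an older one.\<close>

lemma generic_vector_ex:
  assumes "finite R" "\<And>\<gamma>. \<gamma> \<in> R \<Longrightarrow> \<exists>j\<in>L. form (simple_root j) \<gamma> \<noteq> 0"
  shows "\<exists>v. ky v \<subseteq> L \<and> (\<forall>\<gamma>\<in>R. form v \<gamma> \<noteq> 0)"
  using assms
proof (induction R rule: finite_induct)
  case empty
  show ?case by (rule exI[of _ 0]) simp
next
  case (insert g R)
  then obtain v where v: "ky v \<subseteq> L" "\<forall>\<gamma>\<in>R. form v \<gamma> \<noteq> 0" by auto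
  show ?case
  proof (cases "form v g = 0")
    case True
    obtain j where j: "j \<in> L" "form (simple_root j) g \<noteq> 0" using insert.prems by blast
    have "finite (insert 0 ((\<lambda>\<gamma>. - form v \<gamma> / form (simple_root j) \<gamma>) ` R))"
      using insert by simp
    then obtain e :: real where e: "e \<noteq> 0" "\<And>\<gamma>. \<gamma> \<in> R \<Longrightarrow> e \<noteq> - form v \<gamma> / form (simple_root j) \<gamma>"
      using ex_new_if_finite[OF infinite_UNIV_char_0] by (metis (no_types, lifting) image_eqI insertCI)
    have "form (v + scl e (simple_root j)) \<gamma> \<noteq> 0" if "\<gamma> \<in> insert g R" for \<gamma>
    proof (cases "\<gamma> = g")
      case False
      then have \<gamma>: "\<gamma> \<in> R" using that by simp
      show ?thesis
      proof (cases "form (simple_root j) \<gamma> = 0")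
        case True
        then show ?thesis using v \<gamma> by (simp add: form_linear)
      next
        case False
        then show ?thesis using e(2)[OF \<gamma>] by (auto simp: form_linear field_simps)
      qed
    qed (use j e True in \<open>simp add: form_linear\<close>)
    moreover have "ky (v + scl e (simple_root j)) \<subseteq> L"
      using keys_add[of v "scl e (simple_root j)"] keys_scl_subset[of e "simple_root j"] v j by auto
    ultimately show ?thesis by blast
  qed (use v in auto)
qed

text \<open>A generic vector of the span of \<open>L\<close> is moved into the open fundamental chamber of \<open>W\<^sub>K\<close> by
  maximizing the coefficient sum over its orbit.\<close>

lemma fixing_element_orthogonal_root:
  assumes K: "K \<subseteq> S" "finite_type K" and "L \<subseteq> K" and w: "w \<in> parabolic K"
    "w \<noteq> \<one>"
    and fixed: "\<And>j. j \<in> L \<Longrightarrow> act w (simple_root j) = simple_root j"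
  obtains \<gamma> where "\<gamma> \<in> pos_on K" "\<And>j. j \<in> L \<Longrightarrow> form \<gamma> (simple_root j) = 0"
proof (rule ccontr)
  note obt = that
  assume "\<not> thesis"
  then have n: "\<exists>j\<in>L. form \<gamma> (simple_root j) \<noteq> 0"
    if "\<gamma> \<in> pos_on K" for \<gamma>
    using that \<open>\<not> thesis\<close> obt by blast
  have "form (simple_root j) \<gamma> = form \<gamma> (simple_root j)"
    if "j \<in> L" "\<gamma> \<in> pos_on K" for j \<gamma>
    using that assms by (intro form_commute) (auto simp: pos_on_def)
  with n have "\<And>\<gamma>. \<gamma> \<in> pos_on K \<Longrightarrow> \<exists>j\<in>L. form (simple_root j) \<gamma> \<noteq> 0" by metis
  then obtain v where v: "ky v \<subseteq> L" "\<And>\<gamma>. \<gamma> \<in> pos_on K \<Longrightarrow> form v \<gamma> \<noteq> 0"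
    using generic_vector_ex[OF finite_pos_on[OF K], of L] by blast
  have wW: "w \<in> carrier W" using w K parabolic_carrier by blast
  have vS: "ky v \<subseteq> S" "ky v \<subseteq> K" using v assms by auto
  have wv: "act w v = v"
  proof -
    have "act w v = (\<Sum>k\<in>ky v. scl (lk v k) (simple_root k))"
      unfolding act_expansion[OF wW, of v] using fixed v by (intro sum.cong) auto
    then show ?thesis using vector_expansion[of "ky v" v] by (simp add: simple_root_def)
  qed
  have finK: "finite K" by (rule finite_type_finite[OF K])
  define h where "h u = (\<Sum>k\<in>K. lk u k)" for u
  have "finite ((\<lambda>g. h (act g v)) ` parabolic K)" "(\<lambda>g. h (act g v)) ` parabolic K \<noteq> {}"
    using finite_parabolic[OF K] parabolic_one by auto
  from Max_in[OF this] obtain g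
    where g1: "g \<in> parabolic K" "h (act g v) = Max ((\<lambda>g. h (act g v)) ` parabolic K)" by auto
  have g2: "h (act g' v) \<le> h (act g v)" if "g' \<in> parabolic K" for g'
    unfolding g1(2) using finite_parabolic[OF K] that by (intro Max_ge) auto
  note g = g1(1) g2
  have gW: "g \<in> carrier W" using g K parabolic_carrier by blast
  define v' where "v' = act g v"
  have v'S: "ky v' \<subseteq> S" using ky_act gW vS v'_def by simp
  \<comment> \<open>Reflecting in k changes the coefficient sum by - 2 times this value, so
    maximality makes it nonnegative. The value 0 would put the generic vector v on the hyperplane of
    a root of K.\<close>
  have pos: "form v' (simple_root k) > 0" if k: "k \<in> K" for k
  proof -
    have kS: "k \<in> S" using k K by auto
    have comm: "form v' (simple_root k) = form (simple_root k) v'"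
      using form_commute v'S kS by simp
    have "h (act (k \<otimes> g) v) \<le> h v'" using g k parabolic_S parabolic_mult v'_def by blast
    moreover have "act (k \<otimes> g) v = reflect k v'"
      using gW kS S_carrier by (simp add: act_mult act_S v'_def)
    moreover have "h (reflect k v') = h v' - 2 * form (simple_root k) v'"
      unfolding h_def using finK k by (simp add: lookup_reflect sum_subtractf)
    ultimately have "form (simple_root k) v' \<ge> 0" by simp
    moreover have "form v' (simple_root k) \<noteq> 0"
    proof
      let ?d = "act (inv g) (simple_root k)"
      assume "form v' (simple_root k) = 0"
      moreover have "form v' (simple_root k) = form (act g v) (act g ?d)" using gW v'_def by simp
      ultimately have 0: "form v ?d = 0"
        using form_act[OF gW vS(1), of ?d] ky_act[of "inv g" "simple_root k"] gW kS by simp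
      have dK: "ky ?d \<subseteq> K"
        using ky_act_parabolic[OF K(1) parabolic_inv[OF K(1) g(1)] subset_refl] k by simp
      have "?d \<in> roots" using act_root gW simple_root_in_roots kS by simp
      then have "?d \<in> pos_on K \<or> - ?d \<in> pos_on K"
        using root_pos_or_neg dK by (auto simp: pos_on_def)
      then show False using v(2) 0 by (auto simp: form_linear) (metis form_uminus_right neg_equal_0_iff_equal)
    qed
    ultimately show ?thesis using comm by simp
  qed
  define w' where "w' = g \<otimes> w \<otimes> inv g"
  have w'K: "w' \<in> parabolic K" unfolding w'_def
    using parabolic_mult[OF parabolic_mult[OF g(1) w(1)] parabolic_inv[OF K(1) g(1)]] .
  have w'W: "w' \<in> carrier W" using w'K K parabolic_carrier by blast
  have w'v: "act w' v' = v'" unfolding w'_def v'_def using gW wW wv by (simp add: act_mult)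
  \<comment> \<open>A negative image of a simple root of K would pair nonpositively with v', but w'
    fixes v' and therefore preserves the positive pairing.\<close>
  have "w' = \<one>"
  proof (rule parabolic_trivial[OF K(1) w'K])
    fix k assume k: "k \<in> K"
    then have kS: "k \<in> S" using K by auto
    let ?d = "- act w' (simple_root k)"
    show "act w' (simple_root k) \<in> pos_roots"
    proof (rule ccontr)
      assume "act w' (simple_root k) \<notin> pos_roots"
      then have d: "?d \<in> pos_roots" using root_neg_iff act_root w'W simple_root_in_roots kS by blast
      have dK: "ky ?d \<subseteq> K"
        unfolding keys_minus using ky_act_parabolic[OF K(1) w'K subset_refl] k by simp
      have "form v' ?d \<ge> 0" unfolding form_eq_sum_right[of v' ?d]
        using d dK pos by (intro sum_nonneg mult_nonneg_nonneg) (auto simp: pos_roots_def less_imp_le subset_iff)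
      moreover have "form v' (act w' (simple_root k)) = form v' (simple_root k)"
        using form_act[OF w'W v'S, of "simple_root k"] w'v kS by simp
      ultimately show False using pos[OF k] by (simp add: form_linear)
    qed
  qed
  then have "g \<otimes> w = g" using gW wW w'_def by (metis inv_equality inv_inv inv_closed m_closed)
  then have "g \<otimes> w = g \<otimes> \<one>" using gW by simp
  then show False using w(2) gW wW by (metis Units_eq Units_l_cancel one_closed)
qed

end

section \<open>The groupoids \<open>C\<close> and \<open>Y\<close>\<close>

locale labelled_coxeter_system = coxeter_system W S
  for W :: "('a, 'b) monoid_scheme" (structure) and S :: "'a set" +
  fixes \<Lambda> :: "'l set" and xI :: "'l \<Rightarrow> 'a"
  assumes xI: "xI \<in> injections \<Lambda>"
begin

abbreviation V :: "('l \<Rightarrow> 'a) set" where "V \<equiv> C_vertices \<Lambda> xI"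
abbreviation CH :: "('l \<Rightarrow> 'a) \<Rightarrow> ('l \<Rightarrow> 'a) \<Rightarrow> 'a set" where
  "CH \<equiv> C_hom \<Lambda>"
abbreviation YH :: "('l \<Rightarrow> 'a) \<Rightarrow> ('l \<Rightarrow> 'a) \<Rightarrow> 'a set" where
  "YH \<equiv> Y_hom \<Lambda>"

lemma V_injections: "x \<in> V \<Longrightarrow> x \<in> injections \<Lambda>"
  by (simp add: C_vertices_def)

lemma V_S: "x \<in> V \<Longrightarrow> l \<in> \<Lambda> \<Longrightarrow> x l \<in> S"
  using V_injections by (auto simp: injections_def)

lemma V_image: "x \<in> V \<Longrightarrow> x ` \<Lambda> \<subseteq> S"
  using V_S by blast

lemma V_inj: "x \<in> V \<Longrightarrow> inj_on x \<Lambda>"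
  using V_injections by (auto simp: injections_def)

lemma C_homD: "w \<in> CH x y \<Longrightarrow> w \<in> carrier W"
    "w \<in> CH x y \<Longrightarrow> l \<in> \<Lambda> \<Longrightarrow> act w (simple_root (y l)) = simple_root (x l)"
  by (auto simp: C_hom_def)

lemma C_hom_one: "\<one> \<in> CH x x"
  by (simp add: C_hom_def)

lemma C_hom_mult: "w \<in> CH x y \<Longrightarrow> u \<in> CH y z \<Longrightarrow> w \<otimes> u \<in> CH x z"
  by (auto simp: C_hom_def act_mult)

lemma C_hom_inv: "w \<in> CH x y \<Longrightarrow> inv w \<in> CH y x"
  by (auto simp: C_hom_def)

lemma C_hom_unique:
  assumes "y \<in> V" "y' \<in> V" "w \<in> CH y x" "w \<in> CH y' x" shows "y = y'"
proof (rule extensionalityI[of _ \<Lambda>])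
  show "y \<in> extensional \<Lambda>" "y' \<in> extensional \<Lambda>"
    using V_injections assms by (auto simp: injections_def PiE_def)
  fix l assume "l \<in> \<Lambda>"
  then show "y l = y' l" using assms C_homD(2) by (metis simple_root_inj)
qed

lemma C_hom_target_ex:
  assumes x: "x \<in> V" and w: "w \<in> carrier W"
    and simple: "\<And>l. l \<in> \<Lambda> \<Longrightarrow> \<exists>s\<in>S. act w (simple_root (x l)) = simple_root s"
  obtains y where "y \<in> V" "w \<in> CH y x"
proof -
  define y where "y = restrict (\<lambda>l. SOME s. s \<in> S \<and> act w (simple_root (x l)) = simple_root s) \<Lambda>"
  have y: "y l \<in> S" "act w (simple_root (x l)) = simple_root (y l)" if "l \<in> \<Lambda>" for l
    using someI_ex[of "\<lambda>s. s \<in> S \<and> act w (simple_root (x l)) = simple_root s"] simple[OF that] that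
    by (auto simp: y_def)
  have "inj_on y \<Lambda>"
  proof (rule inj_onI)
    fix l l' assume l: "l \<in> \<Lambda>" "l' \<in> \<Lambda>" "y l = y l'"
    then have "act w (simple_root (x l)) = act w (simple_root (x l'))" using y by simp
    then have "x l = x l'" using w by (metis act_inv_act simple_root_inj)
    then show "l = l'" using V_inj[OF x] l by (auto dest: inj_onD)
  qed
  moreover have "y \<in> \<Lambda> \<rightarrow>\<^sub>E S" using y(1) by (intro PiE_I) (auto simp: y_def)
  ultimately have yi: "y \<in> injections \<Lambda>" by (simp add: injections_def)
  have wy: "w \<in> CH y x" unfolding C_hom_def using w y(2) by simp
  obtain g where "g \<in> CH x xI" using x by (auto simp: C_vertices_def)
  then have "w \<otimes> g \<in> CH y xI" using C_hom_mult wy by blast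
  then have "y \<in> V" using yi by (auto simp: C_vertices_def)
  then show ?thesis using that wy by blast
qed

lemma C_hom_ky:
  assumes "w \<in> CH y x" "ky v \<subseteq> x ` \<Lambda>" shows "ky (act w v) \<subseteq> y ` \<Lambda>"
proof
  fix k assume k: "k \<in> ky (act w v)"
  show "k \<in> y ` \<Lambda>"
  proof (rule ccontr)
    assume n: "k \<notin> y ` \<Lambda>"
    have "lk (act w (simple_root j)) k = 0" if "j \<in> ky v" for j
    proof -
      from that obtain l where l: "l \<in> \<Lambda>" "j = x l" using assms(2) by blast
      then show ?thesis using C_homD(2)[OF assms(1) l(1)] n by (auto simp: lookup_simple_root)
    qed
    then have "lk (act w v) k = 0"
      unfolding act_expansion[OF C_homD(1)[OF assms(1)], of v] by (simp add: lookup_sum)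
    then show False using k by (simp add: in_keys_iff)
  qed
qed

lemma C_hom_ky_iff:
  assumes "w \<in> CH y x" shows "ky (act w v) \<subseteq> y ` \<Lambda> \<longleftrightarrow> ky v \<subseteq> x ` \<Lambda>"
  using C_hom_ky[OF assms] C_hom_ky[OF C_hom_inv[OF assms], of "act w v"] C_homD(1)[OF assms] by auto

lemma C_hom_pos:
  assumes "w \<in> CH y x" "y \<in> V" "\<gamma> \<in> pos_roots"
    "\<And>k. k \<in> ky \<gamma> \<Longrightarrow> k \<notin> x ` \<Lambda> \<Longrightarrow> act w (simple_root k) \<in> pos_roots"
  shows "act w \<gamma> \<in> pos_roots"
proof (rule act_pos_combination[OF C_homD(1)[OF assms(1)] assms(3)])
  fix k assume k: "k \<in> ky \<gamma>"
  show "act w (simple_root k) \<in> pos_roots"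
  proof (cases "k \<in> x ` \<Lambda>")
    case True
    then obtain l where l: "l \<in> \<Lambda>" "k = x l" by blast
    then show ?thesis using C_homD(2)[OF assms(1) l(1)] simple_root_pos V_S[OF assms(2)] by simp
  qed (use assms k in auto)
qed

lemma C_hom_descent_notin:
  assumes "w \<in> CH y x" "y \<in> V" "- act w (simple_root s) \<in> pos_roots" shows
    "s \<notin> x ` \<Lambda>"
proof
  assume "s \<in> x ` \<Lambda>"
  then obtain l where l: "l \<in> \<Lambda>" "s = x l" by blast
  then have "act w (simple_root s) \<in> pos_roots"
    using C_homD(2)[OF assms(1) l(1)] simple_root_pos V_S[OF assms(2)] by simp
  then show False using assms pos_not_neg by blast
qed

text \<open>\<open>w \<cdot> \<alpha>\<^sub>t\<close> has a coefficient outside \<open>[y]\<close>, which is negative and cannot be cancelled.\<close>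

lemma C_hom_inv_set:
  assumes w: "w \<in> CH y x" "y \<in> V" and T: "T \<subseteq> S"
    "\<And>t. t \<in> T \<Longrightarrow> - act w (simple_root t) \<in> pos_roots"
  shows "pos_on (x ` \<Lambda> \<union> T) - pos_on (x ` \<Lambda>) \<subseteq> inv_set w"
proof
  fix \<gamma> assume \<gamma>: "\<gamma> \<in> pos_on (x ` \<Lambda> \<union> T) - pos_on (x ` \<Lambda>)"
  have wW: "w \<in> carrier W" using w C_homD by blast
  obtain t where t: "t \<in> ky \<gamma>" "t \<notin> x ` \<Lambda>" "t \<in> T"
    using \<gamma> by (auto simp: pos_on_def)
  have "\<not> ky (act w (simple_root t)) \<subseteq> y ` \<Lambda>" using C_hom_ky_iff[OF w(1)] t by simp
  then obtain k0 where k0: "k0 \<notin> y ` \<Lambda>" "lk (act w (simple_root t)) k0 \<noteq> 0"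
    by (auto simp: in_keys_iff)
  have le: "lk (act w (simple_root k)) k0 \<le> 0" if "k \<in> ky \<gamma>" for k
  proof (cases "k \<in> x ` \<Lambda>")
    case True
    then obtain l where l: "l \<in> \<Lambda>" "k = x l" by blast
    then show ?thesis using C_homD(2)[OF w(1) l(1)] k0 by (auto simp: lookup_simple_root)
  next
    case False
    then have "k \<in> T" using \<gamma> that by (auto simp: pos_on_def)
    then show ?thesis using T(2)[of k] by (auto simp: pos_roots_def)
  qed
  have pos: "lk \<gamma> k > 0" if "k \<in> ky \<gamma>" for k
    using \<gamma> that by (auto simp: pos_on_def pos_roots_def in_keys_iff less_le)
  have "lk (act w \<gamma>) k0 = (\<Sum>k\<in>ky \<gamma>. lk \<gamma> k * lk (act w (simple_root k)) k0)"
    unfolding act_expansion[OF wW, of \<gamma>] by (simp add: lookup_sum)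
  also have "\<dots> < (\<Sum>k\<in>ky \<gamma>. 0)"
  proof (rule sum_strict_mono_ex1)
    show "\<forall>k\<in>ky \<gamma>. lk \<gamma> k * lk (act w (simple_root k)) k0 \<le> 0"
      using le pos by (simp add: mult_nonneg_nonpos less_imp_le)
    have "lk (act w (simple_root t)) k0 < 0" using le[OF t(1)] k0 by linarith
    then show "\<exists>k\<in>ky \<gamma>. lk \<gamma> k * lk (act w (simple_root k)) k0 < 0"
      using t(1) pos[OF t(1)] mult_pos_neg by blast
  qed simp
  finally have "lk (act w \<gamma>) k0 < 0" by simp
  moreover have "act w \<gamma> \<in> roots"
    using act_root[OF wW] \<gamma> by (auto simp: pos_on_def pos_root_iff)
  ultimately show "\<gamma> \<in> inv_set w"
    using root_neg_lookup \<gamma> by (auto simp: inv_set_def pos_on_def)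
qed

lemma act_simple_root_outside_sim:
  assumes "X \<union> T \<subseteq> S" "g \<in> parabolic (sim X T)" "k \<in> X" "k \<notin> sim X T"
  shows "act g (simple_root k) = simple_root k"
proof (rule act_parabolic_orthogonal[OF _ assms(2)])
  show "sim X T \<subseteq> S" using sim_subset assms by blast
  fix j assume "j \<in> sim X T"
  then show "form (simple_root j) (simple_root k) = 0"
    using gram_sim_outside[OF assms(1)] assms(3,4) by (simp add: form_simple_roots)
qed

text \<open>Simple roots of [x] inside the component go to simple roots because two longest elements
  reverse signs twice. Those outside it are orthogonal to the component and stay fixed.\<close>

lemma relative_w0_target_ex:
  assumes x: "x \<in> V" and T: "T \<subseteq> S" "T \<inter> x ` \<Lambda> = {}" and fin:
    "finite_type (sim (x ` \<Lambda>) T)"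
  obtains z where "z \<in> V" "relative_w0 (sim (x ` \<Lambda>) T) T \<in> CH z x"
proof -
  let ?K = "sim (x ` \<Lambda>) T"
  have K: "?K \<subseteq> S" using sim_subset V_image[OF x] T by blast
  show ?thesis
  proof (rule C_hom_target_ex[OF x relative_w0_carrier[OF K fin]])
    fix l assume l: "l \<in> \<Lambda>"
    show "\<exists>s\<in>S. act (relative_w0 ?K T) (simple_root (x l)) = simple_root s"
    proof (cases "x l \<in> ?K")
      case True
      then have "x l \<in> ?K - T" using T l by blast
      then show ?thesis using relative_w0_simple_root[OF K fin] K by (metis subsetD)
    next
      case False
      then show ?thesis
        using act_simple_root_outside_sim[OF _ relative_w0_parabolic[OF K fin]] l T V_image[OF x] by blast
    qed
  qed (use that in blast)
qed

lemma C_hom_descents: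
  assumes x: "x \<in> V" and y: "y \<in> V" and w: "w \<in> CH y x"
    and T: "T \<subseteq> S" "\<And>t. t \<in> T \<Longrightarrow> - act w (simple_root t) \<in> pos_roots"
  defines "u \<equiv> relative_w0 (sim (x ` \<Lambda>) T) T"
  shows "finite_type (sim (x ` \<Lambda>) T)" and "inv_set u \<subseteq> inv_set w"
    and "len w = len (w \<otimes> inv u) + len u"
proof -
  let ?X = "x ` \<Lambda>" and ?K = "sim (x ` \<Lambda>) T"
  have TX: "T \<inter> ?X = {}" using C_hom_descent_notin[OF w y] T(2) by blast
  have wW: "w \<in> carrier W" using w C_homD by blast
  have K: "?K \<subseteq> S" using sim_subset V_image[OF x] T by blast
  have sub: "pos_on ?K - pos_on (?K - T) \<subseteq> inv_set w"
  proof -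
    have "pos_on ?K - pos_on (?K - T) \<subseteq> pos_on (?X \<union> T) - pos_on ?X"
      using sim_subset[of ?X T] TX by (auto simp: pos_on_def)
    then show ?thesis using C_hom_inv_set[OF w y T] by blast
  qed
  then have "finite (pos_on ?K - pos_on (?K - T))" using finite_inv_set[OF wW] finite_subset by blast
  then show fin: "finite_type ?K" using finite_type_simI[OF V_image[OF x] T(1)] by blast
  show N: "inv_set u \<subseteq> inv_set w" using sub inv_set_relative_w0[OF K fin] u_def by simp
  show "len w = len (w \<otimes> inv u) + len u"
    using len_mult_inv_of_inv_set_subset[OF wW _ N] relative_w0_carrier[OF K fin] u_def by simp
qed

section \<open>Arcs of the graph \<open>\<C>\<close>\<close>

abbreviation arcsC :: "(('l \<Rightarrow> 'a) \<times> 'a) set" where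
  "arcsC \<equiv> arcs (C_graph \<Lambda> xI)"
abbreviation elt :: "('l \<Rightarrow> 'a) \<times> 'a \<Rightarrow> 'a" where
  "elt \<equiv> arc_elt \<Lambda>"
abbreviation target :: "('l \<Rightarrow> 'a) \<times> 'a \<Rightarrow> 'l \<Rightarrow> 'a" where
  "target \<equiv> arc_target \<Lambda> xI"
abbreviation oppo :: "('l \<Rightarrow> 'a) \<times> 'a \<Rightarrow> ('l \<Rightarrow> 'a) \<times> 'a" where
  "oppo \<equiv> arc_opp \<Lambda> xI"

lemma arcsC_iff:
  "(x, s) \<in> arcsC \<longleftrightarrow> x \<in> V \<and> s \<in> S - x ` \<Lambda> \<and> finite_type (sim (x ` \<Lambda>) {s})"
  by (simp add: C_graph_def)

lemma elt_eq: "elt (x, s) = relative_w0 (sim (x ` \<Lambda>) {s}) {s}"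
  by (simp add: arc_elt_def relative_w0_def)

lemma arc_facts:
  assumes "(x, s) \<in> arcsC"
  shows "x \<in> V" "s \<in> S" "s \<notin> x ` \<Lambda>" "finite_type (sim (x ` \<Lambda>) {s})"
    "sim (x ` \<Lambda>) {s} \<subseteq> S"
    "s \<in> sim (x ` \<Lambda>) {s}" "x ` \<Lambda> \<union> {s} \<subseteq> S"
  using assms sim_subset[of "x ` \<Lambda>" "{s}"] subset_sim[of "{s}" "x ` \<Lambda>"] V_image
  by (auto simp: arcsC_iff)

lemma target_V_elt:
  assumes "(x, s) \<in> arcsC" shows "target (x, s) \<in> V" "elt (x, s) \<in> CH (target (x, s)) x"
proof -
  note a = arc_facts[OF assms]
  obtain z where z: "z \<in> V" "elt (x, s) \<in> CH z x"
    using relative_w0_target_ex[OF a(1), of "{s}"] a elt_eq by auto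
  have "target (x, s) \<in> V \<and> elt (x, s) \<in> CH (target (x, s)) (fst (x, s))"
    unfolding arc_target_def
    by (rule theI[of _ z]) (use z C_hom_unique in auto)
  then show "target (x, s) \<in> V" "elt (x, s) \<in> CH (target (x, s)) x" by auto
qed

lemma target_eqI: "(x, s) \<in> arcsC \<Longrightarrow> y \<in> V \<Longrightarrow> elt (x, s) \<in> CH y x \<Longrightarrow> target (x, s) = y"
  using C_hom_unique target_V_elt by blast

lemma elt_carrier: "(x, s) \<in> arcsC \<Longrightarrow> elt (x, s) \<in> carrier W"
  using target_V_elt C_homD by blast

lemma inv_set_elt:
  "(x, s) \<in> arcsC \<Longrightarrow> inv_set (elt (x, s)) = pos_on (sim (x ` \<Lambda>) {s}) - pos_on (sim (x ` \<Lambda>) {s} - {s})"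
  unfolding elt_eq by (rule inv_set_relative_w0) (use arc_facts in blast)+

lemma elt_parabolic: "(x, s) \<in> arcsC \<Longrightarrow> elt (x, s) \<in> parabolic (sim (x ` \<Lambda>) {s})"
  unfolding elt_eq by (rule relative_w0_parabolic) (use arc_facts in blast)+

lemma simple_root_in_inv_set_elt: "(x, s) \<in> arcsC \<Longrightarrow> simple_root s \<in> inv_set (elt (x, s))"
  using arc_facts simple_root_pos by (simp add: inv_set_elt pos_on_def)

lemma elt_not_one: "(x, s) \<in> arcsC \<Longrightarrow> elt (x, s) \<noteq> \<one>"
  using simple_root_in_inv_set_elt by force

lemma len_elt_pos: "(x, s) \<in> arcsC \<Longrightarrow> len (elt (x, s)) > 0"
  using elt_not_one elt_carrier len_eq_0 by blast

lemma C_hom_descent_arc: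
  assumes "x \<in> V" "y \<in> V" "w \<in> CH y x" "s \<in> S" "- act w (simple_root s) \<in> pos_roots"
  shows "(x, s) \<in> arcsC" "inv_set (elt (x, s)) \<subseteq> inv_set w"
    "len w = len (w \<otimes> inv elt (x, s)) + len (elt (x, s))"
      "w \<otimes> inv elt (x, s) \<in> CH y (target (x, s))"
proof -
  note d = C_hom_descents[OF assms(1-3), of "{s}"]
  show a: "(x, s) \<in> arcsC"
    using d(1) assms C_hom_descent_notin[OF assms(3,2,5)] by (simp add: arcsC_iff)
  show "inv_set (elt (x, s)) \<subseteq> inv_set w" "len w = len (w \<otimes> inv elt (x, s)) + len (elt (x, s))"
    unfolding elt_eq using d(2,3) assms by auto
  show "w \<otimes> inv elt (x, s) \<in> CH y (target (x, s))"
    using C_hom_mult[OF assms(3) C_hom_inv[OF target_V_elt(2)[OF a]]] .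
qed

section \<open>Regions\<close>

text \<open>\<open>K\<close> is a union of finite type of components of \<open>J\<close> containing \<open>J\<close> minus \<open>[x]\<close>; this persists
  along the arcs inside \<open>J\<close>.\<close>

definition region :: "'a set \<Rightarrow> 'a set \<Rightarrow> ('l \<Rightarrow> 'a) \<Rightarrow> bool" where
  "region J K x \<longleftrightarrow> x \<in> V \<and> J \<subseteq> S \<and> x ` \<Lambda> \<subseteq> J \<and> K \<subseteq> J \<and> J - x ` \<Lambda> \<subseteq> K \<and> finite_type K \<and>
     (\<forall>j\<in>K. \<forall>k\<in>J - K. gram j k = 0)"

lemma region_sim:
  assumes "x \<in> V" "T \<subseteq> S" "finite_type (sim (x ` \<Lambda>) T)"
  shows "region (x ` \<Lambda> \<union> T) (sim (x ` \<Lambda>) T) x"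
proof -
  have "x ` \<Lambda> \<union> T \<subseteq> S" using assms V_image by blast
  then show ?thesis
    using assms sim_subset[of "x ` \<Lambda>" T] subset_sim[of T "x ` \<Lambda>"] gram_sim_outside[of
      "x ` \<Lambda>" T]
    unfolding region_def by (intro conjI ballI) auto
qed

context
  fixes J K :: "'a set" and x :: "'l \<Rightarrow> 'a"
  assumes R: "region J K x"
begin

lemma region_facts:
  "x \<in> V" "J \<subseteq> S" "x ` \<Lambda> \<subseteq> J" "K \<subseteq> J"
    "J - x ` \<Lambda> \<subseteq> K" "finite_type K" "K \<subseteq> S" "finite K"
proof -
  show *: "x \<in> V" "J \<subseteq> S" "x ` \<Lambda> \<subseteq> J" "K \<subseteq> J"
    "J - x ` \<Lambda> \<subseteq> K" "finite_type K"
    using R by (simp_all add: region_def)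
  show "K \<subseteq> S" using *(2,4) by (rule subset_trans[rotated])
  then show "finite K" using *(6) by (rule finite_type_finite)
qed

lemma region_gram: "j \<in> K \<Longrightarrow> k \<in> J \<Longrightarrow> k \<notin> K \<Longrightarrow> gram j k = 0"
  using R unfolding region_def by blast

lemma region_fixes:
  assumes "g \<in> parabolic K" "k \<in> J" "k \<notin> K" shows "act g (simple_root k) = simple_root k"
  by (rule act_parabolic_orthogonal[OF region_facts(7) assms(1)])
    (use region_gram assms in \<open>simp add: form_simple_roots\<close>)

lemma region_simple_image:
  assumes "g \<in> parabolic K" "g \<in> CH y x" "l \<in> \<Lambda>"
  shows "x l \<in> K \<Longrightarrow> y l \<in> K" "x l \<notin> K \<Longrightarrow> y l = x l"
proof -
  note a = C_homD(2)[OF assms(2,3)]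
  show "y l \<in> K" if "x l \<in> K"
    using ky_act_parabolic[OF region_facts(7) assms(1) subset_refl, of "simple_root (x l)"] a that by simp
  show "y l = x l" if "x l \<notin> K"
    using region_fixes[OF assms(1), of "x l"] a that assms(3) region_facts(3) simple_root_inj by auto
qed

text \<open>Labels in K stay in K and labels outside K are fixed, so the number of members of J
  missing from the vertex is constant. For one missing member this provides the opposite arc, for
  two it shows that each vertex has just two arcs inside J.\<close>

lemma region_move:
  assumes g: "g \<in> parabolic K" "g \<in> CH y x" and y: "y \<in> V"
  shows "region J K y" "card (J - y ` \<Lambda>) = card (J - x ` \<Lambda>)"
proof -
  note im = region_simple_image[OF g]
  have yJ: "y ` \<Lambda> \<subseteq> J"
  proof
    fix k assume "k \<in> y ` \<Lambda>"
    then obtain l where "l \<in> \<Lambda>" "k = y l" by blast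
    then show "k \<in> J" using im[of l] region_facts(3,4) by (cases "x l \<in> K") auto
  qed
  have JK: "J - y ` \<Lambda> \<subseteq> K"
  proof
    fix k assume k: "k \<in> J - y ` \<Lambda>"
    show "k \<in> K"
    proof (rule ccontr)
      assume n: "k \<notin> K"
      then obtain l where "l \<in> \<Lambda>" "k = x l" using k region_facts(5) by blast
      then show False using im(2)[of l] n k by (metis DiffD2 image_eqI)
    qed
  qed
  show "region J K y" using R y yJ JK unfolding region_def by blast
  let ?L = "{l \<in> \<Lambda>. x l \<in> K}"
  have im': "y l \<in> K \<longleftrightarrow> x l \<in> K" if "l \<in> \<Lambda>" for l
    using im[OF that] by metis
  have "K \<inter> y ` \<Lambda> = y ` ?L" using im' by blast
  moreover have "K \<inter> x ` \<Lambda> = x ` ?L" by blast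
  moreover have "card (y ` ?L) = card ?L"
    by (rule card_image, rule inj_on_subset[OF V_inj[OF y]]) blast
  moreover have "card (x ` ?L) = card ?L"
    by (rule card_image, rule inj_on_subset[OF V_inj[OF region_facts(1)]]) blast
  ultimately have c: "card (K \<inter> y ` \<Lambda>) = card (K \<inter> x ` \<Lambda>)" by simp
  have "J - y ` \<Lambda> = K - K \<inter> y ` \<Lambda>" "J - x ` \<Lambda> = K - K \<inter> x ` \<Lambda>"
    using JK region_facts(4,5) by blast+
  then show "card (J - y ` \<Lambda>) = card (J - x ` \<Lambda>)"
    using c region_facts(8) by (simp add: card_Diff_subset finite_subset)
qed

lemma region_sim_subset: "T \<subseteq> J \<Longrightarrow> T \<inter> x ` \<Lambda> = {} \<Longrightarrow> sim (x ` \<Lambda>) T \<subseteq> K"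
proof
  fix k assume T: "T \<subseteq> J" "T \<inter> x ` \<Lambda> = {}" and "k \<in> sim (x ` \<Lambda>) T"
  from this(3) show "k \<in> K"
  proof (induction rule: sim_induct)
    case (base t)
    then show ?case using T region_facts(5) by blast
  next
    case (step j k)
    then have "k \<in> J" using sim_subset[of "x ` \<Lambda>" T] T region_facts(3) by blast
    moreover have "gram j k \<noteq> 0"
      using step.hyps(3) coxeter_graph_gram[of j k] by (auto simp: coxeter_graph_def)
    ultimately show ?case using region_gram[of j k] step.IH by blast
  qed
qed

lemma region_arc:
  assumes "s \<in> J" "s \<notin> x ` \<Lambda>"
  shows "(x, s) \<in> arcsC" "elt (x, s) \<in> parabolic K" "region J K (target (x, s))"
proof -
  have sub: "sim (x ` \<Lambda>) {s} \<subseteq> K" using region_sim_subset assms by simp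
  then have "finite_type (sim (x ` \<Lambda>) {s})" using finite_type_subset region_facts by blast
  then show a: "(x, s) \<in> arcsC" using assms region_facts by (auto simp: arcsC_iff)
  show p: "elt (x, s) \<in> parabolic K" using elt_parabolic[OF a] parabolic_mono[OF sub] by blast
  show "region J K (target (x, s))"
    using region_move[OF p target_V_elt(2)[OF a] target_V_elt(1)[OF a]] by blast
qed

lemma region_descent:
  assumes "g \<in> parabolic K" "g \<in> CH y x" "y \<in> V" "s \<in> S"
    "- act g (simple_root s) \<in> pos_roots"
  shows "s \<in> J" "s \<notin> x ` \<Lambda>"
proof -
  show "s \<notin> x ` \<Lambda>" by (rule C_hom_descent_notin[OF assms(2,3,5)])
  have "simple_root s \<in> inv_set g" using assms simple_root_pos by (simp add: inv_set_def)
  then show "s \<in> J"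
    using inv_set_parabolic[OF region_facts(7) assms(1)] region_facts(4) by (auto simp: pos_on_def subset_iff)
qed

text \<open>The rest of J is orthogonal to K, so only the labels inside K have to be tested.\<close>

lemma region_perp_root:
  assumes "\<gamma> \<in> pos_on K" "\<And>j. j \<in> K \<inter> x ` \<Lambda> \<Longrightarrow> form \<gamma> (simple_root j) = 0"
  shows "\<gamma> \<in> perp_roots (x ` \<Lambda>)"
proof -
  have "form \<gamma> (simple_root k) = 0" if k: "k \<in> x ` \<Lambda>" for k
  proof (cases "k \<in> K")
    case False
    have kS: "k \<in> S" using k region_facts by blast
    have \<gamma>S: "ky \<gamma> \<subseteq> K" "ky \<gamma> \<subseteq> S"
      using assms(1) region_facts(7) by (auto simp: pos_on_def)
    have "form \<gamma> (simple_root k) = form (simple_root k) \<gamma>"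
      using \<gamma>S kS by (simp add: form_commute)
    also have "\<dots> = (\<Sum>j\<in>ky \<gamma>. lk \<gamma> j * form (simple_root k) (simple_root j))"
      by (rule form_eq_sum_right)
    also have "\<dots> = 0"
    proof (rule sum.neutral, rule ballI)
      fix j assume j: "j \<in> ky \<gamma>"
      then have "gram j k = 0" using region_gram[of j k] \<gamma>S k False region_facts(3) by blast
      then show "lk \<gamma> j * form (simple_root k) (simple_root j) = 0"
        using gram_commute[of k j] j \<gamma>S kS by (auto simp: form_simple_roots)
    qed
    finally show ?thesis .
  qed (use assms k in auto)
  then show ?thesis using assms(1) by (auto simp: perp_roots_def pos_on_def pos_root_iff)
qed

lemma region_trivial_stabilizer:
  assumes g: "g \<in> parabolic K" "g \<in> CH x x" and n: "pos_on K \<inter> perp_roots (x ` \<Lambda>) = {}"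
  shows "g = \<one>"
proof (rule ccontr)
  assume "g \<noteq> \<one>"
  moreover have "act g (simple_root j) = simple_root j" if "j \<in> K \<inter> x ` \<Lambda>" for j
    using C_homD(2)[OF g(2)] that by auto
  ultimately obtain \<gamma> where "\<gamma> \<in> pos_on K" "\<And>j. j \<in> K \<inter> x ` \<Lambda> \<Longrightarrow> form \<gamma> (simple_root j) = 0"
    using fixing_element_orthogonal_root[OF region_facts(7,6) _ g(1), of "K \<inter> x ` \<Lambda>"] by blast
  then show False using region_perp_root n by blast
qed

end

text \<open>A root orthogonal to all simple roots of its own support would have norm 0.\<close>

lemma perp_root_outside:
  assumes "\<gamma> \<in> pos_roots \<inter> perp_roots X" shows "\<not> ky \<gamma> \<subseteq> X"
  using root_not_orthogonal_to_support[of \<gamma>] assms by (auto simp: perp_roots_def)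

lemma arc_region: "(x, s) \<in> arcsC \<Longrightarrow> region (x ` \<Lambda> \<union> {s}) (sim (x ` \<Lambda>) {s}) x"
  using arc_facts by (intro region_sim) auto

section \<open>Opposite arcs\<close>

lemma sim_eq_of_mem:
  assumes "X \<union> {s} = Y \<union> {t}" "t \<in> sim X {s}" shows "sim X {s} = sim Y {t}"
proof -
  let ?R = "coxeter_graph \<inter> (X \<union> {s}) \<times> (X \<union> {s})"
  have "sym ?R" using coxeter_graph_sym by (auto simp: sym_def)
  then have "sym (?R\<^sup>*)" by (rule sym_rtrancl)
  moreover have st: "(s, t) \<in> ?R\<^sup>*" using assms(2) by (auto simp: sim_def)
  ultimately have "(t, s) \<in> ?R\<^sup>*" by (auto dest: symD)
  then have "?R\<^sup>* `` {s} = ?R\<^sup>* `` {t}" using st by (auto intro: rtrancl_trans)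
  then show ?thesis unfolding sim_def assms(1) .
qed

text \<open>The inverse of an arc is again an arc: both start at the same vertex, and both invert
  exactly the positive roots of the common component that involve t. The last three conclusions
  serve the comparison of lengths along an arc.\<close>

lemma arc_opp_facts:
  assumes a: "(x, s) \<in> arcsC"
  obtains t where "oppo (x, s) = (target (x, s), t)" "(target (x, s), t) \<in> arcsC"
    "elt (target (x, s), t) = inv elt (x, s)" "target (target (x, s), t) = x"
    "oppo (target (x, s), t) = (x, s)" "- act (inv elt (x, s)) (simple_root t) \<in> pos_on (sim (x ` \<Lambda>) {s})"
    "\<not> ky (act (inv elt (x, s)) (simple_root t)) \<subseteq> x ` \<Lambda>"
      "t \<in> x ` \<Lambda> \<union> {s}"
proof -
  define y where "y = target (x, s)"
  define u where "u = elt (x, s)"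
  define K where "K = sim (x ` \<Lambda>) {s}"
  define J where "J = x ` \<Lambda> \<union> {s}"
  note f = arc_facts[OF a]
  have R: "region J K x" using arc_region[OF a] J_def K_def by simp
  have u: "u \<in> parabolic K" "u \<in> CH y x" "y \<in> V" "u \<in> carrier W"
    using elt_parabolic[OF a] target_V_elt[OF a] elt_carrier[OF a] by (auto simp: u_def K_def y_def)
  have Ry: "region J K y" and "card (J - y ` \<Lambda>) = card (J - x ` \<Lambda>)"
    using region_move[OF R u(1-3)] by auto
  moreover have "J - x ` \<Lambda> = {s}" using f J_def by auto
  ultimately obtain t where t: "J - y ` \<Lambda> = {t}" by (auto simp: card_1_singleton_iff)
  note Rf = region_facts[OF R] and Ryf = region_facts[OF Ry]
  have tK: "t \<in> K" "t \<in> J" "t \<notin> y ` \<Lambda>" "t \<in> S" using t Ryf(2,5) by blast+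
  have op: "oppo (x, s) = (y, t)" using t by (simp add: arc_opp_def Let_def y_def J_def)
  have iu: "inv u \<in> parabolic K" "inv u \<in> CH x y" "inv u \<in> carrier W"
    using u parabolic_inv[OF Rf(7)] C_hom_inv by auto
  let ?d = "act (inv u) (simple_root t)"
  have dK: "ky ?d \<subseteq> K" using ky_act_parabolic[OF Rf(7) iu(1) subset_refl] tK by simp
  have dx: "\<not> ky ?d \<subseteq> x ` \<Lambda>" using C_hom_ky_iff[OF iu(2)] tK by simp
  have neg: "- ?d \<in> pos_roots"
  proof (rule ccontr)
    assume "- ?d \<notin> pos_roots"
    then have "?d \<in> pos_roots" using root_pos_or_neg act_root iu(3) simple_root_in_roots tK by blast
    moreover have "\<not> ky ?d \<subseteq> K - {s}" using dx Rf(4) J_def by blast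
    ultimately have "?d \<in> inv_set u" using dK inv_set_elt[OF a] by (simp add: u_def K_def pos_on_def)
    then have "- simple_root t \<in> pos_roots" using u by (simp add: inv_set_def)
    then show False using pos_not_neg simple_root_pos tK by blast
  qed
  note d = C_hom_descent_arc[OF u(3) f(1) iu(2) tK(4) neg]
  have KK: "sim (y ` \<Lambda>) {t} = K"
  proof -
    have "x ` \<Lambda> \<union> {s} = y ` \<Lambda> \<union> {t}" using t J_def Ryf(3) by blast
    then show ?thesis using sim_eq_of_mem[of "x ` \<Lambda>" s "y ` \<Lambda>" t] tK K_def by simp
  qed
  have "inv_set (inv u) \<subseteq> pos_on K - pos_on (K - {t})"
  proof
    fix g assume g: "g \<in> inv_set (inv u)"
    then have "g \<in> pos_on K" using inv_set_parabolic[OF Rf(7) iu(1)] by blast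
    moreover have "g \<notin> pos_on (K - {t})"
    proof
      assume "g \<in> pos_on (K - {t})"
      then have "ky g \<subseteq> K - {t}" by (simp add: pos_on_def)
      then have "ky g \<subseteq> y ` \<Lambda>" using t Ryf(4) by blast
      then have "act (inv u) g \<in> pos_roots"
        using C_hom_pos[OF iu(2) f(1), of g] g by (auto simp: inv_set_def)
      then show False using g pos_not_neg by (auto simp: inv_set_def)
    qed
    ultimately show "g \<in> pos_on K - pos_on (K - {t})" by blast
  qed
  then have "inv_set (inv u) = inv_set (elt (y, t))"
    using d(2) unfolding inv_set_elt[OF d(1)] KK by (rule subset_antisym)
  then have eq: "elt (y, t) = inv u"
    by (rule inv_set_inj[OF iu(3) elt_carrier[OF d(1)], symmetric])
  have tg: "target (y, t) = x" using target_eqI[OF d(1) f(1)] eq iu by simp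
  have "(y ` \<Lambda> \<union> {t}) - x ` \<Lambda> = {s}" using t J_def Ryf(3) f(3) by blast
  then have op2: "oppo (y, t) = (x, s)" by (simp add: arc_opp_def Let_def tg)
  show ?thesis
    by (rule that[of t])
      (use op d(1) eq tg op2 neg dK dx tK(2) in \<open>simp_all add: y_def u_def K_def J_def pos_on_def\<close>)
qed

lemma arc_oppo:
  assumes "e \<in> arcsC"
  shows "oppo e \<in> arcsC" "fst (oppo e) = target e" "target (oppo e) = fst e"
    "oppo (oppo e) = e" "elt (oppo e) = inv elt e"
proof -
  obtain x s where e: "e = (x, s)" by (cases e)
  obtain t where "oppo (x, s) = (target (x, s), t)" "(target (x, s), t) \<in> arcsC"
    "elt (target (x, s), t) = inv elt (x, s)" "target (target (x, s), t) = x"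
    "oppo (target (x, s), t) = (x, s)"
    using arc_opp_facts assms e by metis
  then show "oppo e \<in> arcsC" "fst (oppo e) = target e" "target (oppo e) = fst e"
    "oppo (oppo e) = e" "elt (oppo e) = inv elt e"
    by (simp_all add: e)
qed

text \<open>The analogue of \<open>len_mult_S\<close> for arcs. If s is not a descent of the
  product, then the negative of the root that the inverse arc assigns to t is a combination of s and
  [x], so it stays positive; hence t is a descent of w and the opposite arc divides w.\<close>

lemma C_hom_arc_length:
  assumes a: "(x, s) \<in> arcsC" and z: "z \<in> V" and w: "w \<in> CH z (target (x, s))"
  shows "- act (w \<otimes> elt (x, s)) (simple_root s) \<in> pos_roots \<Longrightarrow> len (w \<otimes> elt (x, s)) = len w + len (elt (x, s))"
    and "- act (w \<otimes> elt (x, s)) (simple_root s) \<notin> pos_roots \<Longrightarrow> len w = len (w \<otimes> elt (x, s)) + len (elt (x, s))"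
proof -
  let ?u = "elt (x, s)"
  note f = arc_facts[OF a] and T = target_V_elt[OF a]
  have wW: "w \<in> carrier W" "?u \<in> carrier W" using w T C_homD by blast+
  have v: "w \<otimes> ?u \<in> CH z x" using C_hom_mult w T by blast
  have vu: "w \<otimes> ?u \<otimes> inv ?u = w" using wW by (simp add: m_assoc)
  show "len (w \<otimes> ?u) = len w + len ?u" if "- act (w \<otimes> ?u) (simple_root s) \<in> pos_roots"
    using C_hom_descent_arc(3)[OF f(1) z v f(2) that] vu by simp
  assume n: "- act (w \<otimes> ?u) (simple_root s) \<notin> pos_roots"
  then have p: "act (w \<otimes> ?u) (simple_root s) \<in> pos_roots"
    using root_pos_or_neg act_root wW simple_root_in_roots f(2) by blast
  obtain t where t: "(target (x, s), t) \<in> arcsC" "elt (target (x, s), t) = inv ?u"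
    "- act (inv ?u) (simple_root t) \<in> pos_on (sim (x ` \<Lambda>) {s})"
    using arc_opp_facts[OF a] by metis
  let ?d = "- act (inv ?u) (simple_root t)"
  have "act (w \<otimes> ?u) ?d \<in> pos_roots"
  proof (rule C_hom_pos[OF v z])
    show "?d \<in> pos_roots" using t by (simp add: pos_on_def)
    fix k assume "k \<in> ky ?d" "k \<notin> x ` \<Lambda>"
    then have "k = s" using t(3) sim_subset[of "x ` \<Lambda>" "{s}"] by (auto simp: pos_on_def)
    then show "act (w \<otimes> ?u) (simple_root k) \<in> pos_roots" using p by simp
  qed
  moreover have "act (w \<otimes> ?u) ?d = - act w (simple_root t)"
    using wW by (simp add: act_mult act_uminus)
  ultimately have "- act w (simple_root t) \<in> pos_roots" by simp
  then have "len w = len (w \<otimes> inv elt (target (x, s), t)) + len (elt (target (x, s), t))"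
    using C_hom_descent_arc(3)[OF T(1) z w arc_facts(2)[OF t(1)]] by blast
  then show "len w = len (w \<otimes> ?u) + len ?u" using t wW len_inv by simp
qed

section \<open>Loops\<close>

text \<open>A loop is a nontrivial element fixing the simple roots of [x], so its component contains
  an orthogonal root. That root is not supported in [x], so it involves s and is inverted.\<close>

lemma loop_perp_root:
  assumes a: "(x, s) \<in> arcsC" and loop: "target (x, s) = x"
  obtains \<gamma> where "\<gamma> \<in> perp_roots (x ` \<Lambda>)" "\<gamma> \<in> inv_set (elt (x, s))"
proof -
  have "pos_on (sim (x ` \<Lambda>) {s}) \<inter> perp_roots (x ` \<Lambda>) \<noteq> {}"
    using region_trivial_stabilizer[OF arc_region[OF a] elt_parabolic[OF a]] target_V_elt(2)[OF a] loop
      elt_not_one[OF a] by auto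
  then obtain \<gamma> where g: "\<gamma> \<in> pos_on (sim (x ` \<Lambda>) {s})"
    "\<gamma> \<in> perp_roots (x ` \<Lambda>)" by blast
  then have "\<not> ky \<gamma> \<subseteq> x ` \<Lambda>"
    by (intro perp_root_outside) (auto simp: pos_on_def)
  then have "\<not> ky \<gamma> \<subseteq> sim (x ` \<Lambda>) {s} - {s}"
    using sim_subset[of "x ` \<Lambda>" "{s}"] by blast
  then have "\<gamma> \<in> inv_set (elt (x, s))" using g inv_set_elt[OF a] by (simp add: pos_on_def)
  then show ?thesis using that g by blast
qed

text \<open>An inverted root orthogonal to \<open>[x]\<close> yields a reflection with the same inversions as the arc.\<close>

lemma perp_root_loop:
  assumes a: "(x, s) \<in> arcsC" and \<gamma>: "\<gamma> \<in> perp_roots (x ` \<Lambda>)"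
    "\<gamma> \<in> inv_set (elt (x, s))"
  shows "target (x, s) = x"
proof -
  define K where "K = sim (x ` \<Lambda>) {s}"
  note f = arc_facts[OF a] and N = inv_set_elt[OF a]
  have KX: "K - {s} \<subseteq> x ` \<Lambda>" "K \<subseteq> x ` \<Lambda> \<union> {s}"
    using sim_subset[of "x ` \<Lambda>" "{s}"] K_def by auto
  have gK: "\<gamma> \<in> pos_roots" "ky \<gamma> \<subseteq> K"
    using \<gamma>(2) N by (auto simp: pos_on_def K_def)
  obtain r where r: "r \<in> carrier W" "\<And>v. ky v \<subseteq> S \<Longrightarrow> act r v = v - scl (2 * form \<gamma> v) \<gamma>"
    using root_reflection_ex[of \<gamma>] gK by (auto simp: pos_root_iff)
  have fixed: "act r (simple_root k) = simple_root k" if "k \<in> x ` \<Lambda>" for k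
    using r(2)[of "simple_root k"] \<gamma>(1) that V_image[OF f(1)] by (auto simp: perp_roots_def)
  then have rC: "r \<in> CH x x" using r(1) by (auto simp: C_hom_def)
  have "ky \<gamma> \<subseteq> S" using root_ky gK pos_root_root by blast
  then have rg: "act r \<gamma> = - \<gamma>" using r(2)[of \<gamma>] root_unit[of \<gamma>] gK
    by (auto intro!: poly_mapping_eqI simp: lookup_minus pos_root_iff)
  \<comment> \<open>Otherwise r would keep the simple roots of [x] and of s positive, and with them
    their combination \<gamma>, which it negates.\<close>
  have neg: "- act r (simple_root s) \<in> pos_roots"
  proof (rule ccontr)
    assume "- act r (simple_root s) \<notin> pos_roots"
    then have p: "act r (simple_root s) \<in> pos_roots"
      using root_pos_or_neg act_root r(1) simple_root_in_roots f(2) by blast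
    have "act r \<gamma> \<in> pos_roots"
      by (rule C_hom_pos[OF rC f(1) gK(1)]) (use p gK KX in auto)
    then show False using rg gK pos_not_neg by simp
  qed
  have "inv_set r = pos_on K - pos_on (K - {s})"
  proof
    have "pos_on K - pos_on (K - {s}) \<subseteq> pos_on (x ` \<Lambda> \<union> {s}) - pos_on (x ` \<Lambda>)"
      using KX f(3) by (auto simp: pos_on_def)
    then show "pos_on K - pos_on (K - {s}) \<subseteq> inv_set r"
      using C_hom_inv_set[OF rC f(1), of "{s}"] neg f(2) by auto
  next
    show "inv_set r \<subseteq> pos_on K - pos_on (K - {s})"
    proof
      fix d assume d: "d \<in> inv_set r"
      then have dp: "d \<in> pos_roots" "act r d \<notin> pos_roots" using inv_set_iff r(1) by blast+
      have dS: "ky d \<subseteq> S" using root_ky dp pos_root_root by blast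
      \<comment> \<open>The reflection in \<gamma> changes no coefficient outside K, and a positive
        one there would prevent the inversion.\<close>
      have "ky d \<subseteq> K"
      proof (rule ccontr)
        assume "\<not> ky d \<subseteq> K"
        then obtain k where k: "k \<notin> K" "lk d k \<noteq> 0" by (auto simp: in_keys_iff)
        then have "lk \<gamma> k = 0" using gK by (auto simp: in_keys_iff)
        then have "lk (act r d) k > 0"
          using k dp r(2)[OF dS] by (auto simp: lookup_minus pos_roots_def less_le)
        then show False using root_pos_lookup act_root r(1) dp pos_root_root by blast
      qed
      moreover have "\<not> ky d \<subseteq> K - {s}"
        using C_hom_pos[OF rC f(1) dp(1)] dp(2) KX by blast
      ultimately show "d \<in> pos_on K - pos_on (K - {s})" using dp by (auto simp: pos_on_def)
    qed
  qed
  then have "r = elt (x, s)" using inv_set_inj r(1) elt_carrier[OF a] N K_def by simp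
  then show ?thesis using target_eqI[OF a f(1)] rC by simp
qed

section \<open>The subgroupoid Y\<close>

lemma act_perp_roots:
  assumes "w \<in> CH y x" "x \<in> V" "\<gamma> \<in> perp_roots (x ` \<Lambda>)" shows
    "act w \<gamma> \<in> perp_roots (y ` \<Lambda>)"
proof -
  have g: "\<gamma> \<in> roots" using assms(3) by (simp add: perp_roots_def)
  have "form (act w \<gamma>) (simple_root (y l)) = 0" if l: "l \<in> \<Lambda>" for l
  proof -
    have "form (act w \<gamma>) (simple_root (y l)) = form (act w \<gamma>) (act w (simple_root (x l)))"
      using C_homD(2)[OF assms(1) l] by simp
    also have "\<dots> = form \<gamma> (simple_root (x l))"
      using form_act[OF C_homD(1)[OF assms(1)] root_ky[OF g]] V_S[OF assms(2) l] by simp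
    finally show ?thesis using assms(3) l by (simp add: perp_roots_def)
  qed
  then show ?thesis using act_root C_homD(1)[OF assms(1)] g by (auto simp: perp_roots_def)
qed

lemma Y_hom_iff:
  "w \<in> YH y x \<longleftrightarrow> w \<in> CH y x \<and> (\<forall>\<gamma>\<in>perp_roots (x ` \<Lambda>) \<inter> pos_roots. act w \<gamma> \<in> pos_roots)"
  by (auto simp: Y_hom_def)

text \<open>In this form the condition visibly passes to right divisors with a smaller inversion
  set.\<close>

lemma Y_hom_iff_inv_set:
  "w \<in> YH y x \<longleftrightarrow> w \<in> CH y x \<and> inv_set w \<inter> perp_roots (x ` \<Lambda>) = {}"
proof (cases "w \<in> CH y x")
  case True
  then show ?thesis using inv_set_iff[OF C_homD(1)[OF True]] by (auto simp: Y_hom_iff)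
qed (simp add: Y_hom_iff)

lemma Y_hom_one: "\<one> \<in> YH x x"
  by (simp add: Y_hom_iff C_hom_one)

lemma Y_hom_mult:
  assumes "x \<in> V" "w \<in> YH z y" "u \<in> YH y x" shows "w \<otimes> u \<in> YH z x"
proof -
  have c: "w \<in> CH z y" "u \<in> CH y x" using assms by (simp_all add: Y_hom_iff)
  have "act (w \<otimes> u) g \<in> pos_roots"
    if "g \<in> perp_roots (x ` \<Lambda>) \<inter> pos_roots" for g
  proof -
    have "act u g \<in> perp_roots (y ` \<Lambda>) \<inter> pos_roots"
      using act_perp_roots[OF c(2) assms(1)] assms(3) that by (simp add: Y_hom_iff)
    then have "act w (act u g) \<in> pos_roots" using assms(2) by (simp add: Y_hom_iff)
    then show ?thesis using act_mult[OF C_homD(1)[OF c(1)] C_homD(1)[OF c(2)]] by simp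
  qed
  then show ?thesis using C_hom_mult[OF c] by (simp add: Y_hom_iff)
qed

text \<open>An element of C maps orthogonal roots to orthogonal roots in both directions, so a
  negative preimage of a positive root would yield, after a change of sign, a positive orthogonal
  root made negative by w.\<close>

lemma Y_hom_inv: assumes "x \<in> V" "y \<in> V" "w \<in> YH y x" shows "inv w \<in> YH x y"
  unfolding Y_hom_iff
proof (intro conjI ballI)
  have w: "w \<in> CH y x" using assms by (simp add: Y_hom_iff)
  then show iw: "inv w \<in> CH x y" by (rule C_hom_inv)
  fix g assume g: "g \<in> perp_roots (y ` \<Lambda>) \<inter> pos_roots"
  let ?d = "act (inv w) g"
  have d: "?d \<in> perp_roots (x ` \<Lambda>)" using act_perp_roots[OF iw assms(2)] g by blast
  then have md: "- ?d \<in> perp_roots (x ` \<Lambda>)" by (auto simp: perp_roots_def uminus_root form_linear)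
  show "?d \<in> pos_roots"
  proof (rule ccontr)
    assume "?d \<notin> pos_roots"
    then have "- ?d \<in> pos_roots" using d root_neg_iff by (auto simp: perp_roots_def)
    then have "act w (- ?d) \<in> pos_roots" using md assms(3) by (auto simp: Y_hom_iff)
    then have "- g \<in> pos_roots" using C_homD(1)[OF w] by (simp add: act_uminus)
    then show False using g pos_not_neg by blast
  qed
qed

lemma elt_Y_hom_iff:
  assumes a: "(x, s) \<in> arcsC" shows "elt (x, s) \<in> YH (target (x, s)) x \<longleftrightarrow> target (x, s) \<noteq> x"
proof
  assume "elt (x, s) \<in> YH (target (x, s)) x"
  then have "inv_set (elt (x, s)) \<inter> perp_roots (x ` \<Lambda>) = {}" by (simp add: Y_hom_iff_inv_set)
  then show "target (x, s) \<noteq> x" using loop_perp_root[OF a] by (metis disjoint_iff)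
next
  assume "target (x, s) \<noteq> x"
  then have "inv_set (elt (x, s)) \<inter> perp_roots (x ` \<Lambda>) = {}"
    using perp_root_loop[OF a] by blast
  then show "elt (x, s) \<in> YH (target (x, s)) x"
    using target_V_elt(2)[OF a] by (simp add: Y_hom_iff_inv_set)
qed

text \<open>The arc inverts only roots that w inverts, hence no orthogonal one, and so it is not a
  loop.\<close>

lemma Y_hom_descent:
  assumes "x \<in> V" "y \<in> V" "w \<in> YH y x" "s \<in> S" "- act w (simple_root s) \<in> pos_roots"
  shows "target (x, s) \<noteq> x" "elt (x, s) \<in> YH (target (x, s)) x"
    "w \<otimes> inv elt (x, s) \<in> YH y (target (x, s))"
proof -
  have w: "w \<in> CH y x" using assms by (simp add: Y_hom_iff)
  note d = C_hom_descent_arc[OF assms(1,2) w assms(4,5)]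
  show e: "elt (x, s) \<in> YH (target (x, s)) x"
    using assms(3) d target_V_elt(2) by (auto simp: Y_hom_iff_inv_set)
  then show "target (x, s) \<noteq> x" using elt_Y_hom_iff d by blast
  show "w \<otimes> inv elt (x, s) \<in> YH y (target (x, s))"
    using Y_hom_mult[OF _ assms(3) Y_hom_inv[OF _ _ e]] target_V_elt(1)[OF d(1)] assms by blast
qed

end

section \<open>The fundamental groupoid of a complex\<close>

locale edge_complex = wf_digraph "skel X" for X :: "('v, 'e) two_complex" +
  assumes opp_arc: "e \<in> arcs (skel X) \<Longrightarrow> opp X e \<in> arcs (skel X)"
    and tail_opp: "e \<in> arcs (skel X) \<Longrightarrow> tail (skel X) (opp X e) = head (skel X) e"
    and head_opp: "e \<in> arcs (skel X) \<Longrightarrow> head (skel X) (opp X e) = tail (skel X) e"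
    and opp_opp: "e \<in> arcs (skel X) \<Longrightarrow> opp X (opp X e) = e"
begin

abbreviation "hclass \<equiv> homotopy_class X"
abbreviation "FG \<equiv> fundamental_groupoid X"

declare awalk_append_iff [simp del] awalkE [rule del] awalkE' [rule del]

lemma awalk_appendE:
  assumes "awalk u (p @ q) v" obtains z where "awalk u p z" "awalk z q v"
  using assms that by (auto simp: awalk_append_iff)

lemma homotopic_refl: "(w, w) \<in> homotopic X"
  by (simp add: homotopic_def)

lemma homotopic_trans: "(a, b) \<in> homotopic X \<Longrightarrow> (b, c) \<in> homotopic X \<Longrightarrow> (a, c) \<in> homotopic X"
  unfolding homotopic_def by (rule rtrancl_trans)

lemma homotopic_sym: "(a, b) \<in> homotopic X \<Longrightarrow> (b, a) \<in> homotopic X"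
proof -
  have "sym (homotopic X)" unfolding homotopic_def by (rule sym_rtrancl) (auto simp: sym_def)
  then show "(a, b) \<in> homotopic X \<Longrightarrow> (b, a) \<in> homotopic X" by (auto dest: symD)
qed

lemma homotopy_step_homotopic: "(a, b) \<in> homotopy_step X \<Longrightarrow> (a, b) \<in> homotopic X"
  unfolding homotopic_def by blast

lemma homotopy_stepE:
  assumes "(w, w') \<in> homotopy_step X"
  obtains u v a b c where "w = (u, a @ b @ c, v)" "w' = (u, a @ c, v)"
    "awalk u (a @ b @ c) v" "awalk u (a @ c) v"
    "(\<exists>e. b = [e, opp X e]) \<or> (\<exists>D\<in>cells X. traverses (skel X) (opp X) b D)"
  using assms unfolding homotopy_step_def by blast

text \<open>A homotopy keeps the end points, so only the list of arcs varies. Steps are offered in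
  both directions to cover the symmetric closure.\<close>

lemma homotopic_induct [consumes 1, case_names refl step]:
  assumes "((u, p, v), w) \<in> homotopic X" and "P p"
    and "\<And>q q'. awalk u q v \<Longrightarrow> awalk u q' v \<Longrightarrow>
      ((u, q, v), (u, q', v)) \<in> homotopy_step X \<or> ((u, q', v), (u, q, v)) \<in> homotopy_step X \<Longrightarrow> P q \<Longrightarrow> P q'"
  shows "\<exists>q. w = (u, q, v) \<and> P q"
  using assms(1) unfolding homotopic_def
proof (induction rule: rtrancl_induct)
  case base
  then show ?case using assms(2) by blast
next
  case (step y z)
  then obtain q where q: "y = (u, q, v)" "P q" by blast
  from step.hyps(2) consider "(y, z) \<in> homotopy_step X" | "(z, y) \<in> homotopy_step X" by blast
  then show ?case
  proof cases
    case 1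
    then show ?thesis
    proof (rule homotopy_stepE)
      fix u1 v1 a b c
      assume *: "y = (u1, a @ b @ c, v1)" "z = (u1, a @ c, v1)" "awalk u1 (a @ b @ c) v1"
        "awalk u1 (a @ c) v1"
      then have "z = (u, a @ c, v)" "q = a @ b @ c" "awalk u q v" "awalk u (a @ c) v" using q by auto
      then show ?thesis using assms(3)[of q "a @ c"] 1 q by blast
    qed
  next
    case 2
    then show ?thesis
    proof (rule homotopy_stepE)
      fix u1 v1 a b c
      assume *: "z = (u1, a @ b @ c, v1)" "y = (u1, a @ c, v1)" "awalk u1 (a @ b @ c) v1"
        "awalk u1 (a @ c) v1"
      then have "z = (u, a @ b @ c, v)" "q = a @ c" "awalk u q v" "awalk u (a @ b @ c) v" using q by auto
      then show ?thesis using assms(3)[of q "a @ b @ c"] 2 q by blast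
    qed
  qed
qed

lemma homotopic_awalk:
  assumes "((u, p, v), w) \<in> homotopic X" "awalk u p v"
  obtains q where "w = (u, q, v)" "awalk u q v"
  using homotopic_induct[OF assms(1), of "\<lambda>q. awalk u q v"] assms(2) by blast

lemma homotopy_step_context:
  assumes "((u, q, v), (u, q', v)) \<in> homotopy_step X" "awalk t a u" "awalk v c z"
  shows "((t, a @ q @ c, z), (t, a @ q' @ c, z)) \<in> homotopy_step X"
  using assms(1)
proof (rule homotopy_stepE)
  fix u1 v1 a1 b c1
  assume *: "(u, q, v) = (u1, a1 @ b @ c1, v1)" "(u, q', v) = (u1, a1 @ c1, v1)"
    "awalk u1 (a1 @ b @ c1) v1" "awalk u1 (a1 @ c1) v1"
    "(\<exists>e. b = [e, opp X e]) \<or> (\<exists>D\<in>cells X. traverses (skel X) (opp X) b D)"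
  then have "awalk u q v" "awalk u q' v" by auto
  then have "awalk t (a @ q @ c) z" "awalk t (a @ q' @ c) z"
    using awalk_appendI[OF assms(2) awalk_appendI[OF _ assms(3)]] by blast+
  then have "awalk t ((a @ a1) @ b @ (c1 @ c)) z" "awalk t ((a @ a1) @ (c1 @ c)) z" using * by auto
  then have "((t, (a @ a1) @ b @ (c1 @ c), z), (t, (a @ a1) @ (c1 @ c), z)) \<in> homotopy_step X"
    using *(5) unfolding homotopy_step_def by blast
  then show ?thesis using * by simp
qed

lemma homotopic_context:
  assumes "((u, p, v), (u, p', v)) \<in> homotopic X" "awalk t a u" "awalk v c z"
  shows "((t, a @ p @ c, z), (t, a @ p' @ c, z)) \<in> homotopic X"
proof -
  have "\<exists>q. (u, p', v) = (u, q, v) \<and> ((t, a @ p @ c, z), (t, a @ q @ c, z)) \<in> homotopic X"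
    using assms(1)
  proof (rule homotopic_induct[of u p v "(u, p', v)" "\<lambda>q. ((t, a @ p @ c, z), (t, a @ q @ c, z)) \<in> homotopic X"])
    show "((t, a @ p @ c, z), t, a @ p @ c, z) \<in> homotopic X" by (rule homotopic_refl)
    fix q q'
    assume "((u, q, v), u, q', v) \<in> homotopy_step X \<or> ((u, q', v), u, q, v) \<in> homotopy_step X"
    then have "((t, a @ q @ c, z), (t, a @ q' @ c, z)) \<in> homotopic X"
      using homotopy_step_context[OF _ assms(2,3)] homotopy_step_homotopic homotopic_sym by blast
    moreover assume "((t, a @ p @ c, z), t, a @ q @ c, z) \<in> homotopic X"
    ultimately show "((t, a @ p @ c, z), t, a @ q' @ c, z) \<in> homotopic X" using homotopic_trans by blast
  qed
  then show ?thesis by simp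
qed

lemma homotopic_append:
  assumes "((u, p, v), (u, p', v)) \<in> homotopic X" "((v, q, w), (v, q', w)) \<in> homotopic X"
    "awalk u p v" "awalk v q w"
  shows "((u, p @ q, w), (u, p' @ q', w)) \<in> homotopic X"
proof -
  obtain p1 where "awalk u p' v" using homotopic_awalk[OF assms(1,3)] by auto
  then have "((u, p' @ q, w), (u, p' @ q', w)) \<in> homotopic X"
    using homotopic_context[OF assms(2), of u p' "[]" w] awalk_last_in_verts[OF assms(4)]
    by (auto simp: awalk_Nil_iff)
  moreover have "((u, p @ q, w), (u, p' @ q, w)) \<in> homotopic X"
    using homotopic_context[OF assms(1), of u "[]" q w] assms(4) awalk_hd_in_verts[OF assms(3)]
    by (auto simp: awalk_Nil_iff)
  ultimately show ?thesis using homotopic_trans by blast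
qed

definition rev_walk :: "'e list \<Rightarrow> 'e list" where
  "rev_walk p = rev (map (opp X) p)"

lemma rev_walk_simps [simp]: "rev_walk [] = []" "rev_walk (e # p) = rev_walk p @ [opp X e]"
  by (simp_all add: rev_walk_def)

lemma set_rev_walk: "set (rev_walk p) = opp X ` set p"
  by (simp add: rev_walk_def)

lemma awalk_rev_walk: "awalk u p v \<Longrightarrow> awalk v (rev_walk p) u"
proof (induction p arbitrary: u)
  case (Cons e p)
  then have e: "e \<in> arcs (skel X)" "u = tail (skel X) e" "awalk v (rev_walk p) (head (skel X) e)"
    by (auto simp: awalk_Cons_iff)
  have "awalk (head (skel X) e) [opp X e] u"
    using e opp_arc tail_opp head_opp by (auto simp: awalk_Cons_iff awalk_Nil_iff)
  then show ?case using awalk_appendI[OF e(3)] by simp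
qed (auto simp: awalk_Nil_iff)

lemma homotopic_backtrack:
  assumes "awalk u (a @ [e, opp X e] @ c) v"
  shows "((u, a @ [e, opp X e] @ c, v), (u, a @ c, v)) \<in> homotopic X"
proof -
  obtain z z' where z: "awalk u a z" "awalk z [e, opp X e] z'" "awalk z' c v"
    using assms by (metis awalk_appendE)
  then have "z' = z" using head_opp by (auto simp: awalk_Cons_iff awalk_Nil_iff)
  then have "awalk u (a @ c) v" using awalk_appendI z by blast
  then show ?thesis using assms
    by (intro homotopy_step_homotopic) (unfold homotopy_step_def, blast)
qed

lemma homotopic_rev_walk_right: "awalk u p v \<Longrightarrow> ((u, p @ rev_walk p, u), (u, [], u)) \<in> homotopic X"
proof (induction p arbitrary: u)
  case (Cons e p)
  let ?z = "head (skel X) e"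
  have e: "e \<in> arcs (skel X)" "u = tail (skel X) e" "awalk ?z p v"
    using Cons.prems by (auto simp: awalk_Cons_iff)
  have we: "awalk u [e] ?z" "awalk ?z [opp X e] u"
    using e opp_arc tail_opp head_opp by (auto simp: awalk_Cons_iff awalk_Nil_iff)
  have "((u, [e] @ (p @ rev_walk p) @ [opp X e], u), (u, [e] @ [] @ [opp X e], u)) \<in> homotopic X"
    by (rule homotopic_context[OF Cons.IH[OF e(3)] we])
  moreover have "((u, [] @ [e, opp X e] @ [], u), (u, [] @ [], u)) \<in> homotopic X"
    using awalk_appendI[OF we] by (intro homotopic_backtrack) simp
  ultimately show ?case using homotopic_trans by fastforce
qed (simp add: homotopic_refl)

lemma rev_walk_rev_walk: "set p \<subseteq> arcs (skel X) \<Longrightarrow> rev_walk (rev_walk p) = p"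
  by (induction p) (auto simp: rev_walk_def opp_opp)

lemma awalk_arcs: "awalk u p v \<Longrightarrow> set p \<subseteq> arcs (skel X)"
  by (auto simp: awalk_def)

lemma homotopic_rev_walk_left: "awalk u p v \<Longrightarrow> ((v, rev_walk p @ p, v), (v, [], v)) \<in> homotopic X"
  using homotopic_rev_walk_right[OF awalk_rev_walk, of u p v] rev_walk_rev_walk[OF awalk_arcs, of u p v]
    by simp

text \<open>The walk p followed by q backwards and q forwards contracts to p in one way and to q in
  the other.\<close>

lemma homotopic_if_loop_trivial:
  assumes "awalk u p v" "awalk u q v" "((u, p @ rev_walk q, u), (u, [], u)) \<in> homotopic X"
  shows "((u, p, v), (u, q, v)) \<in> homotopic X"
proof -
  have vv: "awalk v [] v" "awalk u [] u"
    using assms awalk_last_in_verts awalk_hd_in_verts by (auto simp: awalk_Nil_iff)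
  have "((u, p @ (rev_walk q @ q) @ [], v), (u, p @ [] @ [], v)) \<in> homotopic X"
    by (rule homotopic_context[OF homotopic_rev_walk_left[OF assms(2)] assms(1) vv(1)])
  then have A: "((u, p @ rev_walk q @ q, v), (u, p, v)) \<in> homotopic X" by simp
  have "((u, [] @ (p @ rev_walk q) @ q, v), (u, [] @ [] @ q, v)) \<in> homotopic X"
    by (rule homotopic_context[OF assms(3) vv(2) assms(2)])
  then have "((u, p @ rev_walk q @ q, v), (u, q, v)) \<in> homotopic X" by simp
  then show ?thesis by (rule homotopic_trans[OF homotopic_sym[OF A]])
qed

lemma hclass_eq_iff: "hclass a = hclass b \<longleftrightarrow> (a, b) \<in> homotopic X"
proof
  assume "hclass a = hclass b"
  then show "(a, b) \<in> homotopic X" using homotopic_refl[of b] unfolding homotopy_class_def by blast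
next
  assume ab: "(a, b) \<in> homotopic X"
  show "hclass a = hclass b" unfolding homotopy_class_def
    using homotopic_trans[OF ab] homotopic_trans[OF homotopic_sym[OF ab]] by blast
qed

lemma mem_hclass: "b \<in> hclass a \<longleftrightarrow> (a, b) \<in> homotopic X"
  by (simp add: homotopy_class_def)

lemma Hom_FG: "A \<in> Hom FG x y \<longleftrightarrow> (\<exists>p. awalk y p x \<and> A = hclass (y, p, x))"
  by (auto simp: fundamental_groupoid_def quotient_def homotopy_class_def)

lemma Obj_FG: "Obj FG = verts (skel X)" by (simp add: fundamental_groupoid_def)

lemma Ident_FG: "Ident FG x = hclass (x, [], x)" by (simp add: fundamental_groupoid_def)

text \<open>\<open>Comp\<close> runs over all pairs of representatives; compatibility of homotopy
  with concatenation makes the outcome a single class.\<close>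

lemma Comp_FG:
  assumes "awalk y p x" "awalk z q y"
  shows "Comp FG (hclass (y, p, x)) (hclass (z, q, y)) = hclass (z, q @ p, x)"
proof -
  let ?M = "{(u, q' @ p', w) | u v w p' q'. (v, p', w) \<in> hclass (y, p, x) \<and> (u, q', v) \<in> hclass (z, q, y)}"
  have "(z, q @ p, x) \<in> ?M" using homotopic_refl mem_hclass by blast
  moreover have "((z, q @ p, x), w) \<in> homotopic X" if "w \<in> ?M" for w
  proof -
    obtain u v w' p' q' where w: "w = (u, q' @ p', w')" "(v, p', w') \<in> hclass (y, p, x)"
      "(u, q', v) \<in> hclass (z, q, y)"
      by (use \<open>w \<in> ?M\<close> in blast)
    then have h: "((y, p, x), (v, p', w')) \<in> homotopic X" "((z, q, y), (u, q', v)) \<in> homotopic X"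
      by (auto simp: mem_hclass)
    then have "v = y" "w' = x" "u = z"
      using homotopic_awalk[OF h(1) assms(1)] homotopic_awalk[OF h(2) assms(2)] by auto
    then show ?thesis using h homotopic_append[of z q y q' p x p'] assms w by auto
  qed
  ultimately have "homotopic X `` ?M = hclass (z, q @ p, x)"
    unfolding homotopy_class_def using homotopic_trans by blast
  then show ?thesis by (simp add: fundamental_groupoid_def)
qed

lemma groupoid_FG: "groupoid FG"
proof
  fix x assume "x \<in> Obj FG"
  then have "awalk x [] x" by (simp add: Obj_FG awalk_Nil_iff)
  then show "Ident FG x \<in> Hom FG x x" unfolding Hom_FG Ident_FG by blast
next
  fix x y z f g assume "f \<in> Hom FG x y" "g \<in> Hom FG y z"
  then obtain p q where "awalk y p x" "f = hclass (y, p, x)" "awalk z q y" "g = hclass (z, q, y)"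
    by (auto simp: Hom_FG)
  then show "Comp FG f g \<in> Hom FG x z" using Comp_FG awalk_appendI[of z q y p x] by (auto simp: Hom_FG)
next
  fix x y z u f g h assume "f \<in> Hom FG x y" "g \<in> Hom FG y z" "h \<in> Hom FG z u"
  then obtain p q r where *: "awalk y p x" "f = hclass (y, p, x)" "awalk z q y" "g = hclass (z, q, y)"
    "awalk u r z" "h = hclass (u, r, z)" by (auto simp: Hom_FG)
  have "awalk z (q @ p) x" "awalk u (r @ q) y" using * awalk_appendI by blast+
  then show "Comp FG (Comp FG f g) h = Comp FG f (Comp FG g h)" using * by (simp add: Comp_FG)
next
  fix x y f assume "f \<in> Hom FG x y"
  then obtain p where *: "awalk y p x" "f = hclass (y, p, x)" by (auto simp: Hom_FG)
  then have "awalk x [] x" "awalk y [] y"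
    using awalk_last_in_verts awalk_hd_in_verts by (auto simp: awalk_Nil_iff)
  then show "Comp FG (Ident FG x) f = f" "Comp FG f (Ident FG y) = f"
    using * by (simp_all add: Ident_FG Comp_FG)
next
  fix x y f assume "f \<in> Hom FG x y"
  then obtain p where *: "awalk y p x" "f = hclass (y, p, x)" by (auto simp: Hom_FG)
  have r: "awalk x (rev_walk p) y" by (rule awalk_rev_walk[OF *(1)])
  show "\<exists>g\<in>Hom FG y x. Comp FG f g = Ident FG x \<and> Comp FG g f = Ident FG y"
  proof (intro bexI conjI)
    show "hclass (x, rev_walk p, y) \<in> Hom FG y x" using r by (auto simp: Hom_FG)
    show "Comp FG f (hclass (x, rev_walk p, y)) = Ident FG x"
      using * r homotopic_rev_walk_left[OF *(1)] by (simp add: Comp_FG Ident_FG hclass_eq_iff)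
    show "Comp FG (hclass (x, rev_walk p, y)) f = Ident FG y"
      using * r homotopic_rev_walk_right[OF *(1)] by (simp add: Comp_FG Ident_FG hclass_eq_iff)
  qed
qed

text \<open>A functor on walks descends to an isomorphism if it is onto all sets of morphisms and
  its fibres over fixed end points are the homotopy classes.\<close>

lemma groupoid_isoI:
  fixes H :: "('v, 'n) groupoid_data" and \<mu> :: "'e list \<Rightarrow> 'n"
  assumes obj: "Obj H = verts (skel X)"
    and nil: "\<And>x. x \<in> verts (skel X) \<Longrightarrow> \<mu> [] = Ident H x"
    and app: "\<And>x y z p q. awalk y p x \<Longrightarrow> awalk z q y \<Longrightarrow> \<mu> (q @ p) = Comp H (\<mu> p) (\<mu> q)"
    and closed: "\<And>x y p. awalk y p x \<Longrightarrow> \<mu> p \<in> Hom H x y"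
    and surj: "\<And>x y h. x \<in> verts (skel X) \<Longrightarrow> y \<in> verts (skel X) \<Longrightarrow> h \<in> Hom H x y \<Longrightarrow> \<exists>p. awalk y p x \<and> \<mu> p = h"
    and eq: "\<And>x y p q. awalk y p x \<Longrightarrow> awalk y q x \<Longrightarrow> \<mu> p = \<mu> q \<longleftrightarrow> ((y, p, x), (y, q, x)) \<in> homotopic X"
  shows "\<exists>\<phi>. groupoid_iso FG H id \<phi> \<and> (\<forall>x p y. awalk x p y \<longrightarrow> \<phi> (hclass (x, p, y)) = \<mu> p)"
proof -
  \<comment> \<open>The value at an arbitrary representative; on homotopic walks \<mu>
    agrees.\<close>
  define \<phi> where "\<phi> A = \<mu> (fst (snd (SOME w. w \<in> A)))" for A :: "('v, 'e) walk set"
  have \<phi>: "\<phi> (hclass (x, p, y)) = \<mu> p" if p: "awalk x p y" for x p y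
  proof -
    have "\<exists>w. w \<in> hclass (x, p, y)" using homotopic_refl mem_hclass by blast
    then have h: "((x, p, y), (SOME w. w \<in> hclass (x, p, y))) \<in> homotopic X"
      using someI_ex mem_hclass by metis
    then obtain q where q: "(SOME w. w \<in> hclass (x, p, y)) = (x, q, y)" "awalk x q y"
      using homotopic_awalk[OF _ p] by metis
    then show ?thesis using eq[OF p q(2)] h by (simp add: \<phi>_def)
  qed
  have "groupoid_iso FG H id \<phi>"
    unfolding groupoid_iso_def
  proof (intro conjI ballI)
    show "bij_betw id (Obj FG) (Obj H)" using obj by (simp add: Obj_FG bij_betw_id)
    fix x assume x: "x \<in> Obj FG"
    have "awalk x [] x" using x by (simp add: awalk_Nil_iff Obj_FG)
    then show "\<phi> (Ident FG x) = Ident H (id x)" using x nil \<phi> by (simp add: Ident_FG Obj_FG)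
    fix y assume y: "y \<in> Obj FG"
    show "bij_betw \<phi> (Hom FG x y) (Hom H (id x) (id y))"
    proof (rule bij_betwI')
      fix f g assume "f \<in> Hom FG x y" "g \<in> Hom FG x y"
      then obtain p q where "awalk y p x" "f = hclass (y, p, x)" "awalk y q x" "g = hclass (y, q, x)"
        by (auto simp: Hom_FG)
      then show "\<phi> f = \<phi> g \<longleftrightarrow> f = g" using eq by (simp add: \<phi> hclass_eq_iff)
    next
      fix f assume "f \<in> Hom FG x y"
      then show "\<phi> f \<in> Hom H (id x) (id y)" using closed by (auto simp: Hom_FG \<phi>)
    next
      fix h assume "h \<in> Hom H (id x) (id y)"
      then obtain p where "awalk y p x" "\<mu> p = h" using surj[of x y h] x y by (auto simp: Obj_FG)
      then show "\<exists>f\<in>Hom FG x y. h = \<phi> f"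
        using \<phi> by (intro bexI[of _ "hclass (y, p, x)"]) (auto simp: Hom_FG)
    qed
    fix z f g assume "f \<in> Hom FG x y" "g \<in> Hom FG y z"
    then obtain p q where *: "awalk y p x" "f = hclass (y, p, x)" "awalk z q y" "g = hclass (z, q, y)"
      by (auto simp: Hom_FG)
    have "awalk z (q @ p) x" using * awalk_appendI by blast
    then show "\<phi> (Comp FG f g) = Comp H (\<phi> f) (\<phi> g)" using * app by (simp add: \<phi> Comp_FG)
  qed
  then show ?thesis using \<phi> by blast
qed

end

lemma (in groupoid) group_vertex_group:
  assumes "x \<in> Obj G" shows "group (vertex_group G x)"
proof (rule groupI)
  fix f assume "f \<in> carrier (vertex_group G x)"
  then show "\<exists>g\<in>carrier (vertex_group G x). g \<otimes>\<^bsub>vertex_group G x\<^esub> f = \<one>\<^bsub>vertex_group G x\<^esub>"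
    using inverse_ex[OF assms assms, of f] by (auto simp: vertex_group_def)
qed (use assms Comp_closed Comp_assoc Comp_Ident_left Ident_closed in \<open>auto simp: vertex_group_def\<close>)

lemma groupoid_iso_vertex_group:
  assumes "groupoid G" "groupoid_iso G H id \<phi>" "x \<in> Obj G"
  shows "vertex_group H x \<cong> vertex_group G x"
proof -
  have "\<phi> \<in> iso (vertex_group G x) (vertex_group H x)"
  proof (rule isoI)
    have b: "bij_betw \<phi> (Hom G x x) (Hom H x x)"
      using assms(2,3) by (simp add: groupoid_iso_def)
    then show "bij_betw \<phi> (carrier (vertex_group G x)) (carrier (vertex_group H x))"
      by (simp add: vertex_group_def)
    show "\<phi> \<in> hom (vertex_group G x) (vertex_group H x)"
      using assms(2,3) bij_betw_apply[OF b] by (auto simp: hom_def vertex_group_def groupoid_iso_def)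
  qed
  then have "vertex_group G x \<cong> vertex_group H x" by (auto simp: is_iso_def)
  then show ?thesis using group.iso_sym[OF groupoid.group_vertex_group[OF assms(1,3)]] by blast
qed

section \<open>Walks in the graph \<open>\<C>\<close>\<close>

context labelled_coxeter_system
begin

abbreviation YC :: "('l \<Rightarrow> 'a, ('l \<Rightarrow> 'a) \<times> 'a) two_complex" where
  "YC \<equiv> Y_complex \<Lambda> xI"

lemma skel_Y [simp]:
  "verts (skel YC) = V" "tail (skel YC) = fst" "head (skel YC) = target"
  "e \<in> arcs (skel YC) \<longleftrightarrow> e \<in> arcsC \<and> fst e \<noteq> target e"
  by (simp_all add: Y_complex_def delete_loops_def C_graph_def)

lemma opp_Y [simp]: "opp YC = oppo"
  by (simp add: Y_complex_def)

lemma arcsC_facts: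
  assumes "e \<in> arcsC"
  shows "fst e \<in> V" "target e \<in> V" "elt e \<in> CH (target e) (fst e)" "elt e \<in> carrier W"
    "len (elt e) > 0"
  using assms arc_facts(1) target_V_elt elt_carrier len_elt_pos by (cases e; auto)+

sublocale YC: edge_complex YC
  by unfold_locales (use arc_oppo arcsC_facts in auto)

abbreviation aw :: "('l \<Rightarrow> 'a) \<Rightarrow> (('l \<Rightarrow> 'a) \<times> 'a) list \<Rightarrow> ('l \<Rightarrow> 'a) \<Rightarrow> bool" where "aw \<equiv> YC.awalk"
abbreviation we :: "(('l \<Rightarrow> 'a) \<times> 'a) list \<Rightarrow> 'a" where
  "we \<equiv> walk_elt \<Lambda>"

lemma aw_Nil: "aw x [] y \<longleftrightarrow> x = y \<and> x \<in> V"
  by (auto simp: YC.awalk_Nil_iff)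

lemma aw_Cons: "aw x (e # p) y \<longleftrightarrow> e \<in> arcsC \<and> fst e \<noteq> target e \<and> x = fst e \<and> aw (target e) p y"
  by (auto simp: YC.awalk_Cons_iff)

lemma aw_V: "aw x p y \<Longrightarrow> x \<in> V" "aw x p y \<Longrightarrow> y \<in> V"
  using YC.awalk_hd_in_verts YC.awalk_last_in_verts by auto

lemma aw_arcsC: "aw x p y \<Longrightarrow> set p \<subseteq> arcsC"
  using YC.awalk_arcs[of x p y] by auto

lemma fold_elt_closed:
  "set p \<subseteq> arcsC \<Longrightarrow> a \<in> carrier W \<Longrightarrow> fold (\<lambda>e w. elt e \<otimes> w) p a \<in> carrier W"
  by (induction p arbitrary: a) (auto simp: arcsC_facts)

lemma we_closed [simp]: "set p \<subseteq> arcsC \<Longrightarrow> we p \<in> carrier W"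
  by (simp add: walk_elt_def fold_elt_closed)

lemma we_Nil [simp]: "we [] = \<one>"
  by (simp add: walk_elt_def)

lemma fold_elt: "set p \<subseteq> arcsC \<Longrightarrow> a \<in> carrier W \<Longrightarrow> fold (\<lambda>e w. elt e \<otimes> w) p a = we p \<otimes> a"
proof (induction p arbitrary: a)
  case (Cons e p)
  then have e: "elt e \<in> carrier W" "set p \<subseteq> arcsC" using arcsC_facts by auto
  have "we (e # p) = we p \<otimes> elt e" using Cons.IH[of "elt e"] e by (simp add: walk_elt_def)
  then show ?case using Cons e by (simp add: m_assoc)
qed simp

lemma we_Cons: "set (e # p) \<subseteq> arcsC \<Longrightarrow> we (e # p) = we p \<otimes> elt e"
  using fold_elt[of p "elt e"] arcsC_facts[of e] by (simp add: walk_elt_def)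

lemma we_append: "set p \<subseteq> arcsC \<Longrightarrow> set q \<subseteq> arcsC \<Longrightarrow> we (p @ q) = we q \<otimes> we p"
  using fold_elt[of q "we p"]
    by (simp add: walk_elt_def[of \<Lambda> "p @ q"] walk_elt_def[of \<Lambda> p, symmetric])

lemma nonloop_elt_Y_hom: "e \<in> arcsC \<Longrightarrow> fst e \<noteq> target e \<Longrightarrow> elt e \<in> YH (target e) (fst e)"
  using elt_Y_hom_iff[of "fst e" "snd e"] by auto

lemma we_Y_hom: "aw x p y \<Longrightarrow> we p \<in> YH y x"
proof (induction p arbitrary: x)
  case (Cons e p)
  then have e: "e \<in> arcsC" "fst e \<noteq> target e" "x = fst e" "aw (target e) p y"
    by (auto simp: aw_Cons)
  then have "we p \<otimes> elt e \<in> YH y x"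
    using Y_hom_mult Cons.IH nonloop_elt_Y_hom arcsC_facts(1) by metis
  then show ?case using we_Cons[of e p] aw_arcsC[OF Cons.prems] by simp
qed (auto simp: aw_Nil Y_hom_one)

lemma Y_hom_C_hom: "w \<in> YH y x \<Longrightarrow> w \<in> CH y x"
  by (simp add: Y_hom_iff)

lemma we_C_hom: "aw x p y \<Longrightarrow> we p \<in> CH y x"
  using we_Y_hom Y_hom_C_hom by blast

definition wlen :: "(('l \<Rightarrow> 'a) \<times> 'a) list \<Rightarrow> nat" where
  "wlen p = sum_list (map (\<lambda>e. len (elt e)) p)"

lemma wlen_simps [simp]: "wlen [] = 0" "wlen (e # p) = len (elt e) + wlen p" "wlen (p @ q) = wlen p + wlen q"
  by (simp_all add: wlen_def)

lemma wlen_eq_0: "set p \<subseteq> arcsC \<Longrightarrow> wlen p = 0 \<Longrightarrow> p = []"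
proof (cases p)
  case (Cons e p')
  assume "set p \<subseteq> arcsC" "wlen p = 0"
  then show ?thesis using Cons arcsC_facts(5)[of e] by simp
qed simp

lemma len_we_le: "set p \<subseteq> arcsC \<Longrightarrow> len (we p) \<le> wlen p"
proof (induction p)
  case (Cons e p)
  then have "len (we p \<otimes> elt e) \<le> len (we p) + len (elt e)"
    using len_mult_le arcsC_facts(4) by auto
  then show ?case using Cons we_Cons[of e p] by simp
qed simp

text \<open>Additivity of Coxeter lengths along the walk, as opposed to minimality of the number of
  arcs.\<close>

definition reduced :: "(('l \<Rightarrow> 'a) \<times> 'a) list \<Rightarrow> bool" where
  "reduced p \<longleftrightarrow> len (we p) = wlen p"

lemma reduced_append:
  assumes "set (p @ q) \<subseteq> arcsC" "reduced (p @ q)" shows "reduced p" "reduced q"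
proof -
  have a: "set p \<subseteq> arcsC" "set q \<subseteq> arcsC" using assms(1) by auto
  have "len (we (p @ q)) \<le> len (we q) + len (we p)" using we_append[OF a] len_mult_le a by simp
  moreover have "len (we p) \<le> wlen p" "len (we q) \<le> wlen q" using len_we_le a by auto
  ultimately show "reduced p" "reduced q" using assms(2) by (simp_all add: reduced_def)
qed

text \<open>By the dichotomy of \<open>C_hom_arc_length\<close>, without the descent the first arc
  would shorten the product.\<close>

lemma reduced_Cons_descent:
  assumes "aw x ((x, s) # p) y" "reduced ((x, s) # p)"
  shows "- act (we ((x, s) # p)) (simple_root s) \<in> pos_roots"
proof (rule ccontr)
  assume n: "\<not> ?thesis"
  have a: "(x, s) \<in> arcsC" "aw (target (x, s)) p y" using assms(1) by (auto simp: aw_Cons)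
  have s: "set ([(x, s)] @ p) \<subseteq> arcsC" using aw_arcsC[OF assms(1)] by simp
  have eq: "we ((x, s) # p) = we p \<otimes> elt (x, s)" using we_Cons[of "(x, s)" p] s by simp
  have "len (we p) = len (we p \<otimes> elt (x, s)) + len (elt (x, s))"
    using C_hom_arc_length(2)[OF a(1) aw_V(2)[OF a(2)] we_C_hom[OF a(2)]] n eq by simp
  moreover have "reduced p" using reduced_append(2)[OF s] assms(2) by simp
  ultimately show False using assms(2) eq len_elt_pos[OF a(1)] by (simp add: reduced_def)
qed

text \<open>Splitting off the arc of a descent stays inside Y and lowers the length. This is the
  surjectivity of the isomorphism.\<close>

lemma reduced_walk_ex:
  assumes "x \<in> V" "y \<in> V" "w \<in> YH y x"
  obtains p where "aw x p y" "we p = w" "reduced p"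
proof -
  have "\<exists>p. aw x p y \<and> we p = w \<and> reduced p" using assms
  proof (induction "len w" arbitrary: w x rule: less_induct)
    case less
    have wC: "w \<in> CH y x" "w \<in> carrier W" using less.prems(3) Y_hom_C_hom C_homD(1) by blast+
    show ?case
    proof (cases "w = \<one>")
      case True
      then have "y = x" using C_hom_unique[OF less.prems(2,1)] wC C_hom_one by blast
      then show ?thesis using True less.prems by (intro exI[of _ "[]"]) (simp add: aw_Nil reduced_def)
    next
      case False
      then obtain s where s: "s \<in> S" "- act w (simple_root s) \<in> pos_roots"
        using descent_ex wC by metis
      note d = C_hom_descent_arc[OF less.prems(1,2) wC(1) s]
      note Y = Y_hom_descent[OF less.prems s]
      have e: "elt (x, s) \<in> carrier W" using elt_carrier d(1) by blast
      have "len (w \<otimes> inv elt (x, s)) < len w" using d(3) len_elt_pos[OF d(1)] by simp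
      then obtain p where p: "aw (target (x, s)) p y" "we p = w \<otimes> inv elt (x, s)" "reduced p"
        using less.hyps[OF _ target_V_elt(1)[OF d(1)] less.prems(2) Y(3)] by blast
      have "aw x ((x, s) # p) y" using p d(1) Y(1) by (auto simp: aw_Cons)
      moreover have "we ((x, s) # p) = w"
        using we_Cons[of "(x, s)" p] aw_arcsC[OF p(1)] d(1) p(2) e wC by (simp add: m_assoc)
      moreover have "reduced ((x, s) # p)" using calculation(2) p d(3) by (simp add: reduced_def)
      ultimately show ?thesis by blast
    qed
  qed
  then show ?thesis using that by blast
qed

text \<open>The first arc can be prescribed among the descents; this provides both sides of a
  2-cell.\<close>

lemma reduced_walk_first_arc:
  assumes "x \<in> V" "y \<in> V" "w \<in> YH y x" "s \<in> S" "- act w (simple_root s) \<in> pos_roots"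
  obtains p where "aw x ((x, s) # p) y" "we ((x, s) # p) = w" "reduced ((x, s) # p)"
proof -
  have wC: "w \<in> CH y x" "w \<in> carrier W" using assms(3) Y_hom_C_hom C_homD(1) by blast+
  note d = C_hom_descent_arc[OF assms(1,2) wC(1) assms(4,5)] and Y = Y_hom_descent[OF assms]
  have e: "elt (x, s) \<in> carrier W" using elt_carrier d(1) by blast
  obtain p where p: "aw (target (x, s)) p y" "we p = w \<otimes> inv elt (x, s)" "reduced p"
    using reduced_walk_ex[OF target_V_elt(1)[OF d(1)] assms(2) Y(3)] by blast
  have "aw x ((x, s) # p) y" using p d(1) Y(1) by (auto simp: aw_Cons)
  moreover have "we ((x, s) # p) = w"
    using we_Cons[of "(x, s)" p] aw_arcsC[OF p(1)] d(1) p(2) e wC by (simp add: m_assoc)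
  moreover have "reduced ((x, s) # p)" using calculation(2) p d(3) by (simp add: reduced_def)
  ultimately show ?thesis using that by blast
qed

section \<open>Components of rank two\<close>

abbreviation CJ :: "'a set \<Rightarrow> ('l \<Rightarrow> 'a, ('l \<Rightarrow> 'a) \<times> 'a) pre_digraph" where "CJ \<equiv> C_graph_on \<Lambda> xI"

lemma CJ_simps [simp]: "verts (CJ J) = {y \<in> V. y ` \<Lambda> \<subseteq> J}" "tail (CJ J) = fst"
  "head (CJ J) = target"
    "(y, s) \<in> arcs (CJ J) \<longleftrightarrow> (y, s) \<in> arcsC \<and> y ` \<Lambda> \<subseteq> J \<and> s \<in> J"
  by (auto simp: C_graph_on_def C_graph_def)

lemma CJ_arcsC: "e \<in> arcs (CJ J) \<Longrightarrow> e \<in> arcsC"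
  by (cases e) simp

lemma CJ_tail: "e \<in> arcs (CJ J) \<Longrightarrow> fst e \<in> verts (CJ J)"
  by (cases e) (auto simp: arcsC_iff)

lemma CJ_oppo: assumes "e \<in> arcs (CJ J)" shows "oppo e \<in> arcs (CJ J)"
proof -
  obtain x s where e: "e = (x, s)" by (cases e)
  have a: "(x, s) \<in> arcsC" "x ` \<Lambda> \<union> {s} \<subseteq> J" using assms e by auto
  have "region (x ` \<Lambda> \<union> {s}) (sim (x ` \<Lambda>) {s}) (target (x, s))"
    using region_arc(3)[OF arc_region[OF a(1)]] arc_facts[OF a(1)] by blast
  then have "target (x, s) ` \<Lambda> \<subseteq> x ` \<Lambda> \<union> {s}" by (rule region_facts)
  then have "target (x, s) ` \<Lambda> \<subseteq> J" using a(2) by blast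
  moreover obtain t where "oppo (x, s) = (target (x, s), t)" "(target (x, s), t) \<in> arcsC"
    "t \<in> x ` \<Lambda> \<union> {s}"
    using arc_opp_facts[OF a(1)] by metis
  ultimately show ?thesis using a(2) e by auto
qed

lemma CJ_head: "e \<in> arcs (CJ J) \<Longrightarrow> target e \<in> verts (CJ J)"
  using CJ_tail[OF CJ_oppo, of e J] arc_oppo(2)[OF CJ_arcsC, of e J] by simp

section \<open>Connected components and their roots\<close>

definition comp_verts :: "'a set \<Rightarrow> ('l \<Rightarrow> 'a) \<Rightarrow> ('l \<Rightarrow> 'a) set" where
  "comp_verts J x = {y. reachable (with_proj (mk_symmetric (CJ J))) x y}"

lemma component_CJ [simp]:
  "verts (component_of (CJ J) x) = comp_verts J x"
  "tail (component_of (CJ J) x) = fst" "head (component_of (CJ J) x) = target"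
  "e \<in> arcs (component_of (CJ J) x) \<longleftrightarrow> e \<in> arcs (CJ J) \<and> fst e \<in> comp_verts J x \<and> target e \<in> comp_verts J x"
  by (simp_all add: component_of_def comp_verts_def induce_subgraph_def)

lemma sym_adjacency:
  "arcs_ends (with_proj (mk_symmetric (CJ J))) = (\<Union>e\<in>arcs (CJ J). {(fst e, target e), (target e, fst e)})"
  by (simp add: parcs_mk_symmetric arcs_ends_conv)

lemma comp_verts_base: "x \<in> verts (CJ J) \<Longrightarrow> x \<in> comp_verts J x"
  by (simp add: comp_verts_def reachable_def)

lemma comp_verts_step:
  assumes "e \<in> arcs (CJ J)" "fst e \<in> comp_verts J x" shows "target e \<in> comp_verts J x"
proof -
  let ?S = "with_proj (mk_symmetric (CJ J))"
  have 1: "(x, fst e) \<in> rtrancl_on (verts ?S) (arcs_ends ?S)"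
    by (rule assms(2)[unfolded comp_verts_def reachable_def, THEN CollectD])
  have 2: "(fst e, target e) \<in> arcs_ends ?S" unfolding sym_adjacency using assms(1) by blast
  have 3: "target e \<in> verts ?S" using CJ_head[OF assms(1)] by simp
  show ?thesis unfolding comp_verts_def reachable_def
    by (rule CollectI, rule rtrancl_on_into_rtrancl_on[OF 1 2 3])
qed

text \<open>The graph contains opposite arcs, so undirected reachability needs steps in the
  direction of arcs only.\<close>

lemma comp_verts_induct [consumes 1, case_names base step]:
  assumes "y \<in> comp_verts J x" "P x"
    "\<And>e. e \<in> arcs (CJ J) \<Longrightarrow> P (fst e) \<Longrightarrow> P (target e)"
  shows "P y"
proof -
  have "(x, y) \<in> (arcs_ends (with_proj (mk_symmetric (CJ J))))\<^sup>*"
    by (rule reachable_rtranclI[OF assms(1)[unfolded comp_verts_def, THEN CollectD]])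
  then show ?thesis
  proof (induction rule: rtrancl_induct)
    case (step y z)
    from step.hyps(2) obtain e
      where e: "e \<in> arcs (CJ J)" "(y, z) = (fst e, target e) \<or> (y, z) = (target e, fst e)"
      unfolding sym_adjacency by blast
    from e(2) show ?case
    proof
      assume "(y, z) = (target e, fst e)"
      then show ?thesis
        using assms(3)[OF CJ_oppo[OF e(1)]] step.IH arc_oppo(2,3)[OF CJ_arcsC[OF e(1)]] by simp
    qed (use assms(3)[OF e(1)] step.IH in simp)
  qed (use assms(2) in simp)
qed

lemma region_comp_verts:
  assumes "region J K x" "y \<in> comp_verts J x" shows "region J K y"
  using assms(2)
proof (induction rule: comp_verts_induct)
  case (step e)
  then show ?case using region_arc(3)[of J K "fst e" "snd e"] by (cases e) (auto simp: arcsC_iff)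
qed (rule assms(1))

lemma region_CJ:
  assumes "region J K y"
  shows "y \<in> verts (CJ J)" "s \<in> J \<Longrightarrow> s \<notin> y ` \<Lambda> \<Longrightarrow> (y, s) \<in> arcs (CJ J)"
    "(y, s) \<in> arcs (CJ J) \<Longrightarrow> elt (y, s) \<in> parabolic K"
  using region_facts[OF assms] region_arc[OF assms] by (auto simp: arcsC_iff)

text \<open>Descents of g split off arcs of the component. None of these is a loop, so each lies in
  Y and carries \<gamma> to a positive root orthogonal to the next vertex.\<close>

lemma nonloop_component_pos:
  assumes R: "region J K x" and noloop: "\<And>e. e \<in> arcs (component_of (CJ J) x) \<Longrightarrow> fst e \<noteq> target e"
    and "u \<in> comp_verts J x" "g \<in> parabolic K" "g \<in> CH z u" "z \<in> V"
      "\<gamma> \<in> perp_roots (u ` \<Lambda>) \<inter> pos_roots"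
  shows "act g \<gamma> \<in> pos_roots"
  using assms(3-)
proof (induction "len g" arbitrary: g u \<gamma> rule: less_induct)
  case less
  note u = less.prems(1) and gK = less.prems(2) and gC = less.prems(3) and z = less.prems(4) and \<gamma> = less.prems(5)
  have Ru: "region J K u" using region_comp_verts[OF R u] .
  note f = region_facts[OF Ru]
  have g: "g \<in> carrier W" using gC C_homD by blast
  show ?case
  proof (cases "g = \<one>")
    case False
    then obtain s where s: "s \<in> S" "- act g (simple_root s) \<in> pos_roots" using descent_ex g by metis
    note sJ = region_descent[OF Ru gK gC z s]
    note d = C_hom_descent_arc[OF f(1) z gC s]
    let ?e = "elt (u, s)" and ?t = "target (u, s)"
    have e: "(u, s) \<in> arcs (CJ J)" using region_CJ(2)[OF Ru sJ] .
    then have t: "?t \<in> comp_verts J x" using comp_verts_step[of "(u, s)"] u by simp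
    then have "(u, s) \<in> arcs (component_of (CJ J) x)" using e u by (simp only: component_CJ fst_conv)
    then have "?t \<noteq> u" using noloop[of "(u, s)"] by simp
    then have eY: "?e \<in> YH ?t u" using elt_Y_hom_iff[OF d(1)] by simp
    have eW: "?e \<in> carrier W" using elt_carrier d(1) by blast
    have \<gamma>': "act ?e \<gamma> \<in> perp_roots (?t ` \<Lambda>) \<inter> pos_roots"
      using act_perp_roots[OF Y_hom_C_hom[OF eY] f(1)] \<gamma> eY by (auto simp: Y_hom_iff)
    have "len (g \<otimes> inv ?e) < len g" using d(3) len_elt_pos[OF d(1)] by simp
    moreover have "g \<otimes> inv ?e \<in> parabolic K"
      using parabolic_mult[OF gK parabolic_inv[OF f(7) region_arc(2)[OF Ru sJ]]] .
    ultimately have "act (g \<otimes> inv ?e) (act ?e \<gamma>) \<in> pos_roots"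
      using less.hyps[OF _ t _ d(4) z \<gamma>'] by blast
    then show ?thesis using g eW by (simp add: act_mult)
  qed (use \<gamma> in simp)
qed

text \<open>The element \<open>relative_w0\<close> for all of J - [u] inverts every positive root of
  K that is not supported in [u], in particular every orthogonal one, against the preceding
  lemma.\<close>

lemma nonloop_component_no_perp:
  assumes R: "region J K x" and noloop: "\<And>e. e \<in> arcs (component_of (CJ J) x) \<Longrightarrow> fst e \<noteq> target e"
    and u: "u \<in> comp_verts J x"
  shows "pos_on K \<inter> perp_roots (u ` \<Lambda>) = {}"
proof (rule ccontr)
  assume "\<not> ?thesis"
  then obtain \<gamma> where \<gamma>: "\<gamma> \<in> pos_on K" "\<gamma> \<in> perp_roots (u ` \<Lambda>)"
    by blast
  have Ru: "region J K u" using region_comp_verts[OF R u] .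
  note f = region_facts[OF Ru]
  let ?T = "J - u ` \<Lambda>"
  let ?v = "relative_w0 K ?T"
  have v: "?v \<in> parabolic K" "?v \<in> carrier W"
    using relative_w0_parabolic[OF f(7,6)] relative_w0_carrier[OF f(7,6)] by auto
  obtain z where z: "z \<in> V" "?v \<in> CH z u"
  proof (rule C_hom_target_ex[OF f(1) v(2)])
    fix l assume l: "l \<in> \<Lambda>"
    show "\<exists>s\<in>S. act ?v (simple_root (u l)) = simple_root s"
    proof (cases "u l \<in> K")
      case True
      then have "u l \<in> K - ?T" using l by blast
      then obtain j where "j \<in> K" "act ?v (simple_root (u l)) = simple_root j"
        by (rule relative_w0_simple_root[OF f(7,6)])
      then show ?thesis using f(7) by blast
    next
      case False
      then have "act ?v (simple_root (u l)) = simple_root (u l)"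
        using region_fixes[OF Ru v(1), of "u l"] f(3) l by blast
      then show ?thesis using V_S[OF f(1) l] by blast
    qed
  qed
  have "\<not> ky \<gamma> \<subseteq> u ` \<Lambda>"
    using perp_root_outside[of \<gamma> "u ` \<Lambda>"] \<gamma> by (auto simp: pos_on_def)
  then have "\<not> ky \<gamma> \<subseteq> K - ?T" using f(4) by blast
  then have "\<gamma> \<in> inv_set ?v"
    using \<gamma> inv_set_relative_w0[OF f(7,6)] by (simp add: pos_on_def)
  moreover have "act ?v \<gamma> \<in> pos_roots"
    using nonloop_component_pos[OF R noloop u v(1) z(2,1)] \<gamma> by (simp add: pos_on_def)
  ultimately show False using pos_not_neg by (auto simp: inv_set_def)
qed

text \<open>Without loops, \<open>C\<^sub>u\<^sub>,\<^sub>u \<inter> W\<^sub>K\<close> is trivial.\<close>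

lemma cell_boundary_trivial:
  assumes D: "D \<in> cells YC" and b: "traverses (skel YC) (opp YC) b D" and u: "aw u b u"
  shows "we b = \<one>"
proof -
  obtain G x s t where G: "D = arcs G" "cycle_without_loops G oppo" "x \<in> V" "s \<in> S - x ` \<Lambda>"
    "t \<in> S - x ` \<Lambda>"
    "finite_type (sim (x ` \<Lambda>) {s, t})" "G = component_of (CJ (x ` \<Lambda> \<union> {s, t})) x"
    using D unfolding Y_complex_def by auto
  define J where "J = x ` \<Lambda> \<union> {s, t}"
  define K where "K = sim (x ` \<Lambda>) {s, t}"
  have R: "region J K x" unfolding J_def K_def by (rule region_sim) (use G in auto)
  have noloop: "fst e \<noteq> target e" if "e \<in> arcs (component_of (CJ J) x)" for e
    using G(2,7) that by (auto simp: cycle_without_loops_def J_def)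
  have bD: "set b \<subseteq> arcs (component_of (CJ J) x)" "b \<noteq> []"
    using b G(1,7) by (auto simp: traverses_def J_def pre_digraph.cycle_def)
  have "u \<in> comp_verts J x"
  proof -
    obtain e b' where "b = e # b'" using bD(2) by (cases b) auto
    then show ?thesis using bD(1) u by (auto simp: aw_Cons)
  qed
  then have Ru: "region J K u" and n: "pos_on K \<inter> perp_roots (u ` \<Lambda>) = {}"
    using region_comp_verts[OF R] nonloop_component_no_perp[OF R noloop] by auto
  have "we p \<in> parabolic K" if "set p \<subseteq> arcs (component_of (CJ J) x)" for p
    using that
  proof (induction p)
    case (Cons e p)
    then have e: "e \<in> arcs (CJ J)" "fst e \<in> comp_verts J x" by auto
    have "elt e \<in> parabolic K"
      using region_CJ(3)[OF region_comp_verts[OF R e(2)], of "snd e"] e(1) by simp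
    moreover have "we (e # p) = we p \<otimes> elt e" 
    proof (rule we_Cons, rule subsetI)
      fix f assume "f \<in> set (e # p)"
      then have "f \<in> arcs (component_of (CJ J) x)" using Cons.prems by blast
      then show "f \<in> arcsC" unfolding component_CJ using CJ_arcsC by blast
    qed
    ultimately show ?case using Cons parabolic_mult by auto
  qed (simp add: parabolic_one)
  then show "we b = \<one>" using region_trivial_stabilizer[OF Ru _ we_C_hom[OF u] n] bD(1) by blast
qed

end

text \<open>This lemma and the next transfer walks and their vertices between a component and the
  whole skeleton, which share the tail and head functions.\<close>

lemma cas_cong: "tail G = tail H \<Longrightarrow> head G = head H \<Longrightarrow> pre_digraph.cas G u p v = pre_digraph.cas H u p v"
  by (induction p arbitrary: u) (simp_all add: pre_digraph.cas.simps)

lemma awalk_verts_cong: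
  "tail G = tail H \<Longrightarrow> head G = head H \<Longrightarrow> pre_digraph.awalk_verts G u p = pre_digraph.awalk_verts H u p"
  by (induction p arbitrary: u) (simp_all add: pre_digraph.awalk_verts.simps)

lemma (in edge_complex) awalk_verts_rev_walk: "awalk u p v \<Longrightarrow> awalk_verts v (rev_walk p) = rev (awalk_verts u p)"
proof (induction p arbitrary: u)
  case (Cons e p)
  then have e: "e \<in> arcs (skel X)" "awalk (head (skel X) e) p v" by (auto simp: awalk_Cons_iff)
  have w: "awalk v (rev_walk p) (head (skel X) e)" by (rule awalk_rev_walk[OF e(2)])
  have "awalk v (rev_walk p @ [opp X e]) u" using awalk_rev_walk[OF Cons.prems] by simp
  then have "awalk_verts v (rev_walk p @ [opp X e])
      = awalk_verts v (rev_walk p) @ tl (awalk_verts (awlast v (rev_walk p)) [opp X e])"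
    by (rule awalk_verts_append)
  then show ?case using Cons.IH[OF e(2)] head_opp[OF e(1)] by simp
qed (simp add: awalk_Nil_iff)

context labelled_coxeter_system
begin

lemma parabolic_C_hom_unique:
  assumes R: "region J K x" and n: "pos_on K \<inter> perp_roots (x ` \<Lambda>) = {}"
    and g: "g \<in> parabolic K" "g \<in> CH y x" and h: "h \<in> parabolic K" "h \<in> CH y x"
  shows "g = h"
proof -
  have c: "g \<in> carrier W" "h \<in> carrier W" using g h C_homD by blast+
  have "inv g \<otimes> h = \<one>"
    by (rule region_trivial_stabilizer[OF R _ _ n])
      (use parabolic_mult[OF parabolic_inv[OF region_facts(7)[OF R] g(1)] h(1)]
        C_hom_mult[OF C_hom_inv[OF g(2)] h(2)] in auto)
  then have "inv h = inv g" using c by (intro inv_equality) auto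
  then show ?thesis using c by (metis inv_inv)
qed

lemma we_parabolic:
  "(\<And>e. e \<in> set p \<Longrightarrow> e \<in> arcsC \<and> elt e \<in> parabolic K) \<Longrightarrow> we p \<in> parabolic K"
proof (induction p)
  case (Cons e p)
  then have "we (e # p) = we p \<otimes> elt e" by (intro we_Cons) auto
  then show ?case using Cons parabolic_mult by simp
qed (simp add: parabolic_one)

text \<open>The first arc of a reduced walk is a descent of its product, and elements of
  \<open>parabolic K\<close> invert only roots of K. Dividing by that arc stays in the parabolic
  subgroup.\<close>

lemma reduced_walk_in_region:
  "region J K x \<Longrightarrow> aw x p z \<Longrightarrow> reduced p \<Longrightarrow> we p \<in> parabolic K \<Longrightarrow> e \<in> set p \<Longrightarrow>
    e \<in> arcs (CJ J) \<and> elt e \<in> parabolic K"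
proof (induction p arbitrary: x)
  case (Cons e1 p)
  obtain s where e1: "e1 = (x, s)" using Cons.prems(2) by (cases e1) (auto simp: aw_Cons)
  have a: "(x, s) \<in> arcsC" "aw (target (x, s)) p z" using Cons.prems(2) e1 by (auto simp: aw_Cons)
  have sub: "set ([(x, s)] @ p) \<subseteq> arcsC" using aw_arcsC[OF Cons.prems(2)] e1 by simp
  have neg: "- act (we (e1 # p)) (simple_root s) \<in> pos_roots"
    using reduced_Cons_descent Cons.prems(2,3) unfolding e1 by blast
  have sJ: "s \<in> J" "s \<notin> x ` \<Lambda>"
    using region_descent[OF Cons.prems(1,4) we_C_hom[OF Cons.prems(2)] aw_V(2)[OF Cons.prems(2)] _ neg]
      arc_facts(2)[OF a(1)] by blast+
  note ra = region_arc[OF Cons.prems(1) sJ] and ce = region_CJ(2)[OF Cons.prems(1) sJ]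
  have red: "reduced p" using reduced_append(2)[OF sub] Cons.prems(3) e1 by simp
  have "we p = we (e1 # p) \<otimes> inv elt (x, s)"
    using we_Cons[of "(x, s)" p] sub e1 elt_carrier[OF a(1)] by (simp add: m_assoc)
  then have "we p \<in> parabolic K"
    using parabolic_mult[OF Cons.prems(4) parabolic_inv[OF region_facts(7)[OF Cons.prems(1)] ra(2)]] by simp
  then have "e \<in> set p \<Longrightarrow> ?case" using Cons.IH[OF ra(3) a(2) red] by blast
  then show ?case using Cons.prems(5) ra(2) ce e1 by auto
qed simp

lemma walk_in_component:
  "aw u p z \<Longrightarrow> u \<in> comp_verts J x \<Longrightarrow> set p \<subseteq> arcs (CJ J) \<Longrightarrow> set p \<subseteq> arcs (component_of (CJ J) x)"
proof (induction p arbitrary: u)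
  case (Cons e p)
  then have e: "e \<in> arcs (CJ J)" "fst e = u" "aw (target e) p z" by (auto simp: aw_Cons)
  then have "target e \<in> comp_verts J x" using comp_verts_step Cons.prems(2) by blast
  moreover have "set p \<subseteq> arcs (CJ J)" using Cons.prems(3) by simp
  ultimately have "set p \<subseteq> arcs (component_of (CJ J) x)" using Cons.IH[OF e(3)] by blast
  moreover have "e \<in> arcs (component_of (CJ J) x)"
    unfolding component_CJ using e \<open>target e \<in> comp_verts J x\<close> Cons.prems(2) by simp
  ultimately show ?case by simp
qed simp

text \<open>At the base point, where one of the two pieces is empty, the first arc leaves and the
  last arc enters.\<close>

lemma closed_walk_out_arc:
  assumes "aw x h x" "h \<noteq> []" "aw x a y" "aw y b x" "h = a @ b"
  obtains e1 e2 where "e1 \<in> set h" "fst e1 = y" "e2 \<in> set h" "target e2 = y"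
proof -
  have 1: "\<exists>e\<in>set r. fst e = u" if "aw u r v" "r \<noteq> []" for u r v
    using that by (cases r) (auto simp: aw_Cons)
  have 2: "\<exists>e\<in>set r. target e = v" if r: "aw u r v" "r \<noteq> []" for u r v
  proof -
    obtain r' e where re: "r = r' @ [e]" using r(2) by (metis append_butlast_last_id)
    then obtain w where "aw w [e] v" using r(1) YC.awalk_appendE by metis
    then have "target e = v" by (simp add: aw_Cons aw_Nil)
    then show ?thesis using re by auto
  qed
  have "\<exists>e\<in>set h. fst e = y"
  proof (cases "b = []")
    case True
    then have "y = x" using assms(4) by (simp add: aw_Nil)
    then show ?thesis using 1[OF assms(1,2)] by simp
  qed (use 1[OF assms(4)] assms(5) in auto)
  moreover have "\<exists>e\<in>set h. target e = y"
  proof (cases "a = []")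
    case True
    then have "y = x" using assms(3) by (simp add: aw_Nil)
    then show ?thesis using 2[OF assms(1,2)] by simp
  qed (use 2[OF assms(3)] assms(5) in auto)
  ultimately show ?thesis using that by blast
qed

text \<open>The two reduced walks representing \<open>w\<^sub>x\<^sup>s\<^sup>,\<^sup>t\<close> bound a cell: products of initial segments determine
  vertices and conversely, because \<open>C\<^sub>x\<^sub>,\<^sub>x \<inter> W\<^sub>K\<close> is trivial.\<close>

lemma rank_two_homotopic:
  assumes x: "x \<in> V" and s: "s \<in> S - x ` \<Lambda>" and t: "t \<in> S - x ` \<Lambda>" and st:
    "s \<noteq> t"
    and fin: "finite_type (sim (x ` \<Lambda>) {s, t})"
    and v: "v = relative_w0 (sim (x ` \<Lambda>) {s, t}) {s, t}" "v \<in> YH z x"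
    and p: "p = (x, s) # p'" "aw x p z" "we p = v" "reduced p"
    and q: "q = (x, t) # q'" "aw x q z" "we q = v" "reduced q"
  shows "((x, p, z), (x, q, z)) \<in> homotopic YC"
proof -
  define J where "J = x ` \<Lambda> \<union> {s, t}"
  define K where "K = sim (x ` \<Lambda>) {s, t}"
  have R: "region J K x" unfolding J_def K_def by (rule region_sim) (use x s t fin in auto)
  note f = region_facts[OF R]
  have vK: "v \<in> parabolic K" using v(1) relative_w0_parabolic[OF f(7,6)] K_def by simp
  have Nv: "inv_set v = pos_on K - pos_on (K - {s, t})"
    using v(1) inv_set_relative_w0[OF f(7,6)] K_def by simp
  \<comment> \<open>An orthogonal root of K would involve s or t and hence be inverted by v, which
    lies in Y.\<close>
  have n: "pos_on K \<inter> perp_roots (x ` \<Lambda>) = {}"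
  proof (rule ccontr)
    assume "\<not> ?thesis"
    then obtain \<gamma> where g: "\<gamma> \<in> pos_on K" "\<gamma> \<in> perp_roots (x ` \<Lambda>)"
      by blast
    then have "\<not> ky \<gamma> \<subseteq> x ` \<Lambda>"
      using perp_root_outside[of \<gamma> "x ` \<Lambda>"] by (auto simp: pos_on_def)
    moreover have "K - {s, t} \<subseteq> x ` \<Lambda>" using f(4) J_def by blast
    ultimately have "\<gamma> \<in> inv_set v" using g Nv by (auto simp: pos_on_def)
    then show False using v(2) g by (auto simp: Y_hom_iff_inv_set)
  qed
  note uniq = parabolic_C_hom_unique[OF R n]
  have arcs: "e \<in> arcs (CJ J) \<and> elt e \<in> parabolic K" if "e \<in> set p \<union> set q" for e
  proof -
    have "we p \<in> parabolic K" "we q \<in> parabolic K" using p(3) q(3) vK by simp_all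
    then show ?thesis
      using reduced_walk_in_region[OF R p(2,4)] reduced_walk_in_region[OF R q(2,4)] that by blast
  qed
  have walkK: "we a \<in> parabolic K" if "set a \<subseteq> set p \<union> set q" for a
    using arcs CJ_arcsC that by (intro we_parabolic) blast
  have arcsC: "set p \<subseteq> arcsC" "set q \<subseteq> arcsC" using aw_arcsC p(2) q(2) by auto
  have sv: "- act g (simple_root s') \<in> pos_roots"
    if "aw x ((x, s') # a) m" "reduced ((x, s') # a)" "g = we ((x, s') # a)" for a m s' g
    using reduced_Cons_descent[OF that(1,2)] that(3) by simp
  \<comment> \<open>If nonempty initial segments of p and q end at the same vertex, their products
    agree and have both s and t as descents. The product is then at least as long as v, so the
    segments are the full walks.\<close>
  have prefix: "(a = [] \<and> a' = []) \<or> (b = [] \<and> b' = [])"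
    if d: "p = a @ b" "q = a' @ b'" "aw x a m" "aw x a' m" for a b a' b' m
  proof -
    have r: "reduced a" "reduced a'" using reduced_append(1) arcsC p(4) q(4) d(1,2) by metis+
    have eq: "we a = we a'"
      using uniq[OF walkK we_C_hom[OF d(3)] walkK we_C_hom[OF d(4)]] d(1,2) by auto
    have sa: "set a \<subseteq> arcsC" "set a' \<subseteq> arcsC" using arcsC d by auto
    have len: "wlen a = wlen a'" using r eq by (simp add: reduced_def)
    show ?thesis
    proof (cases "a = [] \<or> a' = []")
      case True
      then show ?thesis using len wlen_eq_0 sa by auto
    next
      case False
      then obtain a1 a1' where a1: "a = (x, s) # a1" "a' = (x, t) # a1'"
        using d(1,2) p(1) q(1) by (cases a; cases a') auto
      have "- act (we a) (simple_root s) \<in> pos_roots" "- act (we a) (simple_root t) \<in> pos_roots"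
        using sv[of s a1 m "we a"] sv[of t a1' m "we a"] d r eq a1 by auto
      then have "\<And>r. r \<in> {s, t} \<Longrightarrow> - act (we a) (simple_root r) \<in> pos_roots"
        by blast
      then have "len (we a) \<ge> len v"
        using C_hom_descents(3)[OF x aw_V(2)[OF d(3)] we_C_hom[OF d(3)], of "{s, t}"] s t v(1) by auto
      then have "wlen a \<ge> wlen p" "wlen a' \<ge> wlen q"
        using r p(3,4) q(3,4) len by (auto simp: reduced_def)
      then have "wlen b = 0" "wlen b' = 0" using d(1,2) by auto
      then show ?thesis using wlen_eq_0 arcsC d(1,2) by auto
    qed
  qed
  have v1: "v \<noteq> \<one>"
  proof -
    have "simple_root s \<in> pos_on K - pos_on (K - {s, t})"
      using simple_root_pos[of s] s subset_sim[of "{s, t}" "x ` \<Lambda>"] K_def by (auto simp: pos_on_def)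
    then show ?thesis using Nv inv_set_one by auto
  qed
  have xz: "x \<noteq> z"
    using uniq[OF vK Y_hom_C_hom[OF v(2)] parabolic_one] C_hom_one v1 by blast
  \<comment> \<open>Between two visits of a vertex the product would not change although the length
    grows.\<close>
  have dist: "distinct (YC.awalk_verts x r)"
    if r: "aw x r z" "reduced r" "set r \<subseteq> set p \<union> set q" for r
  proof (rule ccontr)
    assume "\<not> ?thesis"
    then obtain a b c w where d: "r = a @ b @ c" "0 < length b" "aw x a w" "aw w b w"
      using YC.awalk_not_distinct_decomp[OF r(1)] by blast
    have ab: "aw x (a @ b) w" using YC.awalk_appendI[OF d(3,4)] .
    have sub: "set ((a @ b) @ c) \<subseteq> arcsC" "set (a @ b) \<subseteq> arcsC"
      using aw_arcsC[OF r(1)] d(1) by auto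
    have "reduced (a @ b)" by (rule reduced_append(1)[OF sub(1)]) (use r(2) d(1) in simp)
    moreover from this have "reduced a" by (rule reduced_append(1)[OF sub(2)])
    moreover have "we (a @ b) = we a"
      using uniq[OF walkK we_C_hom[OF ab] walkK we_C_hom[OF d(3)]] r(3) d(1) by auto
    ultimately have "wlen b = 0" by (simp add: reduced_def)
    then show False using wlen_eq_0[of b] sub(2) d(2) by auto
  qed
  \<comment> \<open>For each vertex of the component at most one element of
    \<open>parabolic K\<close> leads there from x; its length serves as a height. All arcs of p and
    q go up and their opposites go down, so no arc is traversed in both directions.\<close>
  define up where "up e \<longleftrightarrow> (\<exists>g h. g \<in> parabolic K \<and> g \<in> CH (fst e) x \<and> h \<in> parabolic K \<and>
    h \<in> CH (target e) x \<and> len g < len h)" for e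
  have up_walk: "up e" if r: "aw x r z" "reduced r" "set r \<subseteq> set p \<union> set q" "e \<in> set r"
    for r e
  proof -
    obtain a b where d: "r = a @ e # b" using split_list[OF r(4)] by blast
    obtain w where w: "aw x a w" "aw w (e # b) z" using r(1) d YC.awalk_appendE by metis
    then have fe: "w = fst e" "e \<in> arcsC" "fst e \<noteq> target e" by (auto simp: aw_Cons)
    have "aw w [e] (target e)" using fe arcsC_facts(2) by (simp add: aw_Cons aw_Nil)
    then have ae: "aw x (a @ [e]) (target e)" using YC.awalk_appendI[OF w(1)] by blast
    have sub: "set ((a @ [e]) @ b) \<subseteq> arcsC" "set (a @ [e]) \<subseteq> arcsC"
      using aw_arcsC[OF r(1)] d by auto
    have r1: "reduced (a @ [e])" by (rule reduced_append(1)[OF sub(1)]) (use r(2) d in simp)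
    then have r2: "reduced a" by (rule reduced_append(1)[OF sub(2)])
    have "len (we a) < len (we (a @ [e]))" using r1 r2 arcsC_facts(5)[OF fe(2)] by (simp add: reduced_def)
    then show ?thesis unfolding up_def
      using we_C_hom[OF w(1)] we_C_hom[OF ae] walkK[of a] walkK[of "a @ [e]"] r(3) d fe(1) by auto
  qed
  have up: "up e" if "e \<in> set p \<union> set q" for e
    using that up_walk[OF p(2,4)] up_walk[OF q(2,4)] by blast
  have not_up: "\<not> up (oppo e)" if e: "e \<in> arcsC" "up e" for e
    unfolding up_def arc_oppo(2)[OF e(1)] arc_oppo(3)[OF e(1)]
    using e(2) uniq unfolding up_def by (metis less_asym)
  have pq: "set p \<inter> set q = {}"
  proof (rule ccontr)
    assume "\<not> ?thesis"
    then obtain e where e: "e \<in> set p" "e \<in> set q" by blast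
    obtain a b where d: "p = a @ e # b" using split_list[OF e(1)] by blast
    obtain a' b' where d': "q = a' @ e # b'" using split_list[OF e(2)] by blast
    obtain w where w: "aw x a w" "aw w (e # b) z" using p(2) d YC.awalk_appendE by metis
    obtain w' where w': "aw x a' w'" "aw w' (e # b') z" using q(2) d' YC.awalk_appendE by metis
    have "w = fst e" "w' = fst e" using w w' by (auto simp: aw_Cons)
    then have "a = []" "a' = []" using prefix[OF d d' w(1)] w'(1) by auto
    then show False using d d' p(1) q(1) st by auto
  qed
  define h where "h = p @ YC.rev_walk q"
  have hx: "aw x h x" unfolding h_def by (rule YC.awalk_appendI[OF p(2) YC.awalk_rev_walk[OF q(2)]])
  have seth: "set h = set p \<union> oppo ` set q" by (simp add: h_def YC.set_rev_walk)
  have opop: "oppo (oppo e) = e" if "e \<in> arcsC" for e using arc_oppo(4)[OF that] .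
  have seth': "oppo ` set h = oppo ` set p \<union> set q"
  proof -
    have "(\<lambda>e. oppo (oppo e)) ` set q = (\<lambda>e. e) ` set q"
      by (rule image_cong) (use opop arcsC in blast)+
    then show ?thesis unfolding seth image_Un image_image by simp
  qed
  have disj: "set h \<inter> oppo ` set h = {}"
  proof (rule ccontr)
    assume "\<not> ?thesis"
    then obtain e where "e \<in> set p \<union> oppo ` set q" "e \<in> oppo ` set p \<union> set q"
      using seth seth' by blast
    then consider f where "e \<in> set p" "f \<in> set p" "e = oppo f" | "e \<in> set p" "e \<in> set q"
      | f f' where "f \<in> set q" "f' \<in> set p" "oppo f = oppo f'" | f where "f \<in> set q"
        "e \<in> set q" "e = oppo f"
      by blast
    then show False
    proof cases
      case (1 f)
      then show False using not_up[of f] up arcsC by blast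
    next
      case 2
      then show False using pq by blast
    next
      case (3 f f')
      then have "f = f'" using opop arcsC by (metis subsetD)
      then show False using 3 pq by blast
    next
      case (4 f)
      then show False using not_up[of f] up arcsC by blast
    qed
  qed
  have hK: "e \<in> arcs (CJ J) \<and> elt e \<in> parabolic K" if e: "e \<in> set h" for e
  proof (cases "e \<in> set p")
    case False
    then obtain f' where f': "f' \<in> set q" "e = oppo f'" using e seth by blast
    then have fc: "f' \<in> arcs (CJ J)" "elt f' \<in> parabolic K" using arcs by auto
    have "elt e = inv elt f'" using f'(2) arc_oppo(5)[OF CJ_arcsC[OF fc(1)]] by simp
    then show ?thesis using f'(2) CJ_oppo[OF fc(1)] parabolic_inv[OF f(7) fc(2)] by simp
  qed (use arcs in auto)
  have harcs: "set h \<subseteq> arcs (CJ J)" using hK by blast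
  define G where "G = component_of (CJ J) x"
  have xc: "x \<in> comp_verts J x" using comp_verts_base region_CJ(1)[OF R] by blast
  have hG: "set h \<subseteq> arcs G" unfolding G_def by (rule walk_in_component[OF hx xc harcs])
  have oppG: "oppo e \<in> arcs G" if "e \<in> arcs G" for e
  proof -
    have e: "e \<in> arcs (CJ J)" "fst e \<in> comp_verts J x" "target e \<in> comp_verts J x"
      using that by (simp_all add: G_def)
    then show ?thesis unfolding G_def component_CJ
      using CJ_oppo[OF e(1)] arc_oppo(2,3)[OF CJ_arcsC[OF e(1)]] by simp
  qed
  have J2: "card (J - x ` \<Lambda>) = 2"
  proof -
    have "J - x ` \<Lambda> = {s, t}" using s t J_def by auto
    then show ?thesis using st by simp
  qed
  have hne: "h \<noteq> []" using p(1) h_def by simp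
  \<comment> \<open>Two members of J are missing at each vertex, so at most two arcs leave it inside
    J. The arc by which h leaves and the opposite of the arc by which h enters account for both,
    hence h exhausts the component.\<close>
  have out: "e \<in> set h \<union> oppo ` set h"
    if m: "m \<in> set (YC.awalk_verts x h)" and e: "e \<in> arcs (CJ J)" "fst e = m" for m e
  proof -
    obtain a b where d: "h = a @ b" "aw x a m" "aw m b x" using YC.awalk_decomp[OF hx m] by blast
    have aK: "we a \<in> parabolic K" using hK CJ_arcsC d(1) by (intro we_parabolic) auto
    note Rm = region_move[OF R aK we_C_hom[OF d(2)] aw_V(2)[OF d(2)]]
    obtain e1 e2 where e12: "e1 \<in> set h" "fst e1 = m" "e2 \<in> set h" "target e2 = m"
      using closed_walk_out_arc[OF hx hne d(2,3,1)] by blast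
    have e2J: "e2 \<in> arcs (CJ J)" using harcs e12(3) by blast
    have e2: "oppo e2 \<in> arcs (CJ J)" "fst (oppo e2) = m"
      using CJ_oppo[OF e2J] arc_oppo(2)[OF CJ_arcsC[OF e2J]] e12(4) by simp_all
    have "e1 \<noteq> oppo e2" using disj e12 by blast
    have snd: "snd e' \<in> J - m ` \<Lambda>" if "e' \<in> arcs (CJ J)" "fst e' = m" for e'
      using that by (cases e') (simp add: arcsC_iff)
    have ne: "snd e1 \<noteq> snd (oppo e2)"
      using \<open>e1 \<noteq> oppo e2\<close> e12 e2 by (metis prod_eqI)
    have e1J: "e1 \<in> arcs (CJ J)" using harcs e12(1) by blast
    have sub: "{snd e1, snd (oppo e2)} \<subseteq> J - m ` \<Lambda>"
      using snd[OF e1J e12(2)] snd[OF e2] by simp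
    have c2: "card {snd e1, snd (oppo e2)} = card (J - m ` \<Lambda>)" using ne Rm(2) J2 by simp
    have "finite (J - m ` \<Lambda>)" using Rm(2) J2 by (intro card_ge_0_finite) simp
    from card_subset_eq[OF this sub c2] have "J - m ` \<Lambda> = {snd e1, snd (oppo e2)}" by (rule sym)
    then have "snd e = snd e1 \<or> snd e = snd (oppo e2)" using snd[OF e] by blast
    then have "e = e1 \<or> e = oppo e2" using e(2) e12(2) e2(2) by (metis prod_eqI)
    then show ?thesis using e12 by blast
  qed
  have verts_h: "target e \<in> set (YC.awalk_verts x h)" "fst e \<in> set (YC.awalk_verts x h)"
    if "e \<in> set h" for e
    using YC.set_awalk_verts[OF hx] that by auto
  have comp: "y \<in> set (YC.awalk_verts x h)" if "y \<in> comp_verts J x" for y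
    using that
  proof (induction rule: comp_verts_induct)
    case base
    show ?case using YC.set_awalk_verts[OF hx] by simp
  next
    case (step e)
    then have "e \<in> set h \<union> oppo ` set h" using out by blast
    then show ?case
    proof
      assume "e \<in> oppo ` set h"
      then obtain e' where "e' \<in> set h" "e = oppo e'" by blast
      moreover from this have "e' \<in> arcsC" using harcs CJ_arcsC by blast
      ultimately show ?thesis using verts_h(2)[of e'] arc_oppo(3)[of e'] by simp
    qed (use verts_h in blast)
  qed
  have arcsG: "arcs G = set h \<union> oppo ` set h"
  proof
    show "arcs G \<subseteq> set h \<union> oppo ` set h"
    proof
      fix e assume "e \<in> arcs G"
      then have "e \<in> arcs (CJ J)" "fst e \<in> comp_verts J x" by (simp_all add: G_def)
      then show "e \<in> set h \<union> oppo ` set h" using out comp by blast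
    qed
    show "set h \<union> oppo ` set h \<subseteq> arcs G" using hG oppG by blast
  qed
  have verts_eq: "YC.awalk_verts x h = YC.awalk_verts x p @ tl (rev (YC.awalk_verts x q))"
    using YC.awalk_verts_append[OF hx[unfolded h_def]] YC.awalk_verts_rev_walk[OF q(2)] p(2) h_def by simp
  \<comment> \<open>The two sides share no vertex other than x and z by \<open>prefix\<close>;
    dropping the head of the list removes the repetition of the base point.\<close>
  have dist_h: "distinct (tl (YC.awalk_verts x h))"
  proof -
    let ?P = "YC.awalk_verts x p" and ?Q = "YC.awalk_verts x q"
    have dP: "distinct ?P" "distinct ?Q" using dist p(2,4) q(2,4) by auto
    have hdP: "?P = x # tl ?P" using p(1) by simp
    have lastQ: "last ?Q = z" using q(2) by simp
    have "?Q \<noteq> []" by simp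
    then have revQ: "rev ?Q = z # tl (rev ?Q)" using lastQ by (metis hd_rev list.collapse rev_is_Nil_conv)
    have "set (tl ?P) \<inter> set (tl (rev ?Q)) = {}"
    proof (rule ccontr)
      assume "\<not> ?thesis"
      then obtain m where m: "m \<in> set (tl ?P)" "m \<in> set (tl (rev ?Q))" by blast
      have "m \<noteq> x" using m(1) dP(1) hdP by (metis distinct.simps(2))
      moreover have "distinct (rev ?Q)" using dP(2) by simp
      then have "m \<noteq> z" using m(2) revQ by (metis distinct.simps(2))
      moreover have "m \<in> set ?P" "m \<in> set ?Q" using m hdP revQ by (metis list.set_intros(2) set_rev)+
      then obtain a b a' b' where "p = a @ b" "aw x a m" "aw m b z" "q = a' @ b'" "aw x a' m" "aw m b' z"
        using YC.awalk_decomp[OF p(2)] YC.awalk_decomp[OF q(2)] by meson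
      then have "m = x \<or> m = z" using prefix[of a b a' b' m] by (auto simp: aw_Nil)
      ultimately show False by blast
    qed
    moreover have "tl (YC.awalk_verts x h) = tl ?P @ tl (rev ?Q)"
      using verts_eq hdP by (metis list.sel(3) append_Cons)
    ultimately show ?thesis using dP by (simp add: distinct_tl)
  qed
  have cyc: "pre_digraph.cycle (skel YC) h" unfolding YC.cycle_def using hx dist_h hne by blast
  have tG: "tail G = tail (skel YC)" "head G = head (skel YC)" by (simp_all add: G_def)
  have "pre_digraph.awalk G x h x"
    unfolding pre_digraph.awalk_def using hx hG xc cas_cong[OF tG] by (simp add: G_def YC.awalk_def)
  then have "pre_digraph.cycle G h"
    unfolding pre_digraph.cycle_def using dist_h hne awalk_verts_cong[OF tG, of x h] by auto
  then have "traverses G oppo h (arcs G)" using disj arcsG by (simp add: traverses_def)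
  moreover have "tail G e \<noteq> head G e" if "e \<in> arcs G" for e
  proof -
    have nl: "fst e' \<noteq> target e'" if "e' \<in> set h" for e' using YC.awalk_arcs[OF hx] that by auto
    from that arcsG consider "e \<in> set h" | e' where "e' \<in> set h" "e = oppo e'" by blast
    then show ?thesis
    proof cases
      case 2
      then have "e' \<in> arcsC" using harcs CJ_arcsC by blast
      then show ?thesis using 2 nl[of e'] arc_oppo(2,3)[of e'] tG by simp
    qed (use nl tG in simp)
  qed
  ultimately have "cycle_without_loops G oppo" by (auto simp: cycle_without_loops_def)
  then have cell: "arcs G \<in> cells YC"
    unfolding Y_complex_def using x s t st fin G_def J_def by auto
  have trav: "traverses (skel YC) (opp YC) h (arcs G)" using cyc disj arcsG by (simp add: traverses_def)
  have "aw x [] x" using x by (simp add: aw_Nil)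
  then have "((x, [] @ h @ [], x), (x, [] @ [], x)) \<in> homotopy_step YC"
    unfolding homotopy_step_def using hx cell trav
    by (intro CollectI exI[of _ x] exI[of _ "[]"] exI[of _ h]) auto
  then have "((x, p @ YC.rev_walk q, x), (x, [], x)) \<in> homotopic YC"
    using YC.homotopy_step_homotopic h_def by simp
  then show ?thesis by (rule YC.homotopic_if_loop_trivial[OF p(2) q(2)])
qed

section \<open>Walks with the same product are homotopic\<close>

lemma homotopic_Cons:
  assumes "aw x (e # p) y" "((target e, p, y), (target e, q, y)) \<in> homotopic YC"
  shows "((x, e # p, y), (x, e # q, y)) \<in> homotopic YC"
proof -
  have a: "e \<in> arcsC" "x = fst e" "fst e \<noteq> target e" "aw (target e) p y"
    using assms(1) by (simp_all add: aw_Cons)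
  have e: "aw x [e] (target e)" "aw y [] y"
    using a(1-3) arcsC_facts(2)[OF a(1)] aw_V(2)[OF a(4)] by (simp_all add: aw_Cons aw_Nil)
  show ?thesis using YC.homotopic_context[OF assms(2) e] by simp
qed

text \<open>As for braid relations among reduced words: if the first arcs belong to s and t, both
  are descents of the product, so it is divisible by the element of rank two. Its two reduced walks,
  prolonged by a common reduced walk, interpolate between p and q.\<close>

lemma reduced_walks_homotopic:
  assumes "aw x p y" "aw x q y" "reduced p" "reduced q" "we p = we q"
  shows "((x, p, y), (x, q, y)) \<in> homotopic YC"
  using assms
proof (induction "len (we p)" arbitrary: x p q rule: less_induct)
  case less
  note xp = less.prems(1) and xq = less.prems(2) and rp = less.prems(3) and rq = less.prems(4) and eq = less.prems(5)
  have ac: "set p \<subseteq> arcsC" "set q \<subseteq> arcsC" using aw_arcsC xp xq by auto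
  have wl: "wlen p = wlen q" using rp rq eq by (simp add: reduced_def)
  have x: "x \<in> V" "y \<in> V" using aw_V xp by auto
  \<comment> \<open>A common first arc is cancelled, which makes the product shorter and allows the
    induction hypothesis.\<close>
  have same: "((x, (x, s) # p1, y), (x, (x, s) # p2, y)) \<in> homotopic YC"
    if a: "aw x ((x, s) # p1) y" "aw x ((x, s) # p2) y" and r: "reduced ((x, s) # p1)" "reduced ((x, s) # p2)"
      and e: "we ((x, s) # p1) = we p" "we ((x, s) # p2) = we p" for s p1 p2
  proof (rule homotopic_Cons[OF a(1)])
    have sub: "set ([(x, s)] @ p1) \<subseteq> arcsC" "set ([(x, s)] @ p2) \<subseteq> arcsC"
      using aw_arcsC[OF a(1)] aw_arcsC[OF a(2)] by auto
    have s: "(x, s) \<in> arcsC" using sub by simp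
    have a': "aw (target (x, s)) p1 y" "aw (target (x, s)) p2 y" using a by (auto simp: aw_Cons)
    have r': "reduced p1" "reduced p2"
      using reduced_append(2)[OF sub(1)] reduced_append(2)[OF sub(2)] r by simp_all
    have "we p1 \<otimes> elt (x, s) = we p2 \<otimes> elt (x, s)"
      using e we_Cons[of "(x, s)" p1] we_Cons[of "(x, s)" p2] sub by simp
    moreover have "we p1 \<in> carrier W" "we p2 \<in> carrier W" "elt (x, s) \<in> carrier W"
      using sub elt_carrier[OF s] by auto
    ultimately have e': "we p1 = we p2" by simp
    have "len (we p1) < len (we p)" using r(1) r'(1) e(1) len_elt_pos[OF s] by (simp add: reduced_def)
    then show "((target (x, s), p1, y), (target (x, s), p2, y)) \<in> homotopic YC"
      using less.hyps[OF _ a' r' e'] by blast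
  qed
  show ?case
  proof (cases "p = [] \<or> q = []")
    case True
    then have "p = []" "q = []" using wl wlen_eq_0 ac by auto
    then show ?thesis by (simp add: YC.homotopic_refl)
  next
    case False
    then obtain e1 p' e2 q' where e12: "p = e1 # p'" "q = e2 # q'" by (meson neq_Nil_conv)
    then have "fst e1 = x" "fst e2 = x" using xp xq by (simp_all add: aw_Cons)
    then obtain s t where pq: "p = (x, s) # p'" "q = (x, t) # q'" using e12 by (metis prod.collapse)
    show ?thesis
    proof (cases "s = t")
      case True
      then show ?thesis using same[of s p' q'] xp xq rp rq eq pq by simp
    next
      case False
      let ?w = "we p"
      let ?K = "sim (x ` \<Lambda>) {s, t}"
      let ?v = "relative_w0 ?K {s, t}"
      have wY: "?w \<in> YH y x" by (rule we_Y_hom[OF xp])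
      have st: "s \<in> S - x ` \<Lambda>" "t \<in> S - x ` \<Lambda>"
        using ac pq arc_facts(2,3)[of x s] arc_facts(2,3)[of x t] by auto
      have neg: "- act ?w (simple_root r) \<in> pos_roots" if "r \<in> {s, t}" for r
        using reduced_Cons_descent[of x s p' y] reduced_Cons_descent[of x t q' y] xp xq rp rq eq pq that
          by auto
      have stS: "{s, t} \<subseteq> S" "{s, t} \<inter> x ` \<Lambda> = {}" using st by auto
      note d = C_hom_descents[OF x we_C_hom[OF xp] stS(1) neg]
      have KS: "?K \<subseteq> S" using sim_subset[of "x ` \<Lambda>" "{s, t}"] stS V_image[OF x(1)] by blast
      obtain z where z: "z \<in> V" "?v \<in> CH z x" using relative_w0_target_ex[OF x(1) stS d(1)] .
      have vW: "?v \<in> carrier W" and wW: "?w \<in> carrier W" using z(2) wY Y_hom_C_hom C_homD(1) by blast+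
      have vY: "?v \<in> YH z x" using z(2) d(2) wY by (auto simp: Y_hom_iff_inv_set)
      have w'Y: "?w \<otimes> inv ?v \<in> YH y z" using Y_hom_mult[OF z(1) wY Y_hom_inv[OF x(1) z(1) vY]] .
      have vneg: "- act ?v (simple_root r) \<in> pos_roots" if "r \<in> {s, t}" for r
      proof -
        have "simple_root r \<in> pos_on ?K - pos_on (?K - {s, t})"
          using that stS simple_root_pos[of r] subset_sim[of "{s, t}" "x ` \<Lambda>"]
            by (auto simp: pos_on_def)
        then show ?thesis using inv_set_relative_w0[OF KS d(1)] by (auto simp: inv_set_def)
      qed
      obtain p1 where p1: "aw x ((x, s) # p1) z" "we ((x, s) # p1) = ?v" "reduced ((x, s) # p1)"
        using reduced_walk_first_arc[OF x(1) z(1) vY _ vneg] st by blast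
      obtain q1 where q1: "aw x ((x, t) # q1) z" "we ((x, t) # q1) = ?v" "reduced ((x, t) # q1)"
        using reduced_walk_first_arc[OF x(1) z(1) vY _ vneg] st by blast
      obtain r where r: "aw z r y" "we r = ?w \<otimes> inv ?v" "reduced r"
        using reduced_walk_ex[OF z(1) x(2) w'Y] by blast
      have mid: "((x, (x, s) # p1, z), (x, (x, t) # q1, z)) \<in> homotopic YC"
        by (rule rank_two_homotopic[OF x(1) st False d(1) refl vY refl p1 refl q1])
      have ext: "aw x (u @ r) y" "we (u @ r) = ?w" "reduced (u @ r)"
        if u: "aw x u z" "we u = ?v" "reduced u" for u
      proof -
        show "aw x (u @ r) y" by (rule YC.awalk_appendI[OF u(1) r(1)])
        show w: "we (u @ r) = ?w"
          using we_append[OF aw_arcsC[OF u(1)] aw_arcsC[OF r(1)]] u(2) r(2) vW wW by (simp add: m_assoc)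
        show "reduced (u @ r)" using w d(3) u(2,3) r(2,3) by (simp add: reduced_def)
      qed
      note P = ext[OF p1] and Q = ext[OF q1]
      have "((x, (x, s) # p', y), (x, (x, s) # (p1 @ r), y)) \<in> homotopic YC"
        by (rule same) (use P xp rp pq(1) in simp_all)
      moreover have "((x, (x, t) # (q1 @ r), y), (x, (x, t) # q', y)) \<in> homotopic YC"
        by (rule same) (use Q xq rq pq(2) eq in simp_all)
      moreover have "((x, (x, s) # (p1 @ r), y), (x, (x, t) # (q1 @ r), y)) \<in> homotopic YC"
        using YC.homotopic_append[OF mid YC.homotopic_refl p1(1) r(1)] by simp
      ultimately show ?thesis using YC.homotopic_trans pq by blast
    qed
  qed
qed

text \<open>The rest of the walk may be replaced by a reduced one. If prefixing e adds its length,
  the result is reduced and the preceding lemma applies. Otherwise the opposite of e followed by q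
  is a reduced walk for the rest, and e cancels against its opposite.\<close>

lemma walk_homotopic_reduced:
  assumes "aw x p y" "aw x q y" "reduced q" "we q = we p"
  shows "((x, p, y), (x, q, y)) \<in> homotopic YC"
  using assms
proof (induction p arbitrary: x q)
  case Nil
  then have "wlen q = 0" by (simp add: reduced_def)
  then have "q = []" using wlen_eq_0 aw_arcsC Nil.prems(2) by blast
  then show ?case by (simp add: YC.homotopic_refl)
next
  case (Cons e p)
  obtain s where e: "e = (x, s)" using Cons.prems(1) by (cases e) (auto simp: aw_Cons)
  let ?u = "elt (x, s)" and ?x' = "target (x, s)"
  have a: "(x, s) \<in> arcsC" "aw ?x' p y" "?x' \<noteq> x" using Cons.prems(1) e by (auto simp: aw_Cons)
  have V: "x \<in> V" "?x' \<in> V" "y \<in> V" using aw_V a(2) Cons.prems(1) by auto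
  have ac: "set p \<subseteq> arcsC" "set q \<subseteq> arcsC" using aw_arcsC a(2) Cons.prems(2) by auto
  have c: "we p \<in> carrier W" "?u \<in> carrier W" using ac elt_carrier[OF a(1)] by auto
  have wep: "we (e # p) = we p \<otimes> ?u" using we_Cons[of e p] ac a(1) e by simp
  obtain q' where q': "aw ?x' q' y" "we q' = we p" "reduced q'"
    using reduced_walk_ex[OF V(2,3) we_Y_hom[OF a(2)]] by blast
  have "((?x', p, y), (?x', q', y)) \<in> homotopic YC" by (rule Cons.IH[OF a(2) q'(1,3,2)])
  then have h1: "((x, e # p, y), (x, e # q', y)) \<in> homotopic YC"
    using homotopic_Cons[OF Cons.prems(1)] e by simp
  have awq': "aw x (e # q') y" using q'(1) a e by (simp add: aw_Cons)
  have weq': "we (e # q') = we p \<otimes> ?u" using we_Cons[of e q'] aw_arcsC[OF q'(1)] a(1) e q'(2) by simp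
  note L = C_hom_arc_length[OF a(1) V(3) we_C_hom[OF a(2)]]
  show ?case
  proof (cases "- act (we p \<otimes> ?u) (simple_root s) \<in> pos_roots")
    case True
    have "reduced (e # q')" using L(1)[OF True] q'(2,3) weq' e by (simp add: reduced_def)
    then have "((x, e # q', y), (x, q, y)) \<in> homotopic YC"
      using reduced_walks_homotopic[OF awq' Cons.prems(2)] Cons.prems(3,4) weq' wep by simp
    then show ?thesis using YC.homotopic_trans h1 by blast
  next
    case False
    note o = arc_oppo[OF a(1)]
    have oq: "aw ?x' (oppo e # q) y" using o(1-3) a(3) Cons.prems(2) e by (simp add: aw_Cons)
    have w: "we (oppo e # q) = we p"
      using we_Cons[of "oppo e" q] ac o(1,5) Cons.prems(4) wep c e by (simp add: m_assoc)
    have "reduced (oppo e # q)"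
      using w L(2)[OF False] Cons.prems(3,4) wep o(5) c len_inv[of ?u] e by (simp add: reduced_def)
    then have "((?x', q', y), (?x', oppo e # q, y)) \<in> homotopic YC"
      using reduced_walks_homotopic[OF q'(1) oq q'(3)] q'(2) w by simp
    then have h2: "((x, e # q', y), (x, e # oppo e # q, y)) \<in> homotopic YC"
      using homotopic_Cons[OF awq'] e by simp
    have "aw x (e # oppo e # q) y" using oq a e by (simp add: aw_Cons)
    then have "((x, [] @ [e, opp YC e] @ q, y), (x, [] @ q, y)) \<in> homotopic YC"
      by (intro YC.homotopic_backtrack) simp
    then have "((x, e # oppo e # q, y), (x, q, y)) \<in> homotopic YC" by simp
    then show ?thesis by (rule YC.homotopic_trans[OF h1 YC.homotopic_trans[OF h2]])
  qed
qed

lemma homotopy_step_we: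
  assumes "((x, p, y), (x, q, y)) \<in> homotopy_step YC" shows "we p = we q"
  using assms
proof (rule YC.homotopy_stepE)
  fix u v a b c
  assume *: "(x, p, y) = (u, a @ b @ c, v)" "(x, q, y) = (u, a @ c, v)" "aw u (a @ b @ c) v" "aw u (a @ c) v"
    and alt: "(\<exists>e. b = [e, opp YC e]) \<or> (\<exists>D\<in>cells YC. traverses (skel YC) (opp YC) b D)"
  obtain z where z: "aw u a z" "aw z (b @ c) v" using *(3) by (rule YC.awalk_appendE)
  obtain z' where z': "aw z b z'" "aw z' c v" using z(2) by (rule YC.awalk_appendE)
  have ac: "set a \<subseteq> arcsC" "set b \<subseteq> arcsC" "set c \<subseteq> arcsC"
    using aw_arcsC z z' by blast+
  have "we b = \<one>"
    using alt
  proof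
    assume "\<exists>e. b = [e, opp YC e]"
    then obtain e where b: "b = [e, oppo e]" by auto
    then have e: "e \<in> arcsC" using ac by simp
    then show ?thesis
      using b we_Cons[of e "[oppo e]"] we_Cons[of "oppo e" "[]"] arc_oppo[OF e] arcsC_facts(4)[OF e] by simp
  next
    assume "\<exists>D\<in>cells YC. traverses (skel YC) (opp YC) b D"
    then obtain D where D: "D \<in> cells YC" "traverses (skel YC) (opp YC) b D" by blast
    then obtain x' where "aw x' b x'" "b \<noteq> []" by (auto simp: traverses_def YC.cycle_def)
    \<comment> \<open>The cycle condition supplies some base point; the first arc identifies it with
      the vertex reached by a.\<close>
    moreover from this have "x' = z" using z'(1) by (cases b) (auto simp: aw_Cons)
    ultimately show ?thesis using cell_boundary_trivial[OF D] by simp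
  qed
  then have "we (a @ b @ c) = we (a @ c)" using ac by (simp add: we_append)
  then show ?thesis using * by simp
qed

lemma homotopic_iff:
  assumes p: "aw x p y" and q: "aw x q y"
  shows "we p = we q \<longleftrightarrow> ((x, p, y), (x, q, y)) \<in> homotopic YC"
proof
  assume eq: "we p = we q"
  obtain r where r: "aw x r y" "we r = we p" "reduced r"
    using reduced_walk_ex[OF aw_V[OF p] we_Y_hom[OF p]] by blast
  have "((x, p, y), (x, r, y)) \<in> homotopic YC" "((x, q, y), (x, r, y)) \<in> homotopic YC"
    using walk_homotopic_reduced p q r eq by simp_all
  then show "((x, p, y), (x, q, y)) \<in> homotopic YC"
    using YC.homotopic_trans YC.homotopic_sym by blast
next
  assume "((x, p, y), (x, q, y)) \<in> homotopic YC"
  then have "\<exists>r. (x, q, y) = (x, r, y) \<and> we p = we r"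
    by (rule YC.homotopic_induct) (use homotopy_step_we in auto)
  then show "we p = we q" by simp
qed

lemma groupoid_Y: "groupoid (Y_groupoid \<Lambda> xI)"
proof
  fix x y f assume *: "x \<in> Obj (Y_groupoid \<Lambda> xI)" "y \<in> Obj (Y_groupoid \<Lambda> xI)"
    "f \<in> Hom (Y_groupoid \<Lambda> xI) x y"
  then have f: "x \<in> V" "y \<in> V" "f \<in> YH x y" by (simp_all add: Y_groupoid_def)
  then have fW: "f \<in> carrier W" using Y_hom_C_hom C_homD(1) by blast
  then show "Comp (Y_groupoid \<Lambda> xI) (Ident (Y_groupoid \<Lambda> xI) x) f = f"
    "Comp (Y_groupoid \<Lambda> xI) f (Ident (Y_groupoid \<Lambda> xI) y) = f"
    by (simp_all add: Y_groupoid_def)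
  show "\<exists>g\<in>Hom (Y_groupoid \<Lambda> xI) y x. Comp (Y_groupoid \<Lambda> xI) f g = Ident (Y_groupoid \<Lambda> xI) x \<and>
      Comp (Y_groupoid \<Lambda> xI) g f = Ident (Y_groupoid \<Lambda> xI) y"
    using Y_hom_inv[OF f(2,1,3)] fW by (intro bexI[of _ "inv f"]) (simp_all add: Y_groupoid_def)
next
  fix x y z u f g h
  assume "f \<in> Hom (Y_groupoid \<Lambda> xI) x y" "g \<in> Hom (Y_groupoid \<Lambda> xI) y z"
    "h \<in> Hom (Y_groupoid \<Lambda> xI) z u"
  then have "f \<in> YH x y" "g \<in> YH y z" "h \<in> YH z u" by (simp_all add: Y_groupoid_def)
  then have "f \<in> carrier W" "g \<in> carrier W" "h \<in> carrier W"
    using Y_hom_C_hom C_homD(1) by blast+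
  then show "Comp (Y_groupoid \<Lambda> xI) (Comp (Y_groupoid \<Lambda> xI) f g) h =
      Comp (Y_groupoid \<Lambda> xI) f (Comp (Y_groupoid \<Lambda> xI) g h)"
    by (simp add: Y_groupoid_def m_assoc)
qed (simp_all add: Y_groupoid_def Y_hom_one Y_hom_mult)

lemma Y_groupoid_iso:
  "\<exists>\<phi>. groupoid_iso (fundamental_groupoid YC) (Y_groupoid \<Lambda> xI) id \<phi> \<and>
    (\<forall>x p y. aw x p y \<longrightarrow> \<phi> (homotopy_class YC (x, p, y)) = we p)"
proof (rule YC.groupoid_isoI)
  fix x y z p q assume "aw y p x" "aw z q y"
  then show "we (q @ p) = Comp (Y_groupoid \<Lambda> xI) (we p) (we q)"
    using we_append aw_arcsC by (simp add: Y_groupoid_def)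
next
  fix x y h assume "x \<in> verts (skel YC)" "y \<in> verts (skel YC)"
    "h \<in> Hom (Y_groupoid \<Lambda> xI) x y"
  then show "\<exists>p. aw y p x \<and> we p = h"
    using reduced_walk_ex[of y x h] by (auto simp: Y_groupoid_def)
qed (use we_Y_hom homotopic_iff in \<open>simp_all add: Y_groupoid_def\<close>)

end

theorem theorem4p10:
  fixes W :: "('a, 'b) monoid_scheme" and S I :: "'a set"
    and \<Lambda> :: "'l set" and xI :: "'l \<Rightarrow> 'a"
  assumes "coxeter_system W S"
    and "I \<subseteq> S"
    and "xI \<in> coxeter_system.injections S \<Lambda>"
    and "xI ` \<Lambda> = I"
  shows "groupoid (coxeter_system.Y_groupoid W S \<Lambda> xI) \<and>
    groupoid (fundamental_groupoid (coxeter_system.Y_complex W S \<Lambda> xI)) \<and>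
    (\<exists>\<phi>. groupoid_iso (fundamental_groupoid (coxeter_system.Y_complex W S \<Lambda> xI))
                (coxeter_system.Y_groupoid W S \<Lambda> xI) id \<phi> \<and>
           (\<forall>x p y. pre_digraph.awalk (skel (coxeter_system.Y_complex W S \<Lambda> xI)) x p y \<longrightarrow>
              \<phi> (homotopy_class (coxeter_system.Y_complex W S \<Lambda> xI) (x, p, y)) =
                coxeter_system.walk_elt W S \<Lambda> p)) \<and>
    (\<forall>x\<in>coxeter_system.C_vertices W S \<Lambda> xI.
           vertex_group (coxeter_system.Y_groupoid W S \<Lambda> xI) x \<cong>
             fundamental_group (coxeter_system.Y_complex W S \<Lambda> xI) x)"
proof -
  interpret L: labelled_coxeter_system W S \<Lambda> xI
    by (intro labelled_coxeter_system.intro labelled_coxeter_system_axioms.intro assms(1,3))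
  obtain \<phi> where \<phi>: "groupoid_iso (fundamental_groupoid L.YC) (L.Y_groupoid \<Lambda> xI) id \<phi>"
    "\<forall>x p y. L.aw x p y \<longrightarrow> \<phi> (homotopy_class L.YC (x, p, y)) = L.we p"
    using L.Y_groupoid_iso by blast
  have "vertex_group (L.Y_groupoid \<Lambda> xI) x \<cong> fundamental_group L.YC x" if "x \<in> L.V" for x
    unfolding fundamental_group_def
    by (rule groupoid_iso_vertex_group[OF L.YC.groupoid_FG \<phi>(1)]) (use that in \<open>simp add: L.YC.Obj_FG\<close>)
  then show ?thesis using L.groupoid_Y L.YC.groupoid_FG \<phi> by blast
qed

end
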